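(* Let $k\ge 1$, let $a_1,\ldots,a_k$ be distinct complex numbers with $a_j\notin\{0,1\}$, let $m_1,\ldots,m_k$ be positive integers, put $d=\sum_{j=1}^k m_j$, and let $\alpha,\beta,\gamma,\delta$ be complex numbers with $\gamma+\delta=\alpha+\beta+1+d$. Let $P$ be a polynomial of the form $P(z)=\gamma\delta z^k+(\text{a polynomial of degree at most }k-1)$, and consider the differential equation $$y''-\left(\frac{\alpha}{z}+\frac{\beta}{z-1}+\sum_{i=1}^k\frac{m_i}{z-a_i}\right)y'+\frac{P(z)}{z(z-1)\prod_{i=1}^k(z-a_i)}\,y=0.\qquad (E)$$ Assume that the singularities of $(E)$ at $a_1,\ldots,a_k$ are all apparent and that $$\gamma,\ \delta,\ \gamma-\alpha-1,\ \delta-\alpha-1\ \notin\ \{0,1,\ldots,d-1\}.$$ Then there exists a polynomial $Q$ of degree $d$ such that every solution of $(E)$ has the form $Q\big(z\frac{\mathrm d}{\mathrm dz}\big)F(z)$, where $F$ is a solution of the hypergeometric equation $$F''-\left(\frac{\alpha}{z}+\frac{\beta+d}{z-1}\right)F'+\frac{\gamma\delta}{z(z-1)}\,F=0.\qquad (H)$$ In particular, the monodromy group of $(E)$ coincides with that of $(H)$.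
   Context: A singularity $a$ of a second order linear differential equation is called apparent if the ratio of any two linearly independent solutions is meromorphic at $a$. The exponents of $(E)$ are $0,\alpha+1$ at $z=0$; $0,\beta+1$ at $z=1$; $0,m_j+1$ at $z=a_j$; and $-\gamma,-\delta$ at $\infty$. Solutions are understood as (multivalued) analytic functions on the complement of the singularities, i.e. local solutions near a base point continued analytically along paths; $Q\big(z\frac{\mathrm d}{\mathrm dz}\big)$ is the linear differential operator obtained by substituting the operator $z\frac{\mathrm d}{\mathrm dz}$ for the variable of $Q$. The monodromy group of an equation is the group of linear transformations of its (two-dimensional) space of local solutions at a base point obtained by analytic continuation along loops in the complement of the singularities; the monodromy groups of $(E)$ and $(H)$ are compared as matrix groups up to the choice of bases of the solution spaces. *)

theory Defs
  imports "HOL-Complex_Analysis.Complex_Analysis" "HOL-Computational_Algebra.Polynomial"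
begin

text \<open>
  A second order equation \<open>y'' + p y' + q y = 0\<close> is given by its coefficients \<open>p\<close>, \<open>q\<close> and the
  complement \<open>\<Omega>\<close> of its finite singularities. Germs at \<open>b\<close> are represented by functions on the
  whole plane, of which only the values near \<open>b\<close> matter.
\<close>

definition germ_eq :: "complex \<Rightarrow> (complex \<Rightarrow> complex) \<Rightarrow> (complex \<Rightarrow> complex) \<Rightarrow> bool" where
  "germ_eq b f g \<longleftrightarrow> (\<forall>\<^sub>F z in nhds b. f z = g z)"

definition local_solution ::
    "(complex \<Rightarrow> complex) \<Rightarrow> (complex \<Rightarrow> complex) \<Rightarrow> complex \<Rightarrow> (complex \<Rightarrow> complex) \<Rightarrow> bool" where
  "local_solution p q b y \<longleftrightarrow>
     y analytic_on {b} \<and>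
     (\<forall>\<^sub>F z in nhds b. deriv (deriv y) z + p z * deriv y z + q z * y z = 0)"

definition germs_independent :: "complex \<Rightarrow> (2 \<Rightarrow> complex \<Rightarrow> complex) \<Rightarrow> bool" where
  "germs_independent b Y \<longleftrightarrow>
     (\<forall>c. germ_eq b (\<lambda>z. \<Sum>i\<in>UNIV. c i * Y i z) (\<lambda>_. 0) \<longrightarrow> (\<forall>i. c i = 0))"

definition solution_basis ::
    "(complex \<Rightarrow> complex) \<Rightarrow> (complex \<Rightarrow> complex) \<Rightarrow> complex \<Rightarrow> (2 \<Rightarrow> complex \<Rightarrow> complex) \<Rightarrow> bool" where
  "solution_basis p q b Y \<longleftrightarrow>
     (\<forall>i. local_solution p q b (Y i)) \<and> germs_independent b Y \<and>
     (\<forall>y. local_solution p q b y \<longrightarrow> (\<exists>c. germ_eq b y (\<lambda>z. \<Sum>i\<in>UNIV. c i * Y i z)))"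

text \<open>
  The ratio of two solutions near a point \<open>b\<close> of a punctured disc around \<open>a\<close> is required to be the
  germ of one (single-valued) function meromorphic on the full disc. The germs are compared in
  \<open>at b\<close> because the values of a HOL function at its poles are irrelevant.
\<close>

definition apparent_singularity ::
    "complex set \<Rightarrow> (complex \<Rightarrow> complex) \<Rightarrow> (complex \<Rightarrow> complex) \<Rightarrow> complex \<Rightarrow> bool" where
  "apparent_singularity \<Omega> p q a \<longleftrightarrow>
     (\<exists>r>0. ball a r - {a} \<subseteq> \<Omega> \<and>
        (\<forall>b\<in>ball a r - {a}. \<forall>Y.
           (\<forall>i. local_solution p q b (Y i)) \<and> germs_independent b Y \<longrightarrow>
           (\<exists>h. h meromorphic_on ball a r \<and> (\<forall>\<^sub>F z in at b. h z = Y 1 z / Y 2 z))))"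

definition path_from :: "complex set \<Rightarrow> complex \<Rightarrow> (real \<Rightarrow> complex) \<Rightarrow> bool" where
  "path_from \<Omega> b g \<longleftrightarrow> path g \<and> path_image g \<subseteq> \<Omega> \<and> pathstart g = b"

text \<open>\<open>f t\<close> represents the germ at \<open>g t\<close> of the function continued along \<open>g\<close>.\<close>

definition analytic_continuation_along ::
    "(real \<Rightarrow> complex) \<Rightarrow> (real \<Rightarrow> complex \<Rightarrow> complex) \<Rightarrow> bool" where
  "analytic_continuation_along g f \<longleftrightarrow>
     (\<forall>t\<in>{0..1}. f t analytic_on {g t} \<and>
        (\<forall>\<^sub>F s in at t within {0..1}. germ_eq (g s) (f s) (f t)))"

text \<open>
  A multivalued analytic function on \<open>\<Omega>\<close> with base point \<open>b\<close> assigns to each path \<open>g\<close> in \<open>\<Omega>\<close>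
  starting at \<open>b\<close> the germ \<open>y g\<close> at the end of \<open>g\<close> that arises by continuation along \<open>g\<close>. The
  germ at \<open>b\<close> from which one starts is the value of \<open>y\<close> at the constant path \<open>subpath 0 0 g\<close>.
\<close>

definition multivalued_solution ::
    "complex set \<Rightarrow> (complex \<Rightarrow> complex) \<Rightarrow> (complex \<Rightarrow> complex) \<Rightarrow> complex \<Rightarrow>
     ((real \<Rightarrow> complex) \<Rightarrow> complex \<Rightarrow> complex) \<Rightarrow> bool" where
  "multivalued_solution \<Omega> p q b y \<longleftrightarrow>
     (\<forall>g. path_from \<Omega> b g \<longrightarrow>
        analytic_continuation_along g (\<lambda>t. y (subpath 0 t g)) \<and>
        local_solution p q (pathfinish g) (y g))"

text \<open>
  The matrices, with respect to a basis \<open>Y\<close> of the space of local solutions at \<open>b\<close>, of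
  continuation along loops; column \<open>j\<close> holds the coordinates of the continuation of \<open>Y j\<close>.
\<close>

definition monodromy_group ::
    "complex set \<Rightarrow> complex \<Rightarrow> (2 \<Rightarrow> complex \<Rightarrow> complex) \<Rightarrow> (complex^2^2) set" where
  "monodromy_group \<Omega> b Y =
     {M. \<exists>g. path_from \<Omega> b g \<and> pathfinish g = b \<and>
           (\<forall>j. \<exists>f. analytic_continuation_along g f \<and> germ_eq b (f 0) (Y j) \<and>
                    germ_eq b (f 1) (\<lambda>z. \<Sum>i\<in>UNIV. M $ i $ j * Y i z))}"

definition euler_op :: "(complex \<Rightarrow> complex) \<Rightarrow> complex \<Rightarrow> complex" where
  "euler_op f = (\<lambda>z. z * deriv f z)"

definition poly_euler_op :: "complex poly \<Rightarrow> (complex \<Rightarrow> complex) \<Rightarrow> complex \<Rightarrow> complex" where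
  "poly_euler_op Q f = (\<lambda>z. \<Sum>i\<le>degree Q. coeff Q i * (euler_op ^^ i) f z)"

definition E_dom :: "nat \<Rightarrow> (nat \<Rightarrow> complex) \<Rightarrow> complex set" where
  "E_dom k a = - ({0, 1} \<union> a ` {1..k})"

definition E_p :: "complex \<Rightarrow> complex \<Rightarrow> nat \<Rightarrow> (nat \<Rightarrow> complex) \<Rightarrow> (nat \<Rightarrow> nat) \<Rightarrow> complex \<Rightarrow> complex" where
  "E_p \<alpha> \<beta> k a m z = - (\<alpha> / z + \<beta> / (z - 1) + (\<Sum>i=1..k. of_nat (m i) / (z - a i)))"

definition E_q :: "nat \<Rightarrow> (nat \<Rightarrow> complex) \<Rightarrow> complex poly \<Rightarrow> complex \<Rightarrow> complex" where
  "E_q k a P z = poly P z / (z * (z - 1) * (\<Prod>i=1..k. z - a i))"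

definition H_dom :: "complex set" where
  "H_dom = - {0, 1}"

definition H_p :: "complex \<Rightarrow> complex \<Rightarrow> nat \<Rightarrow> complex \<Rightarrow> complex" where
  "H_p \<alpha> \<beta> d z = - (\<alpha> / z + (\<beta> + of_nat d) / (z - 1))"

definition H_q :: "complex \<Rightarrow> complex \<Rightarrow> complex \<Rightarrow> complex" where
  "H_q \<gamma> \<delta> z = \<gamma> * \<delta> / (z * (z - 1))"

end

theory Submission
  imports Defs "HOL-Computational_Algebra.Fundamental_Theorem_Algebra"
begin

text \<open>
  Let \<open>D = z d/dz\<close>. Consider the operators \<open>u + v D\<close> with rational \<open>u\<close>, \<open>v\<close> that map every solution
  of \<open>(E)\<close> to a function with the exponents \<open>0, \<alpha> + 1\<close> at \<open>0\<close>, \<open>0, \<beta> + 1\<close> at \<open>1\<close>, \<open>-\<gamma>, -\<delta>\<close> at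
  \<open>\<infinity>\<close> and no singularity at the \<open>a\<^sub>j\<close>. As the \<open>a\<^sub>j\<close> are apparent, they form a space of dimension
  \<open>d + 1\<close>. Left multiplication by \<open>D\<close> maps this space into itself up to a one-dimensional obstruction
  at \<open>1\<close>, so there is \<open>w \<noteq> 0\<close> with \<open>w, D w, \<dots>, D^d w\<close> all in the space. An eigenvector of \<open>D\<close> would
  yield a factor of \<open>(E)\<close> with solution \<open>z^c\<close>, whose exponents at \<open>0\<close> and \<open>\<infinity>\<close> contradict the
  hypothesis on \<open>\<gamma>\<close>, \<open>\<delta>\<close>, \<open>\<gamma> - \<alpha> - 1\<close>, \<open>\<delta> - \<alpha> - 1\<close>; hence \<open>w, \<dots>, D^d w\<close> is a basis, and \<open>1 = Q(D) w\<close>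
  for a polynomial \<open>Q\<close> of degree \<open>d\<close>. The same argument, applied to a \<open>(d - 1)\<close>-dimensional subspace
  that contains the image of \<open>w\<close> under the hypergeometric operator, shows that \<open>F = w y\<close> solves \<open>(H)\<close>.
  So \<open>w\<close> and \<open>Q(D)\<close> are mutually inverse between the solutions of \<open>(E)\<close> and of \<open>(H)\<close>, and they commute
  with analytic continuation. Paths for \<open>(H)\<close> may pass through the \<open>a\<^sub>j\<close>, but can be moved off
  them without changing the continuation.
\<close>

text \<open>On a branch (z - 1)^(\<beta> + 1) (1 + ...) at 1 an operator of the space multiplies the
  leading coefficient by a number. This number is the obstruction: D lowers the exponent by 1 and
  stays in the space only if the number is 0. The d conditions on w thus say that w raises \<beta> +
  1 to \<beta> + d + 1, the second exponent of (H) at 1. This explains the degree of Q, the shift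
  \<beta> + d in (H), and the count of d linear conditions on a space of dimension d + 1.

  In terms of D, equation (H) reads (D (D - \<alpha> - 1) - z (D - \<gamma>) (D - \<delta>)) F = 0.
  The first product kills leading terms at 0, so the image of w vanishes there, which costs two
  dimensions; the second kills leading terms at infinity, so the factor z does not raise degrees.

  Everything is computed with pairs of polynomials instead of asymptotic expansions of solutions, so
  logarithmic cases of \<alpha> or \<beta> need no separate treatment. The apparent singularities
  enter only through a holomorphic solution of the Riccati equation at each of them, which a single
  polynomial g replaces to sufficient order.\<close>

section \<open>Second order linear differential equations in the complex domain\<close>

context includes fps_syntax
begin

text \<open>The equation F'' + P F' + Q F = 0 in degree n, solved for the coefficient of F of index
  n + 2; \<open>u\<close> and \<open>v\<close> are the initial values.\<close>

fun ode_coeffs :: "complex fps \<Rightarrow> complex fps \<Rightarrow> complex \<Rightarrow> complex \<Rightarrow> nat \<Rightarrow> complex" where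
  "ode_coeffs P Q u v 0 = u"
| "ode_coeffs P Q u v (Suc 0) = v"
| "ode_coeffs P Q u v (Suc (Suc n)) =
     - (\<Sum>i\<le>n. P $ i * (of_nat (Suc (n - i)) * ode_coeffs P Q u v (Suc (n - i)))
               + Q $ i * ode_coeffs P Q u v (n - i)) / (of_nat (Suc n) * of_nat (Suc (Suc n)))"

lemma ode_coeffs_eq:
  fixes P Q :: "complex fps" and u v :: complex
  defines "F \<equiv> Abs_fps (ode_coeffs P Q u v)"
  shows "fps_deriv (fps_deriv F) + P * fps_deriv F + Q * F = 0"
proof (rule fps_ext)
  fix n
  have nz: "(of_nat (Suc n) :: complex) * of_nat (Suc (Suc n)) \<noteq> 0"
    using of_nat_neq_0 by (simp del: of_nat_Suc)
  have "fps_deriv (fps_deriv F) $ n = of_nat (Suc n) * of_nat (Suc (Suc n)) * ode_coeffs P Q u v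
      (Suc (Suc n))"
    by (simp add: F_def)
  also have "\<dots> = - (\<Sum>i\<le>n. P $ i * (of_nat (Suc (n - i)) * ode_coeffs P Q u v (Suc (n - i)))
               + Q $ i * ode_coeffs P Q u v (n - i))"
    unfolding ode_coeffs.simps(3) times_divide_eq_right
        by (rule nonzero_mult_div_cancel_left[OF nz])
  also have "\<dots> = - ((P * fps_deriv F) $ n + (Q * F) $ n)"
    by (simp add: fps_mult_nth F_def sum.distrib atLeast0AtMost)
  finally show "(fps_deriv (fps_deriv F) + P * fps_deriv F + Q * F) $ n = 0 $ n" by simp
qed

lemma fps_ode_unique:
  fixes F P Q :: "complex fps"
  assumes eq: "fps_deriv (fps_deriv F) + P * fps_deriv F + Q * F = 0" and F: "F $ 0 = 0" "F $ 1 = 0"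
  shows "F = 0"
proof (rule fps_ext)
  fix n show "F $ n = 0 $ n"
  proof (induction n rule: less_induct)
    case (less n)
    show ?case
    proof (cases "n < 2")
      case True
      then have "n = 0 \<or> n = 1" by auto
      then show ?thesis using F by auto
    next
      case False
      then have k: "n = Suc (Suc (n - 2))" by simp
      define k where "k = n - 2"
      note k = k[folded k_def]
      have "(P * fps_deriv F) $ k = 0" "(Q * F) $ k = 0"
        using less k by (auto simp: fps_mult_nth intro!: sum.neutral)
      moreover have "(fps_deriv (fps_deriv F) + P * fps_deriv F + Q * F) $ k = 0" using eq by simp
      ultimately have "of_nat (Suc k) * (of_nat (Suc (Suc k)) * F $ n) = 0"
        by (simp add: k)
      then show ?thesis using of_nat_neq_0 by (simp del: of_nat_Suc)
    qed
  qed
qed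

text \<open>The ratios of the majorant tend to \<open>1\<close>, so that the power series solution converges on the
  whole disc on which the coefficients of the equation are holomorphic.\<close>

lemma majorant_recursion:
  fixes b C :: "nat \<Rightarrow> real" and M :: real
  assumes M: "M \<ge> 0" and b0: "b 0 \<ge> 0"
    and b: "\<And>n. b (Suc n) = b n * (1 + 3 * M / real (Suc n))"
    and C01: "C 0 \<le> b 0" "C 1 \<le> b 0"
    and C: "\<And>n. real (Suc n) * real (Suc (Suc n)) * C (Suc (Suc n))
        \<le> M * (\<Sum>j\<le>Suc n. real (Suc j) * C j)"
  shows "C n \<le> b n"
proof -
  have bnn: "b n \<ge> 0" for n
    by (induction n) (use b0 M in \<open>auto simp: b\<close>)
  have b_mono: "b n \<le> b (Suc n)" for n
    using bnn[of n] M mult_left_mono[of 1 "1 + 3 * M / real (Suc n)" "b n"] unfolding b by simp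
  have bS: "real (Suc n) * b (Suc n) = (real (Suc n) + 3 * M) * b n" for n
    unfolding b by (simp add: field_simps)
  \<comment> \<open>\<open>b\<close> satisfies the recursive inequality of \<open>C\<close> in the
    opposite direction, so strong induction yields C \<le> b. The 3 in the majorant comes from the
    base case, where b 0 + 2 b 1 \<le> 3 b 1.\<close>
  have S: "M * (\<Sum>j\<le>Suc n. real (Suc j) * b j) \<le> real (Suc n) * real (Suc (Suc n)) * b (Suc (Suc
      n))" for n
  proof (induction n)
    case 0
    have "M * (b 0 + 2 * b 1) \<le> (2 + 3 * M) * b 1"
      using b_mono[of 0] bnn[of 1] M mult_left_mono[of "b 0" "b 1" M] by (simp add: algebra_simps)
    then show ?case using bS[of 1] by (simp add: numeral_2_eq_2)
  next
    case (Suc n)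
    define m where "m = Suc (Suc n)"
    have "M * (\<Sum>j\<le>Suc (Suc n). real (Suc j) * b j) =
          M * (\<Sum>j\<le>Suc n. real (Suc j) * b j) + M * real (Suc m) * b m"
      by (simp add: m_def algebra_simps)
    also have "\<dots> \<le> real (Suc n) * real m * b m + M * real (Suc m) * b m"
      using Suc by (simp add: m_def)
    also have "\<dots> \<le> real m * ((real (Suc m) + 3 * M) * b m)"
    proof -
      have "real (Suc n) * real m + M * real (Suc m) \<le> real m * (real (Suc m) + 3 * M)"
      proof -
        have "M * real (Suc m) \<le> M * (3 * real m)" using M
            by (intro mult_left_mono) (auto simp: m_def)
        moreover have "real (Suc n) * real m \<le> real m * real (Suc m)"
            by (simp add: m_def algebra_simps)
        ultimately show ?thesis by (simp add: algebra_simps)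
      qed
      from mult_right_mono[OF this bnn[of m]] show ?thesis by (simp add: algebra_simps)
    qed
    also have "\<dots> = real m * (real (Suc m) * b (Suc m))" unfolding bS ..
    finally show ?case by (simp only: m_def mult.assoc)
  qed
  show ?thesis
  proof (induction n rule: less_induct)
    case (less n)
    have "n = Suc (Suc (n - 2))" if "n \<noteq> 0" "n \<noteq> 1" using that by simp
    then consider "n = 0" | "n = 1" | k where "n = Suc (Suc k)" by blast
    then show ?case
    proof cases
      case 3
      have "real (Suc k) * real (Suc (Suc k)) * C n \<le> M * (\<Sum>j\<le>Suc k. real (Suc j) * C j)"
        using C 3 by simp
      also have "\<dots> \<le> M * (\<Sum>j\<le>Suc k. real (Suc j) * b j)"
        using M less 3 by (intro mult_left_mono sum_mono) auto
      also have "\<dots> \<le> real (Suc k) * real (Suc (Suc k)) * b n" using S 3 by simp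
      finally show ?thesis by (subst (asm) mult_le_cancel_left_pos) auto
    qed (use C01 b_mono[of 0] in auto)
  qed
qed

lemma majorant_summable:
  fixes b :: "nat \<Rightarrow> real" and M \<rho> :: real
  assumes M: "M \<ge> 0" and b0: "b 0 \<ge> 0" and b: "\<And>n. b (Suc n) = b n * (1 + 3 * M / real (Suc n))"
    and \<rho>: "0 < \<rho>" "\<rho> < 1"
  shows "summable (\<lambda>n. b n * \<rho> ^ n)"
proof -
  have bnn: "b n \<ge> 0" for n
    by (induction n) (use b0 M in \<open>auto simp: b\<close>)
  have "(\<lambda>n. (1 + 3 * M * inverse (real (Suc n))) * \<rho>) \<longlonglongrightarrow> (1 + 3 * M * 0) * \<rho>"
    by (intro tendsto_intros LIMSEQ_inverse_real_of_nat)
  then have "\<forall>\<^sub>F n in sequentially. (1 + 3 * M * inverse (real (Suc n))) * \<rho> < (1 + \<rho>) / 2"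
    by (rule order_tendstoD) (use \<rho> in auto)
  then obtain N where N: "\<And>n. n \<ge> N \<Longrightarrow> (1 + 3 * M * inverse (real (Suc n))) * \<rho> < (1 + \<rho>) / 2"
    by (auto simp: eventually_sequentially)
  show ?thesis
  proof (rule summable_ratio_test[of "(1 + \<rho>) / 2" N])
    fix n assume "n \<ge> N"
    then have "(1 + 3 * M * inverse (real (Suc n))) * \<rho> * (b n * \<rho> ^ n) \<le> (1
        + \<rho>) / 2 * (b n * \<rho> ^ n)"
      using N[of n] bnn[of n] \<rho> by (intro mult_right_mono) auto
    moreover have "norm (b (Suc n) * \<rho> ^ Suc n) = (1
        + 3 * M * inverse (real (Suc n))) * \<rho> * (b n * \<rho> ^ n)"
    proof -
      have "b (Suc n) * \<rho> ^ Suc n \<ge> 0" using bnn \<rho> by (simp del: power_Suc)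
      then have "norm (b (Suc n) * \<rho> ^ Suc n) = b (Suc n) * \<rho> ^ Suc n" by (simp del: power_Suc)
      then show ?thesis by (simp add: b divide_inverse)
    qed
    moreover have "norm (b n * \<rho> ^ n) = b n * \<rho> ^ n" using bnn \<rho> by simp
    ultimately show "norm (b (Suc n) * \<rho> ^ Suc n) \<le> (1 + \<rho>) / 2 * norm (b n * \<rho> ^ n)" by simp
  qed (use \<rho> in auto)
qed

text \<open>A Cauchy estimate on a circle strictly inside the disc of convergence: the terms of a
  convergent series are bounded.\<close>

lemma fps_coeff_bound:
  fixes P :: "complex fps"
  assumes "\<sigma> > 0" "ereal \<sigma> < fps_conv_radius P"
  obtains K where "K \<ge> 0" "\<And>n. norm (P $ n) * \<sigma> ^ n \<le> K"
proof -
  have "summable (\<lambda>n. norm (P $ n * of_real \<sigma> ^ n))"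
    using assms by (intro abs_summable_in_conv_radius) (simp add: fps_conv_radius_def)
  then have "convergent (\<lambda>n. norm (P $ n * of_real \<sigma> ^ n))"
    using summable_LIMSEQ_zero convergent_def by blast
  then have "Bseq (\<lambda>n. norm (P $ n * of_real \<sigma> ^ n))" by (rule convergent_imp_Bseq)
  then obtain K where "K > 0" "\<And>n. norm (norm (P $ n * of_real \<sigma> ^ n)) \<le> K" by (auto elim: BseqE)
  with assms show ?thesis by (intro that[of K]) (auto simp: norm_mult norm_power)
qed

lemma ode_coeffs_conv_radius:
  assumes P: "fps_conv_radius P \<ge> ereal r" and Q: "fps_conv_radius Q \<ge> ereal r"
  shows "fps_conv_radius (Abs_fps (ode_coeffs P Q u v)) \<ge> ereal r"
  unfolding fps_conv_radius_def
proof (rule conv_radius_geI_ex')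
  fix s assume s: "0 < s" "ereal s < ereal r"
  \<comment> \<open>A radius strictly between \<open>s\<close> and \<open>r\<close>: coefficients
    are estimated on radius \<open>\<sigma>\<close>, and the ratio s / \<sigma> < 1 then makes the
    majorant summable.\<close>
  define \<sigma> where "\<sigma> = (s + r) / 2"
  have \<sigma>: "0 < \<sigma>" "s < \<sigma>" "\<sigma> < r" using s by (auto simp: \<sigma>_def)
  define c where "c = ode_coeffs P Q u v"
  obtain K1 where K1: "K1 \<ge> 0" "\<And>n. norm (P $ n) * \<sigma> ^ n \<le> K1"
    using fps_coeff_bound[OF \<sigma>(1) less_le_trans[OF _ P]] \<sigma>(3) by auto
  obtain K2 where K2: "K2 \<ge> 0" "\<And>n. norm (Q $ n) * \<sigma> ^ n \<le> K2"
    using fps_coeff_bound[OF \<sigma>(1) less_le_trans[OF _ Q]] \<sigma>(3) by auto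
  \<comment> \<open>Of the factor \<sigma>^(n + 2), the term with P_i c_(n-i+1) absorbs all but
    \<sigma>, and the term with Q_i c_(n-i) all but \<sigma>^2.\<close>
  define M where "M = K1 * \<sigma> + K2 * \<sigma>\<^sup>2"
  have M: "M \<ge> 0" using K1 K2 \<sigma> by (simp add: M_def)
  define C where "C n = norm (c n) * \<sigma> ^ n" for n
  have C0: "C n \<ge> 0" for n using \<sigma> by (simp add: C_def)
  define b where "b = rec_nat (C 0 + C 1) (\<lambda>n x. x * (1 + 3 * M / real (Suc n)))"
  have b: "b 0 = C 0 + C 1" "b (Suc n) = b n * (1 + 3 * M / real (Suc n))" for n
    by (simp_all add: b_def)
  have "C n \<le> b n" for n
  proof (rule majorant_recursion[OF M _ b(2)])
    show "b 0 \<ge> 0" "C 0 \<le> b 0" "C 1 \<le> b 0" using C0 by (auto simp: b)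
    fix n
    have "real (Suc n) * real (Suc (Suc n)) * norm (c (Suc (Suc n))) =
        norm (\<Sum>i\<le>n. P $ i * (of_nat (Suc (n - i)) * c (Suc (n - i))) + Q $ i * c (n - i))"
      unfolding c_def ode_coeffs.simps(3)
      by (simp add: norm_divide norm_mult del: of_nat_Suc)
    also have "\<dots> \<le> (\<Sum>i\<le>n. norm (P $ i) * (real (Suc (n - i)) * norm (c (Suc (n - i))))
        + norm (Q $ i) * norm (c (n - i)))"
      by (intro order.trans[OF norm_sum] sum_mono order.trans[OF norm_triangle_ineq])
         (simp add: norm_mult del: of_nat_Suc)
    finally have "real (Suc n) * real (Suc (Suc n)) * C (Suc (Suc n)) \<le>
       (\<Sum>i\<le>n. norm (P $ i) * (real (Suc (n - i)) * norm (c (Suc (n - i))))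
           + norm (Q $ i) * norm (c (n - i))) * \<sigma> ^ Suc (Suc n)"
      unfolding C_def using \<sigma> by (simp add: mult_right_mono mult.assoc[symmetric] del: of_nat_Suc
          power_Suc)
    also have "\<dots> = (\<Sum>i\<le>n. (norm (P $ i) * \<sigma> ^ i) * \<sigma> * (real (Suc (n - i)) * C (Suc (n - i)))
                         + (norm (Q $ i) * \<sigma> ^ i) * \<sigma>\<^sup>2 * C (n - i))"
      unfolding sum_distrib_right
    proof (rule sum.cong)
      fix i assume "i \<in> {..n}"
      then have e: "Suc (Suc n) = i + 1 + Suc (n - i)" "Suc (Suc n) = i + 2 + (n - i)" by auto
      have pw1: "\<sigma> ^ Suc (Suc n) = \<sigma> ^ i * \<sigma> * \<sigma> ^ Suc (n - i)"
        by (subst e(1)) (simp only: power_add power_one_right)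
      have pw2: "\<sigma> ^ Suc (Suc n) = \<sigma> ^ i * \<sigma>\<^sup>2 * \<sigma> ^ (n - i)"
        by (subst e(2)) (simp only: power_add)
      have "norm (P $ i) * (real (Suc (n - i)) * norm (c (Suc (n - i)))) * \<sigma> ^ Suc (Suc n)
          = (norm (P $ i) * \<sigma> ^ i) * \<sigma> * (real (Suc (n - i)) * C (Suc (n - i)))"
        unfolding pw1 C_def by (simp only: mult_ac)
      moreover have "norm (Q $ i) * norm (c (n - i)) * \<sigma> ^ Suc (Suc n)
          = (norm (Q $ i) * \<sigma> ^ i) * \<sigma>\<^sup>2 * C (n - i)"
        unfolding pw2 C_def by (simp only: mult_ac)
      ultimately show "(norm (P $ i) * (real (Suc (n - i)) * norm (c (Suc (n - i))))
          + norm (Q $ i) * norm (c (n - i))) * \<sigma> ^ Suc (Suc n)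
        = (norm (P $ i) * \<sigma> ^ i) * \<sigma> * (real (Suc (n - i)) * C (Suc (n - i)))
            + (norm (Q $ i) * \<sigma> ^ i) * \<sigma>\<^sup>2 * C (n - i)"
        by (simp only: distrib_right)
    qed simp
    also have "\<dots> \<le> (\<Sum>i\<le>n. K1 * \<sigma> * (real (Suc (n - i)) * C (Suc (n - i))) + K2 * \<sigma>\<^sup>2 * C (n - i))"
      using K1 K2 C0 \<sigma> by (intro sum_mono add_mono mult_right_mono) auto
    also have "\<dots> = K1 * \<sigma> * (\<Sum>i\<le>n. real (Suc (n - i)) * C (Suc (n - i))) + K2 * \<sigma>\<^sup>2 * (\<Sum>i\<le>n. C (n
        - i))"
      by (simp add: sum.distrib sum_distrib_left)
    also have "(\<Sum>i\<le>n. real (Suc (n - i)) * C (Suc (n - i))) = (\<Sum>i\<le>n. real (Suc i) * C (Suc i))"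
      using sum.nat_diff_reindex[of "\<lambda>i. real (Suc i) * C (Suc i)" "Suc n"]
      by (simp only: lessThan_Suc_atMost diff_Suc_Suc)
    also have "(\<Sum>i\<le>n. C (n - i)) = (\<Sum>i\<le>n. C i)"
      using sum.nat_diff_reindex[of C "Suc n"] by (simp only: lessThan_Suc_atMost diff_Suc_Suc)
    also have "K1 * \<sigma> * (\<Sum>i\<le>n. real (Suc i) * C (Suc i)) + K2 * \<sigma>\<^sup>2 * (\<Sum>i\<le>n. C i)
        \<le> K1 * \<sigma> * (\<Sum>j\<le>Suc n. real (Suc j) * C j) + K2 * \<sigma>\<^sup>2 * (\<Sum>j\<le>Suc n. real (Suc j) * C j)"
    proof (intro add_mono mult_left_mono)
      have "(\<Sum>i\<le>n. real (Suc i) * C (Suc i)) \<le> (\<Sum>i\<le>n. real (Suc (Suc i)) * C (Suc i))"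
        using C0 by (intro sum_mono mult_right_mono) auto
      also have "\<dots> \<le> real (Suc 0) * C 0 + \<dots>" using C0[of 0] by simp
      finally show "(\<Sum>i\<le>n. real (Suc i) * C (Suc i)) \<le> (\<Sum>j\<le>Suc n. real (Suc j) * C j)"
        by (simp only: sum.atMost_Suc_shift)
      have "C i \<le> real (Suc i) * C i" for i using C0[of i] mult_right_mono[of 1 "real (Suc i)" "C
          i"] by simp
      then have "(\<Sum>i\<le>n. C i) \<le> (\<Sum>i\<le>n. real (Suc i) * C i)" by (rule sum_mono)
      also have "\<dots> \<le> (\<Sum>j\<le>Suc n. real (Suc j) * C j)" using C0 by simp
      finally show "(\<Sum>i\<le>n. C i) \<le> (\<Sum>j\<le>Suc n. real (Suc j) * C j)" .
    qed (use K1 K2 \<sigma> in auto)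
    finally show "real (Suc n) * real (Suc (Suc n)) * C (Suc (Suc n))
        \<le> M * (\<Sum>j\<le>Suc n. real (Suc j) * C j)"
      by (simp add: M_def distrib_right)
  qed
  note le = this
  have sm: "summable (\<lambda>n. b n * (s / \<sigma>) ^ n)"
    by (rule majorant_summable[OF M _ b(2)]) (use C0 \<sigma> s in \<open>auto simp: b\<close>)
  have "summable (\<lambda>n. c n * of_real s ^ n)"
  proof (rule summable_comparison_test'[OF sm])
    fix n :: nat
    have "norm (c n * of_real s ^ n) = C n * (s / \<sigma>) ^ n"
      using s \<sigma> by (simp add: C_def norm_mult norm_power power_divide)
    also have "\<dots> \<le> b n * (s / \<sigma>) ^ n" using le[of n] s \<sigma> by (intro mult_right_mono) auto
    finally show "norm (c n * of_real s ^ n) \<le> b n * (s / \<sigma>) ^ n" .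
  qed
  then show "summable (\<lambda>n. Abs_fps (ode_coeffs P Q u v) $ n * of_real s ^ n)" by (simp add: c_def)
qed


lemma eval_fps_shift_has_derivative:
  fixes F :: "complex fps"
  assumes "fps_conv_radius F \<ge> ereal r" "\<And>z. z \<in> ball c r \<Longrightarrow> y z = eval_fps F (z - c)" "z \<in> ball c r"
  shows "(y has_field_derivative eval_fps (fps_deriv F) (z - c)) (at z)"
proof -
  have "ereal (norm (z - c)) < ereal r" using assms(3) by (simp add: dist_norm norm_minus_commute)
  then have "ereal (norm (z - c)) < fps_conv_radius F" using assms(1) by (rule less_le_trans)
  then have "(eval_fps F has_field_derivative eval_fps (fps_deriv F) (z - c)) (at (z - c))"
    by (rule has_field_derivative_eval_fps)
  then have "((\<lambda>z. eval_fps F (z - c)) has_field_derivative eval_fps (fps_deriv F) (z - c)) (at z)"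
    using DERIV_shift[of "eval_fps F" _ z "- c"] by simp
  moreover have "\<forall>\<^sub>F x in nhds z. y x = eval_fps F (x - c)"
    using eventually_nhds_in_open[OF open_ball assms(3)] by eventually_elim (rule assms(2))
  ultimately show ?thesis by (subst DERIV_cong_ev[OF refl _ refl])
qed

text \<open>The radius depends on the coefficients only, not on the initial values. This is what
  later permits continuation along every path in their domain.\<close>

lemma ode_exists_ball:
  assumes p: "p holomorphic_on ball c r" and q: "q holomorphic_on ball c r" and r: "r > 0"
  obtains y where "y holomorphic_on ball c r" "y c = u" "deriv y c = v"
    "\<And>z. z \<in> ball c r \<Longrightarrow> deriv (deriv y) z + p z * deriv y z + q z * y z = 0"
proof -
  define P Q where "P = fps_expansion p c" and "Q = fps_expansion q c"
  have P: "fps_conv_radius P \<ge> ereal r" and Q: "fps_conv_radius Q \<ge> ereal r"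
    unfolding P_def Q_def using p q by (intro conv_radius_fps_expansion; simp)+
  define F where "F = Abs_fps (ode_coeffs P Q u v)"
  have F: "fps_conv_radius F \<ge> ereal r"
    unfolding F_def by (rule ode_coeffs_conv_radius[OF P Q])
  have F1: "fps_conv_radius (fps_deriv F) \<ge> ereal r"
    using F fps_conv_radius_deriv by (rule order.trans)
  define y where "y z = eval_fps F (z - c)" for z
  have dy: "(y has_field_derivative eval_fps (fps_deriv F) (z - c)) (at z)" if "z \<in> ball c r" for z
    using F _ that by (rule eval_fps_shift_has_derivative) (simp add: y_def)
  have dy1: "deriv y z = eval_fps (fps_deriv F) (z - c)" if "z \<in> ball c r" for z
    using dy[OF that] by (rule DERIV_imp_deriv)
  have dy2: "deriv (deriv y) z = eval_fps (fps_deriv (fps_deriv F)) (z - c)" if "z \<in> ball c r" for z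
    using eval_fps_shift_has_derivative[OF F1 dy1 that] by (rule DERIV_imp_deriv)
  show ?thesis
  proof
    show "y holomorphic_on ball c r"
      by (rule holomorphic_onI) (use dy in \<open>auto simp: field_differentiable_def intro:
          DERIV_subset\<close>)
    show "y c = u" by (simp add: y_def F_def eval_fps_at_0)
    show "deriv y c = v" using r by (simp add: dy1 F_def eval_fps_at_0)
    fix z assume z: "z \<in> ball c r"
    then have "ereal (norm (z - c)) < ereal r" by (simp add: dist_norm norm_minus_commute)
    then have le: "ereal (norm (z - c)) < fps_conv_radius G" if "fps_conv_radius G \<ge> ereal r"
        for G :: "complex fps"
      using that by (rule less_le_trans)
    have F2: "fps_conv_radius (fps_deriv (fps_deriv F)) \<ge> ereal r"
      using F1 fps_conv_radius_deriv by (rule order.trans)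
    have m1: "fps_conv_radius (P * fps_deriv F) \<ge> ereal r" and m2: "fps_conv_radius (Q * F) \<ge>
        ereal r"
      using P Q F F1 fps_conv_radius_mult by (metis min.boundedI order.trans)+
    have s: "fps_conv_radius (fps_deriv (fps_deriv F) + P * fps_deriv F) \<ge> ereal r"
      using F2 m1 fps_conv_radius_add by (metis min.boundedI order.trans)
    have pz: "p z = eval_fps P (z - c)" and qz: "q z = eval_fps Q (z - c)"
      unfolding P_def Q_def using p q z by (subst eval_fps_expansion[where r = "ereal r"]; simp)+
    have "deriv (deriv y) z + p z * deriv y z + q z * y z
        = eval_fps (fps_deriv (fps_deriv F) + P * fps_deriv F + Q * F) (z - c)"
      using le[OF F] le[OF F1] le[OF F2] le[OF P] le[OF Q] le[OF m1] le[OF m2] le[OF s] z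
      by (simp add: eval_fps_add eval_fps_mult dy1 dy2 y_def pz qz)
    also have "\<dots> = 0" unfolding F_def ode_coeffs_eq by simp
    finally show "deriv (deriv y) z + p z * deriv y z + q z * y z = 0" .
  qed
qed

lemma has_fps_expansion_deriv_shift:
  assumes "y analytic_on {c}"
  shows "fps_expansion (deriv y) c = fps_deriv (fps_expansion y c)"
proof (rule fps_expansion_unique_complex)
  show "(\<lambda>x. deriv y (c + x)) has_fps_expansion fps_expansion (deriv y) c"
    using assms by (intro analytic_at_imp_has_fps_expansion analytic_deriv)
  have "deriv (\<lambda>x. y (c + x)) has_fps_expansion fps_deriv (fps_expansion y c)"
    using assms by (intro has_fps_expansion_deriv analytic_at_imp_has_fps_expansion)
  moreover have "\<forall>\<^sub>F x in nhds 0. deriv (\<lambda>x. y (c + x)) x = deriv y (c + x)"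
    using DERIV_shift[of y _ _ c] by (simp add: deriv_def add.commute)
  ultimately show "(\<lambda>x. deriv y (c + x)) has_fps_expansion fps_deriv (fps_expansion y c)"
    using has_fps_expansion_cong by metis
qed

section \<open>Germs, local solutions and the Wronskian\<close>

lemma germ_eq_refl [simp]: "germ_eq b f f" by (simp add: germ_eq_def)
lemma germ_eq_sym: "germ_eq b f g \<Longrightarrow> germ_eq b g f" by (simp add: germ_eq_def eq_commute)
lemma germ_eq_trans [trans]:
  assumes "germ_eq b f g" "germ_eq b g h"
  shows "germ_eq b f h"
  using assms unfolding germ_eq_def by eventually_elim simp
lemma germ_eq_nearby: "germ_eq b f g \<Longrightarrow> \<forall>\<^sub>F z in nhds b. germ_eq z f g"
  unfolding germ_eq_def by (simp add: eventually_eventually)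
lemma germ_eq_deriv: "germ_eq b f g \<Longrightarrow> germ_eq b (deriv f) (deriv g)"
  using germ_eq_nearby[of b f g] unfolding germ_eq_def[of b "deriv f"]
  by (rule eventually_mono) (auto simp: germ_eq_def intro: deriv_cong_ev)
lemma germ_eq_at: "germ_eq b f g \<Longrightarrow> f b = g b"
  unfolding germ_eq_def by (rule eventually_nhds_x_imp_x)
lemma germ_eq_analytic: "germ_eq b f g \<Longrightarrow> f analytic_on {b} \<longleftrightarrow> g analytic_on {b}"
  unfolding germ_eq_def by (intro analytic_at_cong) auto
lemma germ_eq_open: "open S \<Longrightarrow> b \<in> S \<Longrightarrow> (\<And>z. z \<in> S \<Longrightarrow> f z = g z) \<Longrightarrow> germ_eq b f g"
  unfolding germ_eq_def using eventually_nhds by blast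

lemma germ_eq_connected:
  assumes "f holomorphic_on S" "g holomorphic_on S" "open S" "connected S" "x \<in> S" "germ_eq x f
      g" "z \<in> S"
  shows "germ_eq z f g"
proof -
  obtain T where T: "open T" "x \<in> T" "\<And>w. w \<in> T \<Longrightarrow> f w = g w"
    using assms(6) unfolding germ_eq_def eventually_nhds by blast
  have "f w = g w" if "w \<in> S" for w
    by (rule analytic_continuation_open[of "T \<inter> S" S f g]) (use assms T that in auto)
  then show ?thesis using assms by (intro germ_eq_open[of S])
qed

lemma local_solution_germ_cong:
  assumes "germ_eq b y z" "local_solution p q b y"
  shows "local_solution p q b z"
proof -
  note 1 = assms(1) germ_eq_deriv[OF assms(1)] germ_eq_deriv[OF germ_eq_deriv[OF assms(1)]]
  have "\<forall>\<^sub>F w in nhds b. deriv (deriv y) w + p w * deriv y w + q w * y w = 0"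
    using assms(2) by (simp add: local_solution_def)
  then have "\<forall>\<^sub>F w in nhds b. deriv (deriv z) w + p w * deriv z w + q w * z w = 0"
    using 1[unfolded germ_eq_def] by eventually_elim simp
  then show ?thesis using assms germ_eq_analytic unfolding local_solution_def by blast
qed

lemma local_solution_on_open:
  assumes "y holomorphic_on S" "open S" "b \<in> S"
    "\<And>z. z \<in> S \<Longrightarrow> deriv (deriv y) z + p z * deriv y z + q z * y z = 0"
  shows "local_solution p q b y"
  unfolding local_solution_def using assms by (auto simp: eventually_nhds analytic_at)

lemma local_solution_analytic: "local_solution p q b y \<Longrightarrow> y analytic_on {b}"
  by (simp add: local_solution_def)

lemma local_solution_openE:
  assumes "local_solution p q b y"
  obtains S where "open S" "b \<in> S" "y holomorphic_on S"
    "\<And>z. z \<in> S \<Longrightarrow> deriv (deriv y) z + p z * deriv y z + q z * y z = 0"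
proof -
  obtain S1 where S1: "open S1" "b \<in> S1" "y holomorphic_on S1"
    using assms by (auto simp: local_solution_def analytic_at)
  obtain S2 where S2: "open S2" "b \<in> S2"
    "\<And>z. z \<in> S2 \<Longrightarrow> deriv (deriv y) z + p z * deriv y z + q z * y z = 0"
    using assms unfolding local_solution_def eventually_nhds by blast
  show ?thesis
    by (rule that[of "S1 \<inter> S2"]) (use S1 S2 in \<open>auto intro: holomorphic_on_subset\<close>)
qed

lemma local_solution_nearby:
  assumes "local_solution p q b y"
  shows "\<forall>\<^sub>F z in nhds b. local_solution p q z y"
proof -
  obtain S where "open S" "b \<in> S" "y holomorphic_on S"
    "\<And>z. z \<in> S \<Longrightarrow> deriv (deriv y) z + p z * deriv y z + q z * y z = 0"
    using assms by (rule local_solution_openE) blast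
  then show ?thesis
    unfolding eventually_nhds by (intro exI[of _ S]) (auto intro: local_solution_on_open)
qed

lemma deriv_combination:
  assumes "y1 holomorphic_on S" "y2 holomorphic_on S" "open S" "z \<in> S"
  shows "deriv (\<lambda>z. s * y1 z + t * y2 z) z = s * deriv y1 z + t * deriv y2 z"
proof -
  have "(y1 has_field_derivative deriv y1 z) (at z)" "(y2 has_field_derivative deriv y2 z) (at z)"
    using assms by (auto intro: holomorphic_derivI)
  then show ?thesis by (intro DERIV_imp_deriv) (auto intro!: derivative_eq_intros)
qed

lemma deriv2_combination:
  assumes "y1 holomorphic_on S" "y2 holomorphic_on S" "open S" "z \<in> S"
  shows "deriv (deriv (\<lambda>z. s * y1 z + t * y2 z)) z = s * deriv (deriv y1) z
      + t * deriv (deriv y2) z"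
proof -
  have "deriv (deriv (\<lambda>z. s * y1 z + t * y2 z)) z = deriv (\<lambda>z. s * deriv y1 z + t * deriv y2 z) z"
    using assms by (intro deriv_cong_ev eventually_mono[OF eventually_nhds_in_open[of S z]])
                   (auto intro: deriv_combination)
  also have "\<dots> = s * deriv (deriv y1) z + t * deriv (deriv y2) z"
    using assms by (intro deriv_combination[of _ S] holomorphic_deriv)
  finally show ?thesis .
qed

lemma local_solution_combination:
  assumes "local_solution p q b y1" "local_solution p q b y2"
  shows "local_solution p q b (\<lambda>z. s * y1 z + t * y2 z)"
proof -
  obtain S where S: "open S" "b \<in> S" "y1 holomorphic_on S"
    "\<And>z. z \<in> S \<Longrightarrow> deriv (deriv y1) z + p z * deriv y1 z + q z * y1 z = 0"
    using assms(1) by (rule local_solution_openE) blast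
  obtain T where T: "open T" "b \<in> T" "y2 holomorphic_on T"
    "\<And>z. z \<in> T \<Longrightarrow> deriv (deriv y2) z + p z * deriv y2 z + q z * y2 z = 0"
    using assms(2) by (rule local_solution_openE) blast
  define U where "U = S \<inter> T"
  have U: "open U" "b \<in> U" "y1 holomorphic_on U" "y2 holomorphic_on U"
    using S T unfolding U_def by (auto intro: holomorphic_on_subset)
  show ?thesis
  proof (rule local_solution_on_open[of _ U])
    fix z assume z: "z \<in> U"
    have "deriv (deriv (\<lambda>z. s * y1 z + t * y2 z)) z + p z * deriv (\<lambda>z. s * y1 z + t * y2 z) z
            + q z * (s * y1 z + t * y2 z)
       = s * (deriv (deriv y1) z + p z * deriv y1 z + q z * y1 z)
         + t * (deriv (deriv y2) z + p z * deriv y2 z + q z * y2 z)"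
      unfolding deriv_combination[OF U(3,4,1) z] deriv2_combination[OF U(3,4,1) z]
      by (simp add: algebra_simps)
    also have "\<dots> = 0" using S(4) T(4) z by (simp add: U_def)
    finally show "deriv (deriv (\<lambda>z. s * y1 z + t * y2 z)) z + p z * deriv (\<lambda>z. s * y1 z
        + t * y2 z) z
            + q z * (s * y1 z + t * y2 z) = 0" .
  qed (use U in \<open>auto intro!: holomorphic_intros\<close>)
qed

text \<open>Taylor expansion at \<open>c\<close> turns the equation into the formal one, where
  vanishing initial coefficients force all others to vanish.\<close>

lemma local_solution_zero:
  assumes p: "p analytic_on {c}" and q: "q analytic_on {c}"
    and y: "local_solution p q c y" "y c = 0" "deriv y c = 0"
  shows "germ_eq c y (\<lambda>_. 0)"
proof -
  define F P Q where "F = fps_expansion y c" and "P = fps_expansion p c" and "Q = fps_expansion q c"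
  have ya: "y analytic_on {c}" using y(1) by (rule local_solution_analytic)
  have F: "(\<lambda>x. y (c + x)) has_fps_expansion F"
    unfolding F_def by (rule analytic_at_imp_has_fps_expansion[OF ya])
  have F1: "(\<lambda>x. deriv y (c + x)) has_fps_expansion fps_deriv F"
    unfolding F_def has_fps_expansion_deriv_shift[OF ya, symmetric]
    using ya by (intro analytic_at_imp_has_fps_expansion analytic_deriv)
  have F2: "(\<lambda>x. deriv (deriv y) (c + x)) has_fps_expansion fps_deriv (fps_deriv F)"
    unfolding F_def has_fps_expansion_deriv_shift[OF ya, symmetric]
      has_fps_expansion_deriv_shift[OF analytic_deriv[OF ya], symmetric]
    using ya by (intro analytic_at_imp_has_fps_expansion analytic_deriv)
  have PQ: "(\<lambda>x. p (c + x)) has_fps_expansion P" "(\<lambda>x. q (c + x)) has_fps_expansion Q"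
    unfolding P_def Q_def using p q by (auto intro: analytic_at_imp_has_fps_expansion)
  have "(\<lambda>x. deriv (deriv y) (c + x) + p (c + x) * deriv y (c + x) + q (c + x) * y (c + x))
      has_fps_expansion fps_deriv (fps_deriv F) + P * fps_deriv F + Q * F"
    by (intro fps_expansion_intros F F1 F2 PQ)
  moreover have "(\<lambda>x. deriv (deriv y) (c + x) + p (c + x) * deriv y (c + x) + q (c + x) * y (c + x))
      has_fps_expansion 0"
    unfolding has_fps_expansion_0_iff
    using y(1) unfolding local_solution_def by (simp add: nhds_to_0[of c] eventually_filtermap
        add.commute)
  ultimately have "fps_deriv (fps_deriv F) + P * fps_deriv F + Q * F = 0"
    by (rule fps_expansion_unique_complex)
  moreover have "F $ 0 = 0" using has_fps_expansion_imp_0_eq_fps_nth_0[OF F] y by simp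
  moreover have "F $ 1 = 0" using has_fps_expansion_imp_0_eq_fps_nth_0[OF F1] y by simp
  ultimately have "F = 0" by (rule fps_ode_unique)
  with F have "\<forall>\<^sub>F x in nhds 0. y (c + x) = 0" by (simp add: has_fps_expansion_0_iff)
  then show ?thesis
    by (simp add: germ_eq_def nhds_to_0[of c] eventually_filtermap add.commute)
qed

end

lemma local_solution_unique:
  assumes p: "p analytic_on {c}" and q: "q analytic_on {c}"
    and y: "local_solution p q c y" "local_solution p q c z" "y c = z c" "deriv y c = deriv z c"
  shows "germ_eq c y z"
proof -
  have "local_solution p q c (\<lambda>w. 1 * y w + (- 1) * z w)"
    using y by (intro local_solution_combination)
  moreover have "deriv (\<lambda>w. 1 * y w + (- 1) * z w) c = 1 * deriv y c + (- 1) * deriv z c"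
  proof -
    obtain S where "open S" "c \<in> S" "y holomorphic_on S" using y(1)
        by (rule local_solution_openE) blast
    moreover obtain T where "open T" "c \<in> T" "z holomorphic_on T" using y(2)
        by (rule local_solution_openE) blast
    ultimately show ?thesis by (intro deriv_combination[of _ "S \<inter> T"]) (auto intro:
        holomorphic_on_subset)
  qed
  ultimately have "germ_eq c (\<lambda>w. 1 * y w + (- 1) * z w) (\<lambda>_. 0)"
    using y by (intro local_solution_zero[OF p q]) auto
  then show ?thesis by (simp add: germ_eq_def)
qed

lemma local_solution_extend:
  assumes p: "p holomorphic_on ball c r" and q: "q holomorphic_on ball c r" and r: "r > 0"
    and y: "local_solution p q c y"
  obtains w where "w holomorphic_on ball c r" "germ_eq c w y" "\<And>z. z \<in> ball c r \<Longrightarrow>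
      local_solution p q z w"
proof -
  obtain w where w: "w holomorphic_on ball c r" "w c = y c" "deriv w c = deriv y c"
    "\<And>z. z \<in> ball c r \<Longrightarrow> deriv (deriv w) z + p z * deriv w z + q z * w z = 0"
    using ode_exists_ball[OF p q r] by blast
  have sol: "local_solution p q z w" if "z \<in> ball c r" for z
    using w that by (intro local_solution_on_open[of w "ball c r"]) auto
  have "germ_eq c w y"
    using p q r sol[of c] w y
    by (intro local_solution_unique[of p _ q]) (auto intro: holomorphic_on_imp_analytic_at[of _
        "ball c r"])
  with w sol show ?thesis using that by blast
qed

text \<open>A nontrivial combination with vanishing initial values would be the zero germ by
  uniqueness, so the matrix of initial values has trivial kernel.\<close>

lemma germs_independent_imp_det:
  assumes p: "p analytic_on {c}" and q: "q analytic_on {c}"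
    and Y: "\<And>i. local_solution p q c (Y i)" "germs_independent c Y"
  shows "Y 1 c * deriv (Y 2) c - Y 2 c * deriv (Y 1) c \<noteq> 0"
proof
  assume det: "Y 1 c * deriv (Y 2) c - Y 2 c * deriv (Y 1) c = 0"
  obtain S where S: "open S" "c \<in> S" "Y 1 holomorphic_on S" using Y(1)
      by (rule local_solution_openE) blast
  obtain T where T: "open T" "c \<in> T" "Y 2 holomorphic_on T" using Y(1)
      by (rule local_solution_openE) blast
  have none: "s = 0 \<and> t = 0" if "s * Y 1 c + t * Y 2 c = 0" "s * deriv (Y 1) c
      + t * deriv (Y 2) c = 0" for s t
  proof -
    have "deriv (\<lambda>z. s * Y 1 z + t * Y 2 z) c = s * deriv (Y 1) c + t * deriv (Y 2) c"
      using S T by (intro deriv_combination[of _ "S \<inter> T"]) (auto intro: holomorphic_on_subset)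
    then have "germ_eq c (\<lambda>z. s * Y 1 z + t * Y 2 z) (\<lambda>_. 0)"
      using that by (intro local_solution_zero[OF p q] local_solution_combination Y) auto
    then have "germ_eq c (\<lambda>z. \<Sum>i\<in>UNIV. (if i = 1 then s else t) * Y i z) (\<lambda>_. 0)"
      by (simp add: sum_2)
    then have "(if i = 1 then s else t) = 0" for i :: 2
      using Y(2)[unfolded germs_independent_def, THEN spec, of "\<lambda>i. if i
          = 1 then s else t"] by blast
    from this[of 1] this[of 2] show ?thesis by simp
  qed
  \<comment> \<open>If the determinant is 0, each row of the matrix of initial values gives a kernel
    vector, orthogonal to it. Both must be trivial, so the matrix is zero, and then (1, 1) is in the
    kernel.\<close>
  have "Y 2 c = 0 \<and> - Y 1 c = 0" using none[of "Y 2 c" "- Y 1 c"] det by (simp add: algebra_simps)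
  moreover have "deriv (Y 2) c = 0 \<and> - deriv (Y 1) c = 0"
    using none[of "deriv (Y 2) c" "- deriv (Y 1) c"] det by (simp add: algebra_simps)
  ultimately show False using none[of 1 1] by simp
qed

lemma solution_basis_if_independent:
  assumes p: "p analytic_on {c}" and q: "q analytic_on {c}"
    and Y: "\<And>i. local_solution p q c (Y i)" "germs_independent c Y"
  shows "solution_basis p q c Y"
  unfolding solution_basis_def
proof (intro conjI allI impI)
  fix y assume y: "local_solution p q c y"
  define W where "W = Y 1 c * deriv (Y 2) c - Y 2 c * deriv (Y 1) c"
  have W: "W \<noteq> 0" unfolding W_def by (rule germs_independent_imp_det[OF p q Y])
  \<comment> \<open>Cramer's rule for matching the initial values of \<open>y\<close>.\<close>
  define s t where "s = (y c * deriv (Y 2) c - deriv y c * Y 2 c) / W"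
    and "t = (deriv y c * Y 1 c - y c * deriv (Y 1) c) / W"
  have sW: "s * W = y c * deriv (Y 2) c - deriv y c * Y 2 c"
    and tW: "t * W = deriv y c * Y 1 c - y c * deriv (Y 1) c"
    using W by (simp_all add: s_def t_def)
  obtain S where S: "open S" "c \<in> S" "Y 1 holomorphic_on S" using Y(1)
      by (rule local_solution_openE) blast
  obtain T where T: "open T" "c \<in> T" "Y 2 holomorphic_on T" using Y(1)
      by (rule local_solution_openE) blast
  have "deriv (\<lambda>z. s * Y 1 z + t * Y 2 z) c = s * deriv (Y 1) c + t * deriv (Y 2) c"
    using S T by (intro deriv_combination[of _ "S \<inter> T"]) (auto intro: holomorphic_on_subset)
  also have "\<dots> = deriv y c"
  proof -
    have "(s * deriv (Y 1) c + t * deriv (Y 2) c) * W = (s * W) * deriv (Y 1) c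
        + (t * W) * deriv (Y 2) c"
      by (simp add: algebra_simps)
    also have "\<dots> = deriv y c * W" unfolding sW tW by (simp add: W_def algebra_simps)
    finally show ?thesis using W by simp
  qed
  finally have 1: "deriv y c = deriv (\<lambda>z. s * Y 1 z + t * Y 2 z) c" by simp
  have "(s * Y 1 c + t * Y 2 c) * W = (s * W) * Y 1 c + (t * W) * Y 2 c"
      by (simp add: algebra_simps)
  also have "\<dots> = y c * W" unfolding sW tW by (simp add: W_def algebra_simps)
  finally have 2: "y c = s * Y 1 c + t * Y 2 c" using W by simp
  have "germ_eq c y (\<lambda>z. s * Y 1 z + t * Y 2 z)"
    by (intro local_solution_unique[OF p q y] local_solution_combination Y 1 2)
  then show "\<exists>co. germ_eq c y (\<lambda>z. \<Sum>i\<in>UNIV. co i * Y i z)"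
    by (intro exI[of _ "\<lambda>i. if i = 1 then s else t"]) (simp add: sum_2)
qed (use Y in auto)

lemma exists_solution_basis:
  assumes p: "p analytic_on {c}" and q: "q analytic_on {c}"
  shows "\<exists>Y. solution_basis p q c Y"
proof -
  obtain r1 where r1: "r1 > 0" "p holomorphic_on ball c r1" using p by (auto simp: analytic_at_ball)
  obtain r2 where r2: "r2 > 0" "q holomorphic_on ball c r2" using q by (auto simp: analytic_at_ball)
  define r where "r = min r1 r2"
  have r: "r > 0" "p holomorphic_on ball c r" "q holomorphic_on ball c r"
    using r1 r2 by (auto simp: r_def intro: holomorphic_on_subset)
  obtain y1 where y1: "y1 holomorphic_on ball c r" "y1 c = 1" "deriv y1 c = 0"
    "\<And>z. z \<in> ball c r \<Longrightarrow> deriv (deriv y1) z + p z * deriv y1 z + q z * y1 z = 0"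
    using ode_exists_ball[OF r(2,3,1)] by blast
  obtain y2 where y2: "y2 holomorphic_on ball c r" "y2 c = 0" "deriv y2 c = 1"
    "\<And>z. z \<in> ball c r \<Longrightarrow> deriv (deriv y2) z + p z * deriv y2 z + q z * y2 z = 0"
    using ode_exists_ball[OF r(2,3,1)] by blast
  define Y where "Y i = (if i = 1 then y1 else y2)" for i :: 2
  have "solution_basis p q c Y"
  proof (rule solution_basis_if_independent[OF p q])
    show "local_solution p q c (Y i)" for i
      using y1 y2 r by (auto simp: Y_def intro!: local_solution_on_open[of _ "ball c r"])
    show "germs_independent c Y" unfolding germs_independent_def
    proof (intro allI impI)
      fix co and i :: 2 assume *: "germ_eq c (\<lambda>z. \<Sum>i\<in>UNIV. co i * Y i z) (\<lambda>_. 0)"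
      have "deriv (\<lambda>z. co 1 * y1 z + co 2 * y2 z) c = co 1 * deriv y1 c + co 2 * deriv y2 c"
        using y1 y2 r by (intro deriv_combination[of _ "ball c r"]) auto
      then have "co 1 = 0" "co 2 = 0"
        using germ_eq_at[OF *] germ_eq_at[OF germ_eq_deriv[OF *]] y1 y2
        by (simp_all add: sum_2 Y_def)
      then show "co i = 0" using exhaust_2[of i] by auto
    qed
  qed
  then show ?thesis by blast
qed

section \<open>Analytic continuation along paths\<close>

lemma continuation_nbhd:
  assumes g: "path g" and f: "analytic_continuation_along g f" and t: "t \<in> {0..1}" and e: "e > 0"
  obtains \<delta> where "\<delta> > 0"
    "\<And>s. s \<in> {0..1} \<Longrightarrow> \<bar>s - t\<bar> < \<delta> \<Longrightarrow> dist (g s) (g t) < e \<and> germ_eq (g s) (f s) (f t)"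
proof -
  have "continuous_on {0..1} g" using g by (simp add: path_def)
  then obtain d1 where d1: "d1 > 0" "\<And>s. s \<in> {0..1} \<Longrightarrow> dist s t < d1 \<Longrightarrow> dist (g s) (g t) < e"
    using t e unfolding continuous_on_iff by meson
  have "\<forall>\<^sub>F s in at t within {0..1}. germ_eq (g s) (f s) (f t)"
    using f t unfolding analytic_continuation_along_def by blast
  then obtain d2 where d2: "d2 > 0"
    "\<And>s. s \<in> {0..1} \<Longrightarrow> s \<noteq> t \<Longrightarrow> dist s t < d2 \<Longrightarrow> germ_eq (g s) (f s) (f t)"
    unfolding eventually_at by blast
  show ?thesis
  proof (rule that[of "min d1 d2"])
    fix s :: real assume "s \<in> {0..1}" "\<bar>s - t\<bar> < min d1 d2"
    then show "dist (g s) (g t) < e \<and> germ_eq (g s) (f s) (f t)"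
      using d1(2)[of s] d2(2)[of s] by (cases "s = t") (auto simp: dist_real_def)
  qed (use d1(1) d2(1) in simp)
qed

text \<open>Connectedness of the interval replaces a subdivision of the path. As \<open>u\<close>
  and \<open>v\<close> are arbitrary near \<open>t\<close>, the step has to work forwards and
  backwards.\<close>

lemma unit_interval_induction:
  fixes P :: "real \<Rightarrow> bool"
  assumes "P 0" "t \<in> {0..1}"
    and step: "\<And>t. t \<in> {0..1} \<Longrightarrow> \<exists>\<delta>>0. \<forall>u\<in>{0..1}. \<forall>v\<in>{0..1}. \<bar>u - t\<bar> < \<delta> \<longrightarrow> \<bar>v - t\<bar> < \<delta> \<longrightarrow> P u \<longrightarrow> P v"
  shows "P t"
proof (rule connected_induction_simple[of "{0..1}" 0 t P])
  fix t :: real assume "t \<in> {0..1}"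
  then obtain \<delta> where \<delta>: "\<delta> > 0" "\<And>u v. u \<in> {0..1} \<Longrightarrow> v \<in> {0..1} \<Longrightarrow> \<bar>u - t\<bar> < \<delta> \<Longrightarrow> \<bar>v - t\<bar> < \<delta> \<Longrightarrow>
      P u \<Longrightarrow> P v"
    using step[of t] by blast
  show "\<exists>T. openin (top_of_set {0..1}) T \<and> t \<in> T \<and> (\<forall>x\<in>T. \<forall>y\<in>T. P x \<longrightarrow> P y)"
  proof (intro exI conjI)
    show "openin (top_of_set {0..1}) ({0..1} \<inter> ball t \<delta>)" by (intro openin_open_Int) simp
    show "\<forall>x\<in>{0..1} \<inter> ball t \<delta>. \<forall>y\<in>{0..1} \<inter> ball t \<delta>. P x \<longrightarrow> P y"
    proof (intro ballI impI)
      fix x y assume "x \<in> {0..1} \<inter> ball t \<delta>" "y \<in> {0..1} \<inter> ball t \<delta>" "P x"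
      then show "P y" by (intro \<delta>(2)[of x y]) (simp_all add: dist_real_def abs_minus_commute)
    qed
  qed (use \<open>t \<in> {0..1}\<close> \<delta>(1) in simp)
qed (use assms(1,2) in auto)

lemma continuation_analytic:
  "analytic_continuation_along g f \<Longrightarrow> t \<in> {0..1} \<Longrightarrow> f t analytic_on {g t}"
  by (simp add: analytic_continuation_along_def)

text \<open>On a small disc about g t each continuation is given by one holomorphic function, so
  agreement at one nearby parameter spreads to all others by the identity theorem.\<close>

lemma continuation_unique:
  assumes g: "path g" and f: "analytic_continuation_along g f" "analytic_continuation_along g f'"
    and 0: "germ_eq (g 0) (f 0) (f' 0)" and t: "t \<in> {0..1}"
  shows "germ_eq (g t) (f t) (f' t)"
proof (rule unit_interval_induction[of "\<lambda>t. germ_eq (g t) (f t) (f' t)", OF 0 t])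
  fix t :: real assume t: "t \<in> {0..1}"
  obtain e1 where e1: "e1 > 0" "f t holomorphic_on ball (g t) e1"
    using continuation_analytic[OF f(1) t] by (auto simp: analytic_at_ball)
  obtain e2 where e2: "e2 > 0" "f' t holomorphic_on ball (g t) e2"
    using continuation_analytic[OF f(2) t] by (auto simp: analytic_at_ball)
  define e where "e = min e1 e2"
  have e: "e > 0" "f t holomorphic_on ball (g t) e" "f' t holomorphic_on ball (g t) e"
    using e1 e2 by (auto simp: e_def intro: holomorphic_on_subset)
  obtain d1 where d1: "d1 > 0" "\<And>s. s \<in> {0..1} \<Longrightarrow> \<bar>s - t\<bar> < d1 \<Longrightarrow> dist (g s) (g t) < e \<and>
      germ_eq (g s) (f s) (f t)"
    using continuation_nbhd[OF g f(1) t e(1)] by blast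
  obtain d2 where d2: "d2 > 0" "\<And>s. s \<in> {0..1} \<Longrightarrow> \<bar>s - t\<bar> < d2 \<Longrightarrow> dist (g s) (g t) < e \<and>
      germ_eq (g s) (f' s) (f' t)"
    using continuation_nbhd[OF g f(2) t e(1)] by blast
  show "\<exists>\<delta>>0. \<forall>u\<in>{0..1}. \<forall>v\<in>{0..1}. \<bar>u - t\<bar> < \<delta> \<longrightarrow> \<bar>v - t\<bar> < \<delta> \<longrightarrow>
          germ_eq (g u) (f u) (f' u) \<longrightarrow> germ_eq (g v) (f v) (f' v)"
  proof (intro exI[of _ "min d1 d2"] conjI ballI impI)
    fix u v :: real
    assume u: "u \<in> {0..1}" "\<bar>u - t\<bar> < min d1 d2" and v: "v \<in> {0..1}" "\<bar>v - t\<bar> < min d1 d2"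
      and eq: "germ_eq (g u) (f u) (f' u)"
    have "germ_eq (g u) (f t) (f u)" using d1(2)[of u] u by (auto intro: germ_eq_sym)
    also note eq
    also have "germ_eq (g u) (f' u) (f' t)" using d2(2)[of u] u by auto
    finally have eq': "germ_eq (g u) (f t) (f' t)" .
    have "g u \<in> ball (g t) e" "g v \<in> ball (g t) e"
      using d1(2)[of u] d1(2)[of v] u v by (simp_all add: dist_commute)
    with eq' have "germ_eq (g v) (f t) (f' t)"
      by (metis germ_eq_connected[OF e(2,3) open_ball connected_ball])
    moreover have "germ_eq (g v) (f v) (f t)" using d1(2)[of v] v by auto
    moreover have "germ_eq (g v) (f' t) (f' v)" using d2(2)[of v] v by (auto intro: germ_eq_sym)
    ultimately show "germ_eq (g v) (f v) (f' v)" by (meson germ_eq_trans)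
  qed (use d1(1) d2(1) in simp)
qed

lemma germ_eq_along_path:
  assumes g: "path g" and t: "t \<in> {0..1}" and eq: "germ_eq (g t) f h"
  shows "\<forall>\<^sub>F s in at t within {0..1}. germ_eq (g s) f h"
proof -
  have "continuous_on {0..1} g" using g by (simp add: path_def)
  then have "(g \<longlongrightarrow> g t) (at t within {0..1})" using t by (simp add: continuous_on_def)
  with germ_eq_nearby[OF eq] show ?thesis by (rule eventually_compose_filterlim)
qed

lemma continuation_germ_cong:
  assumes g: "path g" and f: "analytic_continuation_along g f"
    and eq: "\<And>t. t \<in> {0..1} \<Longrightarrow> germ_eq (g t) (h t) (f t)"
  shows "analytic_continuation_along g h"
  unfolding analytic_continuation_along_def
proof (intro ballI conjI)
  fix t :: real assume t: "t \<in> {0..1}"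
  show "h t analytic_on {g t}"
    using continuation_analytic[OF f t] germ_eq_analytic[OF eq[OF t]] by simp
  have "\<forall>\<^sub>F s in at t within {0..1}. s \<in> {0..1}" by (simp add: eventually_at_filter)
  moreover have "\<forall>\<^sub>F s in at t within {0..1}. germ_eq (g s) (f s) (f t)"
    using f t by (simp add: analytic_continuation_along_def)
  moreover have "\<forall>\<^sub>F s in at t within {0..1}. germ_eq (g s) (f t) (h t)"
    using germ_eq_along_path[OF g t germ_eq_sym[OF eq[OF t]]] .
  ultimately show "\<forall>\<^sub>F s in at t within {0..1}. germ_eq (g s) (h s) (h t)"
    by eventually_elim (meson eq germ_eq_trans)
qed

lemma continuation_map:
  assumes f: "analytic_continuation_along g f"
    and an: "\<And>t f. t \<in> {0..1} \<Longrightarrow> f analytic_on {g t} \<Longrightarrow> \<Phi> f analytic_on {g t}"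
    and germ: "\<And>t f h. t \<in> {0..1} \<Longrightarrow> germ_eq (g t) f h \<Longrightarrow> germ_eq (g t) (\<Phi> f) (\<Phi> h)"
  shows "analytic_continuation_along g (\<lambda>t. \<Phi> (f t))"
  unfolding analytic_continuation_along_def
proof (intro ballI conjI)
  fix t :: real assume t: "t \<in> {0..1}"
  show "\<Phi> (f t) analytic_on {g t}" using continuation_analytic[OF f t] t by (rule an[rotated])
  have "\<forall>\<^sub>F s in at t within {0..1}. s \<in> {0..1}" by (simp add: eventually_at_filter)
  moreover have "\<forall>\<^sub>F s in at t within {0..1}. germ_eq (g s) (f s) (f t)"
    using f t by (simp add: analytic_continuation_along_def)
  ultimately show "\<forall>\<^sub>F s in at t within {0..1}. germ_eq (g s) (\<Phi> (f s)) (\<Phi> (f t))"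
    by eventually_elim (rule germ)
qed

lemma continuation_subpath:
  assumes g: "path g" and f: "analytic_continuation_along g f" and t: "t \<in> {0..1}"
  shows "analytic_continuation_along (subpath 0 t g) (\<lambda>s. f (t * s))"
  unfolding analytic_continuation_along_def
proof (intro ballI conjI)
  fix s :: real assume s: "s \<in> {0..1}"
  have ts: "t * s \<in> {0..1}" using t s by (auto intro: mult_le_one)
  show "f (t * s) analytic_on {subpath 0 t g s}"
    using continuation_analytic[OF f ts] by (simp add: subpath_def)
  obtain \<delta> where \<delta>: "\<delta> > 0"
    "\<And>r. r \<in> {0..1} \<Longrightarrow> \<bar>r - t * s\<bar> < \<delta> \<Longrightarrow> dist (g r) (g (t * s)) < 1 \<and>
        germ_eq (g r) (f r) (f (t * s))"
    using continuation_nbhd[OF g f ts zero_less_one] by blast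
  show "\<forall>\<^sub>F r in at s within {0..1}. germ_eq (subpath 0 t g r) (f (t * r)) (f (t * s))"
    unfolding eventually_at
  proof (intro exI[of _ \<delta>] conjI ballI impI)
    fix r :: real assume r: "r \<in> {0..1}" "r \<noteq> s \<and> dist r s < \<delta>"
    have "\<bar>t * r - t * s\<bar> = t * \<bar>r - s\<bar>" using t
        by (simp add: right_diff_distrib[symmetric] abs_mult)
    also have "\<dots> \<le> 1 * \<bar>r - s\<bar>" using t by (intro mult_right_mono) auto
    finally have "\<bar>t * r - t * s\<bar> < \<delta>" using r by (simp add: dist_real_def)
    moreover have "t * r \<in> {0..1}" using t r by (auto intro: mult_le_one)
    ultimately show "germ_eq (subpath 0 t g r) (f (t * r)) (f (t * s))"
      using \<delta>(2)[of "t * r"] by (simp add: subpath_def)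
  qed (use \<delta> in auto)
qed

lemma solution_continuation_exists:
  assumes \<Omega>: "open \<Omega>" "p holomorphic_on \<Omega>" "q holomorphic_on \<Omega>"
    and g: "path g" "path_image g \<subseteq> \<Omega>" and y: "local_solution p q (g 0) y"
  obtains f where "analytic_continuation_along g f" "germ_eq (g 0) (f 0) y"
    "\<And>t. t \<in> {0..1} \<Longrightarrow> local_solution p q (g t) (f t)"
proof -
  \<comment> \<open>\<open>C u f\<close>: \<open>f\<close> continues \<open>y\<close> over [0, u].
    The induction moves the end point \<open>u\<close>; backwards by restriction, forwards by
    keeping one solution, holomorphic on a disc about g u, as the germ beyond
    \<open>u\<close>.\<close>
  define C where "C u f \<longleftrightarrow> germ_eq (g 0) (f 0) y \<and> (\<forall>t\<in>{0..u}. local_solution p q (g t) (f t) \<and>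
       (\<exists>\<delta>>0. \<forall>s\<in>{0..u}. \<bar>s - t\<bar> < \<delta> \<longrightarrow> germ_eq (g s) (f s) (f t)))"
    for u :: real and f :: "real \<Rightarrow> complex \<Rightarrow> complex"
  have cont: "continuous_on {0..1} g" using g by (simp add: path_def)
  have "\<exists>f. C 1 f"
  proof (rule unit_interval_induction[of "\<lambda>u. \<exists>f. C u f"])
    have "C 0 (\<lambda>_. y)" unfolding C_def using y by (auto intro!: exI[of _ 1])
    then show "\<exists>f. C 0 f" by blast
    fix t :: real assume t: "t \<in> {0..1}"
    then have "g t \<in> \<Omega>" using g(2) by (auto simp: path_image_def)
    then obtain e where e: "e > 0" "ball (g t) e \<subseteq> \<Omega>" using \<Omega>(1) by (auto simp: open_contains_ball)
    \<comment> \<open>With e / 4, two parameters near \<open>t\<close> have values less than e / 2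
      apart, and the disc of radius e / 2 about either value still lies in \<Omega>.\<close>
    then obtain \<delta> where \<delta>: "\<delta> > 0" "\<And>s. s \<in> {0..1} \<Longrightarrow> dist s t < \<delta> \<Longrightarrow> dist (g s) (g t) < e / 4"
      using t cont unfolding continuous_on_iff by (metis divide_pos_pos zero_less_numeral)
    show "\<exists>\<delta>>0. \<forall>u\<in>{0..1}. \<forall>v\<in>{0..1}. \<bar>u - t\<bar> < \<delta> \<longrightarrow> \<bar>v - t\<bar> < \<delta> \<longrightarrow> (\<exists>f. C u f) \<longrightarrow> (\<exists>f. C v f)"
    proof (intro exI[of _ \<delta>] conjI ballI impI)
      fix u v :: real
      assume u: "u \<in> {0..1}" "\<bar>u - t\<bar> < \<delta>" and v: "v \<in> {0..1}" "\<bar>v - t\<bar> < \<delta>" and "\<exists>f. C u f"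
      then obtain f where f: "C u f" by blast
      show "\<exists>f. C v f"
      proof (cases "v \<le> u")
        case True
        have "C v f" unfolding C_def
        proof (intro conjI ballI)
          show "germ_eq (g 0) (f 0) y" using f by (simp add: C_def)
          fix r assume "r \<in> {0..v}"
          then have r: "r \<in> {0..u}" using True by auto
          then show "local_solution p q (g r) (f r)" using f by (simp add: C_def)
          from f r obtain d where "d > 0" "\<forall>s\<in>{0..u}. \<bar>s - r\<bar> < d \<longrightarrow> germ_eq (g s) (f s) (f r)"
            unfolding C_def by blast
          then show "\<exists>\<delta>>0. \<forall>s\<in>{0..v}. \<bar>s - r\<bar> < \<delta> \<longrightarrow> germ_eq (g s) (f s) (f r)"
            using True by (intro exI[of _ d]) auto
        qed
        then show ?thesis by blast
      next
        case False
        have near: "dist (g s) (g u) < e / 2" if "s \<in> {u..v}" for s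
        proof -
          have "dist (g s) (g t) < e / 4" using that u v by (intro \<delta>(2)) (auto simp: dist_real_def)
          moreover have "dist (g u) (g t) < e / 4" using u
              by (intro \<delta>(2)) (auto simp: dist_real_def)
          ultimately show ?thesis using dist_triangle2[of "g s" "g u" "g t"] by simp
        qed
        have sub: "ball (g u) (e / 2) \<subseteq> \<Omega>"
        proof -
          have "dist (g u) (g t) < e / 4" using u by (intro \<delta>(2)) (auto simp: dist_real_def)
          then have "ball (g u) (e / 2) \<subseteq> ball (g t) e"
            using e(1) unfolding ball_subset_ball_iff by simp
          then show ?thesis using e by blast
        qed
        have fu: "local_solution p q (g u) (f u)" using f u by (simp add: C_def)
        obtain w where w: "w holomorphic_on ball (g u) (e / 2)" "germ_eq (g u) w (f u)"
          "\<And>z. z \<in> ball (g u) (e / 2) \<Longrightarrow> local_solution p q z w"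
          using local_solution_extend[OF holomorphic_on_subset[OF \<Omega>(2) sub]
              holomorphic_on_subset[OF \<Omega>(3) sub] _ fu] e(1)
          by auto
        define f' where "f' s = (if s \<le> u then f s else w)" for s
        have "C v f'" unfolding C_def
        proof (intro conjI ballI)
          show "germ_eq (g 0) (f' 0) y" using f u by (simp add: C_def f'_def)
          fix r assume r: "r \<in> {0..v}"
          show "local_solution p q (g r) (f' r)"
            using f r w(3)[of "g r"] near[of r] by (auto simp: C_def f'_def dist_commute)
          consider "r < u" | "r = u" | "r > u" by linarith
          then show "\<exists>\<delta>>0. \<forall>s\<in>{0..v}. \<bar>s - r\<bar> < \<delta> \<longrightarrow> germ_eq (g s) (f' s) (f' r)"
          proof cases
            case 1
            then have "r \<in> {0..u}" using r by simp
            then obtain d where d: "d > 0" "\<forall>s\<in>{0..u}. \<bar>s - r\<bar> < d \<longrightarrow> germ_eq (g s) (f s) (f r)"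
              using f unfolding C_def by blast
            show ?thesis
              by (rule exI[of _ "min d (u - r)"]) (use d 1 in \<open>auto simp: f'_def\<close>)
          next
            case 2
            with r u f have "u \<in> {0..u}" by auto
            then obtain d where d: "d > 0" "\<forall>s\<in>{0..u}. \<bar>s - u\<bar> < d \<longrightarrow> germ_eq (g s) (f s) (f u)"
              using f unfolding C_def by blast
            have "\<forall>\<^sub>F s in at u within {0..1}. germ_eq (g s) w (f u)"
              using germ_eq_along_path[OF g(1) u(1) w(2)] .
            then obtain d2 where d2: "d2 > 0" "\<And>s. s \<in> {0..1} \<Longrightarrow> s \<noteq> u \<Longrightarrow> dist s u < d2 \<Longrightarrow>
                germ_eq (g s) w (f u)"
              unfolding eventually_at by blast
            show ?thesis
              by (rule exI[of _ "min d d2"]) (use d d2 2 v in \<open>auto simp: f'_def dist_real_def\<close>)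
          next
            case 3
            show ?thesis by (rule exI[of _ "r - u"]) (use 3 in \<open>auto simp: f'_def\<close>)
          qed
        qed
        then show ?thesis by blast
      qed
    qed (use \<delta> in auto)
  qed auto
  then obtain f where f: "C 1 f" by blast
  show ?thesis
  proof (rule that[of f])
    show "analytic_continuation_along g f"
      unfolding analytic_continuation_along_def
    proof (intro ballI conjI)
      fix t :: real assume t: "t \<in> {0..1}"
      then show "f t analytic_on {g t}" using f local_solution_analytic unfolding C_def by blast
      from f t obtain d where "d > 0" "\<forall>s\<in>{0..1}. \<bar>s - t\<bar> < d \<longrightarrow> germ_eq (g s) (f s) (f t)"
        unfolding C_def by blast
      then show "\<forall>\<^sub>F s in at t within {0..1}. germ_eq (g s) (f s) (f t)"
        unfolding eventually_at by (intro exI[of _ d]) (auto simp: dist_real_def)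
    qed
  qed (use f in \<open>auto simp: C_def\<close>)
qed

lemma subpath_0_1 [simp]: "subpath 0 1 g = g"
  by (simp add: subpath_def)

lemma multivalued_solution_exists:
  assumes \<Omega>: "open \<Omega>" "p holomorphic_on \<Omega>" "q holomorphic_on \<Omega>" and y: "local_solution p q b y"
  obtains F where "multivalued_solution \<Omega> p q b F"
    "\<And>g f. path_from \<Omega> b g \<Longrightarrow> analytic_continuation_along g f \<Longrightarrow> germ_eq b (f 0) y \<Longrightarrow>
        germ_eq (pathfinish g) (F g) (f 1)"
proof -
  define good where "good g f \<longleftrightarrow> analytic_continuation_along g f \<and> germ_eq b (f 0) y \<and>
      (\<forall>t\<in>{0..1}. local_solution p q (g t) (f t))" for g f
  have ex: "\<exists>f. good g f" if "path_from \<Omega> b g" for g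
  proof -
    have g: "path g" "path_image g \<subseteq> \<Omega>" "g 0 = b" using that
        by (auto simp: path_from_def pathstart_def)
    with y have "local_solution p q (g 0) y" by simp
    from solution_continuation_exists[OF \<Omega> g(1,2) this] show ?thesis
        unfolding good_def g(3) by metis
  qed
  \<comment> \<open>The continuations chosen for a path and for its initial pieces are a priori
    unrelated; \<open>continuation_unique\<close> makes their end germs fit together.\<close>
  define F where "F g = (SOME f. good g f) 1" for g
  have F: "germ_eq (pathfinish g) (F g) (f 1)"
    if g: "path_from \<Omega> b g" and f: "analytic_continuation_along g f" "germ_eq b (f 0) y" for g f
  proof -
    define h where "h = (SOME f. good g f)"
    have h: "good g h" unfolding h_def using ex[OF g] by (rule someI_ex)
    have g': "g 0 = b" "path g" using g by (auto simp: path_from_def pathstart_def)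
    have "germ_eq (g 0) (h 0) (f 0)"
      unfolding g'(1) using h f(2) germ_eq_trans germ_eq_sym unfolding good_def by blast
    then have "germ_eq (g 1) (h 1) (f 1)"
      using h continuation_unique[OF g'(2) _ f(1), of h 1] by (simp add: good_def)
    then show ?thesis by (simp add: F_def pathfinish_def h_def)
  qed
  show ?thesis
  proof (rule that[of F])
    show "multivalued_solution \<Omega> p q b F" unfolding multivalued_solution_def
    proof (intro allI impI conjI)
      fix g assume g: "path_from \<Omega> b g"
      then have g': "path g" "path_image g \<subseteq> \<Omega>" "g 0 = b"
          by (auto simp: path_from_def pathstart_def)
      obtain f where f: "good g f" using ex[OF g] by blast
      have eq: "germ_eq (g t) (F (subpath 0 t g)) (f t)" if t: "t \<in> {0..1}" for t
      proof -
        have "path_from \<Omega> b (subpath 0 t g)"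
          using g' t path_image_subpath_subset[of 0 t g] by (auto simp: path_from_def)
        moreover have "analytic_continuation_along (subpath 0 t g) (\<lambda>s. f (t * s))"
          using continuation_subpath[OF g'(1) _ t] f by (simp add: good_def)
        moreover have "germ_eq b (f (t * 0)) y" using f by (simp add: good_def)
        ultimately have "germ_eq (pathfinish (subpath 0 t g)) (F (subpath 0 t g)) (f (t * 1))"
            by (rule F)
        then show ?thesis by simp
      qed
      show "analytic_continuation_along g (\<lambda>t. F (subpath 0 t g))"
        using f g' by (intro continuation_germ_cong[OF _ _ eq]) (auto simp: good_def)
      have "germ_eq (g 1) (F g) (f 1)" using eq[of 1] by simp
      moreover have "local_solution p q (g 1) (f 1)" using f by (auto simp: good_def)
      ultimately show "local_solution p q (pathfinish g) (F g)"
        unfolding pathfinish_def by (meson local_solution_germ_cong germ_eq_sym)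
    qed
  qed (rule F)
qed

text \<open>A common frame for the operators u + v D and Q(D). Linearity is asked only for analytic
  arguments and up to germs, since \<open>deriv\<close> takes unspecified values where a function is
  not differentiable.\<close>

definition linear_germ_operator :: "complex set \<Rightarrow> ((complex \<Rightarrow> complex) \<Rightarrow> complex \<Rightarrow> complex) \<Rightarrow>
    bool" where
  "linear_germ_operator S \<Phi> \<longleftrightarrow> (\<forall>z\<in>S.
     (\<forall>f. f analytic_on {z} \<longrightarrow> \<Phi> f analytic_on {z}) \<and>
     (\<forall>f h. germ_eq z f h \<longrightarrow> germ_eq z (\<Phi> f) (\<Phi> h)) \<and>
     (\<forall>f h s t. f analytic_on {z} \<longrightarrow> h analytic_on {z} \<longrightarrow>
        germ_eq z (\<Phi> (\<lambda>w. s * f w + t * h w)) (\<lambda>w. s * \<Phi> f w + t * \<Phi> h w)))"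

lemma linear_germ_operatorD:
  assumes "linear_germ_operator S \<Phi>" "z \<in> S"
  shows "f analytic_on {z} \<Longrightarrow> \<Phi> f analytic_on {z}"
    and "germ_eq z f h \<Longrightarrow> germ_eq z (\<Phi> f) (\<Phi> h)"
    and "f analytic_on {z} \<Longrightarrow> h analytic_on {z} \<Longrightarrow>
        germ_eq z (\<Phi> (\<lambda>w. s * f w + t * h w)) (\<lambda>w. s * \<Phi> f w + t * \<Phi> h w)"
  using assms unfolding linear_germ_operator_def by blast+

lemma linear_germ_operator_continuation:
  assumes \<Phi>: "linear_germ_operator S \<Phi>" and g: "path_image g \<subseteq> S" and f:
      "analytic_continuation_along g f"
  shows "analytic_continuation_along g (\<lambda>t. \<Phi> (f t))"
proof -
  have S: "g t \<in> S" if "t \<in> {0..1}" for t using g that by (auto simp: path_image_def)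
  show ?thesis
    by (rule continuation_map[OF f]) (use linear_germ_operatorD[OF \<Phi> S] in blast)+
qed

lemma continuation_join:
  assumes g: "path g1" "path g2" "pathfinish g1 = pathstart g2"
    and f: "analytic_continuation_along g1 f1" "analytic_continuation_along g2 f2"
    and eq: "germ_eq (pathfinish g1) (f1 1) (f2 0)"
  shows "analytic_continuation_along (g1 +++ g2) (\<lambda>s. if s \<le> 1/2 then f1 (2 * s) else f2 (2 * s
      - 1))"
  unfolding analytic_continuation_along_def
proof (intro ballI conjI)
  define F where "F s = (if s \<le> 1/2 then f1 (2 * s) else f2 (2 * s - 1))" for s :: real
  fix t :: real assume t: "t \<in> {0..1}"
  show "F t analytic_on {(g1 +++ g2) t}"
    using continuation_analytic[OF f(1), of "2 * t"] continuation_analytic[OF f(2), of "2 * t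
        - 1"] t
    by (auto simp: F_def joinpaths_def)
  consider "t < 1/2" | "t = 1/2" | "t > 1/2" by linarith
  then show "\<forall>\<^sub>F s in at t within {0..1}. germ_eq ((g1 +++ g2) s) (F s) (F t)"
  proof cases
    case 1
    then have "2 * t \<in> {0..1}" using t by auto
    then obtain d where d: "d > 0" "\<And>s. s \<in> {0..1} \<Longrightarrow> \<bar>s - 2 * t\<bar> < d \<Longrightarrow>
        dist (g1 s) (g1 (2 * t)) < 1 \<and> germ_eq (g1 s) (f1 s) (f1 (2 * t))"
      using continuation_nbhd[OF g(1) f(1) _ zero_less_one] by metis
    show ?thesis unfolding eventually_at
    proof (intro exI[of _ "min (d / 2) (1/2 - t)"] conjI ballI impI)
      fix s :: real assume s: "s \<in> {0..1}" "s \<noteq> t \<and> dist s t < min (d / 2) (1/2 - t)"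
      then have *: "\<bar>s - t\<bar> < d / 2" "\<bar>s - t\<bar> < 1/2 - t" by (simp_all add: dist_real_def)
      have "s - t < d / 2" "t - s < d / 2" "s - t < 1/2 - t" "t - s < 1/2 - t"
        using * unfolding abs_less_iff by auto
      with s(1) have "2 * s \<in> {0..1}" "\<bar>2 * s - 2 * t\<bar> < d" "s \<le> 1/2"
        by (auto simp: abs_less_iff)
      then show "germ_eq ((g1 +++ g2) s) (F s) (F t)"
        using d(2)[of "2 * s"] 1 by (simp add: F_def joinpaths_def)
    qed (use d 1 in auto)
  next
    case 3
    then have "2 * t - 1 \<in> {0..1}" using t by auto
    then obtain d where d: "d > 0" "\<And>s. s \<in> {0..1} \<Longrightarrow> \<bar>s - (2 * t - 1)\<bar> < d \<Longrightarrow>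
        dist (g2 s) (g2 (2 * t - 1)) < 1 \<and> germ_eq (g2 s) (f2 s) (f2 (2 * t - 1))"
      using continuation_nbhd[OF g(2) f(2) _ zero_less_one] by metis
    show ?thesis unfolding eventually_at
    proof (intro exI[of _ "min (d / 2) (t - 1/2)"] conjI ballI impI)
      fix s :: real assume s: "s \<in> {0..1}" "s \<noteq> t \<and> dist s t < min (d / 2) (t - 1/2)"
      then have *: "\<bar>s - t\<bar> < d / 2" "\<bar>s - t\<bar> < t - 1/2" by (simp_all add: dist_real_def)
      have "s - t < d / 2" "t - s < d / 2" "s - t < t - 1/2" "t - s < t - 1/2"
        using * unfolding abs_less_iff by auto
      with s(1) have "2 * s - 1 \<in> {0..1}" "\<bar>(2 * s - 1) - (2 * t - 1)\<bar> < d" "\<not> s \<le> 1/2"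
        by (auto simp: abs_less_iff)
      then show "germ_eq ((g1 +++ g2) s) (F s) (F t)"
        using d(2)[of "2 * s - 1"] 3 by (simp add: F_def joinpaths_def)
    qed (use d 3 in auto)
  next
    case 2
    then have "2 * t = 1" by simp
    then have F1: "F t = f1 1" using 2 by (metis F_def order_refl)
    obtain d1 where d1: "d1 > 0" "\<And>s. s \<in> {0..1} \<Longrightarrow> \<bar>s - 1\<bar> < d1 \<Longrightarrow>
        dist (g1 s) (g1 1) < 1 \<and> germ_eq (g1 s) (f1 s) (f1 1)"
      using continuation_nbhd[OF g(1) f(1) _ zero_less_one, of 1] by auto
    have "germ_eq (g2 0) (f2 0) (f1 1)" using eq g(3) germ_eq_sym by (simp add: pathstart_def)
    then have "\<forall>\<^sub>F s in at 0 within {0..1}. germ_eq (g2 s) (f2 0) (f1 1)"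
      by (intro germ_eq_along_path g) auto
    moreover have "\<forall>\<^sub>F s in at 0 within {0..1}. germ_eq (g2 s) (f2 s) (f2 0)"
      using f(2) by (auto simp: analytic_continuation_along_def)
    ultimately have "\<forall>\<^sub>F s in at 0 within {0..1}. germ_eq (g2 s) (f2 s) (f1 1)"
      by eventually_elim (rule germ_eq_trans)
    then obtain d2 where d2: "d2 > 0" "\<And>s. s \<in> {0..1} \<Longrightarrow> s \<noteq> 0 \<Longrightarrow> dist s 0 < d2 \<Longrightarrow>
        germ_eq (g2 s) (f2 s) (f1 1)"
      unfolding eventually_at by blast
    show ?thesis unfolding eventually_at F1
    proof (intro exI[of _ "min (d1 / 2) (d2 / 2)"] conjI ballI impI)
      fix s :: real assume s: "s \<in> {0..1}" "s \<noteq> t \<and> dist s t < min (d1 / 2) (d2 / 2)"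
      show "germ_eq ((g1 +++ g2) s) (F s) (f1 1)"
      proof (cases "s \<le> 1/2")
        case True
        then show ?thesis using d1(2)[of "2 * s"] s 2
            by (simp add: F_def joinpaths_def dist_real_def)
      next
        case False
        then show ?thesis using d2(2)[of "2 * s - 1"] s 2
            by (simp add: F_def joinpaths_def dist_real_def)
      qed
    qed (use d1 d2 in auto)
  qed
qed

lemma continuation_const:
  assumes "path g" "path_image g \<subseteq> S" "open S" "f holomorphic_on S"
  shows "analytic_continuation_along g (\<lambda>_. f)"
  unfolding analytic_continuation_along_def
  using assms by (auto simp: path_image_def intro!: holomorphic_on_imp_analytic_at[of f S])

lemma common_ball:
  fixes f :: "'j::finite \<Rightarrow> complex \<Rightarrow> complex"
  assumes "\<And>j. f j analytic_on {z}" "open \<Omega>" "z \<in> \<Omega>"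
  obtains e where "e > 0" "ball z e \<subseteq> \<Omega>" "\<And>j. f j holomorphic_on ball z e"
proof -
  have "\<exists>T. open T \<and> z \<in> T \<and> f j holomorphic_on T" for j using assms(1) by (simp add: analytic_at)
  then obtain T where T: "\<And>j. open (T j)" "\<And>j. z \<in> T j" "\<And>j. f j holomorphic_on T j" by metis
  have "open (\<Omega> \<inter> (\<Inter>j. T j))" using T assms by (intro open_Int open_INT) auto
  moreover have "z \<in> \<Omega> \<inter> (\<Inter>j. T j)" using T assms by auto
  ultimately obtain e where e: "e > 0" "ball z e \<subseteq> \<Omega> \<inter> (\<Inter>j. T j)" by (meson open_contains_ball)
  have "f j holomorphic_on ball z e" for j
    using e(2) by (intro holomorphic_on_subset[OF T(3)]) auto
  with e show ?thesis by (intro that[of e]) auto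
qed

text \<open>A disc minus a finite set is path connected, which permits the detours. One path serves
  the whole family, because the columns of a monodromy matrix must come from the same loop.\<close>

lemma continuation_avoiding:
  fixes f :: "'j::finite \<Rightarrow> real \<Rightarrow> complex \<Rightarrow> complex"
  assumes \<Omega>: "open \<Omega>" and A: "finite A" and g: "path g" "path_image g \<subseteq> \<Omega>" "g 0 \<notin> A" "g 1 \<notin> A"
    and f: "\<And>j. analytic_continuation_along g (f j)"
  obtains g' f' where "path g'" "path_image g' \<subseteq> \<Omega> - A" "g' 0 = g 0" "g' 1 = g 1"
    "\<And>j. analytic_continuation_along g' (f' j)"
    "\<And>j. germ_eq (g 0) (f' j 0) (f j 0)" "\<And>j. germ_eq (g 1) (f' j 1) (f j 1)"
proof -
  \<comment> \<open>\<open>R t c\<close>: the germs of \<open>f j t\<close> at \<open>c\<close> are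
    reached by a path from g 0 to \<open>c\<close> that avoids \<open>A\<close>. It is proved for
    all \<open>c\<close> off \<open>A\<close> in a disc about g t, as g t itself may belong to
    \<open>A\<close>.\<close>
  define R where "R t c \<longleftrightarrow> (\<exists>g' f'. path g' \<and> path_image g' \<subseteq> \<Omega> - A \<and> g' 0 = g 0 \<and> g' 1 = c \<and>
     (\<forall>j. analytic_continuation_along g' (f' j) \<and> germ_eq (g 0) (f' j 0) (f j 0) \<and>
         germ_eq c (f' j 1) (f j t)))"
    for t c
  have path_ball: "\<exists>h. path h \<and> path_image h \<subseteq> ball z e - A \<and> h 0 = x \<and> h 1 = y"
    if "x \<in> ball z e - A" "y \<in> ball z e - A" for x y z e
  proof -
    have "path_connected (ball z e - A)"
      using A by (intro path_connected_open_diff_countable) (auto intro: countable_finite)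
    then show ?thesis using that unfolding path_connected_def pathstart_def pathfinish_def by blast
  qed
  have g\<Omega>: "g t \<in> \<Omega>" if "t \<in> {0..1}" for t using g(2) that by (auto simp: path_image_def)
  have "\<exists>e>0. \<forall>c\<in>ball (g 1) e - A. R 1 c"
  proof (rule unit_interval_induction[of "\<lambda>t. \<exists>e>0. \<forall>c\<in>ball (g t) e - A. R t c"])
    obtain e where e: "e > 0" "ball (g 0) e \<subseteq> \<Omega>" "\<And>j. f j 0 holomorphic_on ball (g 0) e"
      by (rule common_ball[of "\<lambda>j. f j 0" "g 0" \<Omega>]) (use f \<Omega> g\<Omega> continuation_analytic in auto)
    show "\<exists>e>0. \<forall>c\<in>ball (g 0) e - A. R 0 c"
    proof (intro exI[of _ e] conjI ballI)
      fix c assume c: "c \<in> ball (g 0) e - A"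
      have "g 0 \<in> ball (g 0) e - A" using e(1) g(3) by simp
      then obtain h where h: "path h" "path_image h \<subseteq> ball (g 0) e - A" "h 0 = g 0" "h 1 = c"
        using path_ball[OF _ c] by blast
      show "R 0 c" unfolding R_def
      proof (intro exI[of _ h] exI[of _ "\<lambda>j _. f j 0"] conjI allI)
        show "analytic_continuation_along h (\<lambda>_. f j 0)" for j
          using h e by (intro continuation_const[of h "ball (g 0) e"]) auto
      qed (use h e in auto)
    qed (rule e)
    fix t :: real assume t: "t \<in> {0..1}"
    obtain e where e: "e > 0" "ball (g t) e \<subseteq> \<Omega>" "\<And>j. f j t holomorphic_on ball (g t) e"
      by (rule common_ball[of "\<lambda>j. f j t" "g t" \<Omega>]) (use f \<Omega> g\<Omega> t continuation_analytic in auto)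
    have "\<exists>\<delta>>0. \<forall>s\<in>{0..1}. \<bar>s - t\<bar> < \<delta> \<longrightarrow> dist (g s) (g t) < e \<and> germ_eq (g s) (f j s) (f j t)" for j
      using continuation_nbhd[OF g(1) f[of j] t e(1)] by metis
    then obtain D where D: "\<And>j. D j > 0" "\<And>j s. s \<in> {0..1} \<Longrightarrow> \<bar>s - t\<bar> < D j \<Longrightarrow>
        dist (g s) (g t) < e \<and> germ_eq (g s) (f j s) (f j t)" by metis
    define \<delta> where "\<delta> = Min (range D)"
    have \<delta>: "\<delta> > 0" unfolding \<delta>_def using D(1) by auto
    have le: "\<delta> \<le> D j" for j unfolding \<delta>_def by simp
    have near: "dist (g s) (g t) < e" "germ_eq (g s) (f j s) (f j t)"
        if "s \<in> {0..1}" "\<bar>s - t\<bar> < \<delta>" for s j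
      using D(2)[OF that(1) less_le_trans[OF that(2) le]] by auto
    show "\<exists>\<delta>>0. \<forall>u\<in>{0..1}. \<forall>v\<in>{0..1}. \<bar>u - t\<bar> < \<delta> \<longrightarrow> \<bar>v - t\<bar> < \<delta> \<longrightarrow>
        (\<exists>e>0. \<forall>c\<in>ball (g u) e - A. R u c) \<longrightarrow> (\<exists>e>0. \<forall>c\<in>ball (g v) e - A. R v c)"
    proof (rule exI[of _ \<delta>], intro conjI ballI impI)
      fix u v :: real
      assume u: "u \<in> {0..1}" "\<bar>u - t\<bar> < \<delta>" and v: "v \<in> {0..1}" "\<bar>v - t\<bar> < \<delta>"
        and "\<exists>e>0. \<forall>c\<in>ball (g u) e - A. R u c"
      then obtain e' where e': "e' > 0" "\<And>c. c \<in> ball (g u) e' - A \<Longrightarrow> R u c" by blast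
      have "\<forall>\<^sub>F z in nhds (g u). \<forall>j\<in>UNIV. germ_eq z (f j u) (f j t)"
        using near(2)[OF u] by (intro eventually_ball_finite ballI germ_eq_nearby) auto
      moreover have "\<forall>\<^sub>F z in nhds (g u). z \<in> ball (g u) e' \<inter> ball (g t) e"
        using near(1)[OF u] e'(1) by (intro eventually_nhds_in_open) (auto simp: dist_commute)
      ultimately have "\<forall>\<^sub>F z in at (g u). (\<forall>j\<in>UNIV. germ_eq z (f j u) (f j t)) \<and>
          z \<in> ball (g u) e' \<inter> ball (g t) e"
        by (intro eventually_at_filter[THEN iffD2]) (auto elim: eventually_elim2)
      moreover have "\<forall>\<^sub>F z in at (g u). z \<notin> A"
      proof -
        have "\<forall>\<^sub>F z in nhds (g u). z \<in> - (A - {g u})"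
          using A by (intro eventually_nhds_in_open open_Compl finite_imp_closed) auto
        then show ?thesis unfolding eventually_at_filter by (rule eventually_mono) auto
      qed
      ultimately have "\<forall>\<^sub>F z in at (g u). (\<forall>j\<in>UNIV. germ_eq z (f j u) (f j t)) \<and>
          z \<in> ball (g u) e' \<inter> ball (g t) e \<and> z \<notin> A"
        by eventually_elim auto
      \<comment> \<open>Close to g u and off \<open>A\<close> there is a point at which
        \<open>f j u\<close> and \<open>f j t\<close> have the same germ. There the path already
        built is prolonged inside the disc about g t.\<close>
      then obtain c where c: "\<And>j. germ_eq c (f j u) (f j t)" "c \<in> ball (g u) e'
          - A" "c \<in> ball (g t) e - A"
        using eventually_happens[of _ "at (g u)"] by (auto simp: trivial_limit_at)
      from e'(2)[OF c(2)] obtain g' f' where g': "path g'" "path_image g' \<subseteq> \<Omega> - A" "g' 0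
          = g 0" "g' 1 = c"
        and f': "\<And>j. analytic_continuation_along g' (f' j)" "\<And>j. germ_eq (g 0) (f' j 0) (f j 0)"
          "\<And>j. germ_eq c (f' j 1) (f j u)" unfolding R_def by blast
      have "\<forall>\<^sub>F z in nhds (g v). \<forall>j\<in>UNIV. germ_eq z (f j t) (f j v)"
        using near(2)[OF v] by (intro eventually_ball_finite ballI germ_eq_nearby) (auto intro:
            germ_eq_sym)
      moreover have "\<forall>\<^sub>F z in nhds (g v). z \<in> ball (g t) e"
        using near(1)[OF v] by (intro eventually_nhds_in_open) (auto simp: dist_commute)
      ultimately have "\<forall>\<^sub>F z in nhds (g v). (\<forall>j\<in>UNIV. germ_eq z (f j t) (f j v)) \<and> z \<in> ball (g t) e"
        by eventually_elim auto
      then obtain e'' where e'': "e'' > 0" "\<And>z j. z \<in> ball (g v) e'' \<Longrightarrow> germ_eq z (f j t) (f j v)"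
        "\<And>z. z \<in> ball (g v) e'' \<Longrightarrow> z \<in> ball (g t) e"
        unfolding eventually_nhds_metric by (metis UNIV_I dist_commute mem_ball)
      show "\<exists>e>0. \<forall>c\<in>ball (g v) e - A. R v c"
      proof (intro exI[of _ e''] conjI ballI)
        fix c' assume c': "c' \<in> ball (g v) e'' - A"
        then have "c' \<in> ball (g t) e - A" using e''(3) by auto
        then obtain h where h: "path h" "path_image h \<subseteq> ball (g t) e - A" "h 0 = c" "h 1 = c'"
          using path_ball[OF c(3)] by blast
        define F where "F j s = (if s \<le> 1/2 then f' j (2 * s) else f j t)" for j and s :: real
        show "R v c'" unfolding R_def
        proof (intro exI[of _ "g' +++ h"] exI[of _ F] conjI allI)
          show "path (g' +++ h)" using g' h by (simp add: pathstart_def pathfinish_def)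
          show "path_image (g' +++ h) \<subseteq> \<Omega> - A"
            using g'(2) h(2) e(2) path_image_join_subset[of g' h] by blast
          show "(g' +++ h) 0 = g 0" "(g' +++ h) 1 = c'" using g' h by (auto simp: joinpaths_def)
          fix j
          have "germ_eq c (f' j 1) (f j t)" using f'(3) c(1) by (rule germ_eq_trans)
          moreover have "analytic_continuation_along h (\<lambda>_. f j t)"
            using h e by (intro continuation_const[of h "ball (g t) e"]) auto
          ultimately show "analytic_continuation_along (g' +++ h) (F j)"
            unfolding F_def using g' h f' by (intro continuation_join) (auto simp: pathstart_def
                pathfinish_def)
          show "germ_eq (g 0) (F j 0) (f j 0)" using f' by (simp add: F_def)
          show "germ_eq c' (F j 1) (f j v)" using e''(2)[of c' j] c' by (simp add: F_def)
        qed
      qed (use e''(1) in simp)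
    qed (rule \<delta>)
  qed auto
  then have "R 1 (g 1)" using g(4) by auto
  then show ?thesis unfolding R_def using that by blast
qed

section \<open>Comparison of monodromy groups\<close>

lemma monodromy_groupE:
  fixes M :: "complex^2^2"
  assumes "M \<in> monodromy_group \<Omega> b Y"
  obtains g f where "path_from \<Omega> b g" "pathfinish g = b"
    "\<And>j. analytic_continuation_along g (f j)" "\<And>j. germ_eq b (f j 0) (Y j)"
    "\<And>j. germ_eq b (f j 1) (\<lambda>z. \<Sum>i\<in>UNIV. M $ i $ j * Y i z)"
proof -
  from assms obtain g where g: "path_from \<Omega> b g" "pathfinish g = b"
    and f: "\<forall>j. \<exists>f. analytic_continuation_along g f \<and> germ_eq b (f 0) (Y j) \<and>
                    germ_eq b (f 1) (\<lambda>z. \<Sum>i\<in>UNIV. M $ i $ j * Y i z)"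
    unfolding monodromy_group_def by blast
  from choice[OF f] obtain f where "\<forall>j. analytic_continuation_along g (f j) \<and>
      germ_eq b (f j 0) (Y j) \<and>
                    germ_eq b (f j 1) (\<lambda>z. \<Sum>i\<in>UNIV. M $ i $ j * Y i z)" by (elim exE)
  with g that[of g f] show ?thesis by simp
qed

text \<open>In the bases Y and \<Phi> Y the groups are equal as sets of matrices, not merely
  conjugate: by linearity \<Phi> keeps the coefficients of a continued germ. Conversely, a loop in
  \<Omega> is first moved off \<open>A\<close>, where \<Psi> can be applied.\<close>

lemma monodromy_group_eq:
  assumes \<Omega>: "open \<Omega>" and A: "finite A" and b: "b \<in> \<Omega> - A"
    and \<Phi>: "linear_germ_operator (\<Omega> - A) \<Phi>" and \<Psi>: "linear_germ_operator (\<Omega> - A) \<Psi>"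
    and Y: "\<And>i. Y i analytic_on {b}" and \<Psi>\<Phi>: "\<And>i. germ_eq b (\<Psi> (\<Phi> (Y i))) (Y i)"
  shows "monodromy_group (\<Omega> - A) b Y = monodromy_group \<Omega> b (\<lambda>i. \<Phi> (Y i))"
proof (intro set_eqI iffI)
  fix M :: "complex^2^2" assume "M \<in> monodromy_group (\<Omega> - A) b Y"
  then obtain g f where g: "path_from (\<Omega> - A) b g" "pathfinish g = b"
    and f: "\<And>j. analytic_continuation_along g (f j)" "\<And>j. germ_eq b (f j 0) (Y j)"
     "\<And>j. germ_eq b (f j 1) (\<lambda>z. \<Sum>i\<in>UNIV. M $ i $ j * Y i z)"
    by (rule monodromy_groupE) blast
  show "M \<in> monodromy_group \<Omega> b (\<lambda>i. \<Phi> (Y i))"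
    unfolding monodromy_group_def mem_Collect_eq
  proof (intro exI[of _ g] conjI allI)
    show "path_from \<Omega> b g" using g by (auto simp: path_from_def)
    fix j
    show "\<exists>f. analytic_continuation_along g f \<and> germ_eq b (f 0) (\<Phi> (Y j)) \<and>
               germ_eq b (f 1) (\<lambda>z. \<Sum>i\<in>UNIV. M $ i $ j * \<Phi> (Y i) z)"
    proof (intro exI[of _ "\<lambda>t. \<Phi> (f j t)"] conjI)
      show "analytic_continuation_along g (\<lambda>t. \<Phi> (f j t))"
        using g f(1) by (intro linear_germ_operator_continuation[OF \<Phi>]) (auto simp: path_from_def)
      show "germ_eq b (\<Phi> (f j 0)) (\<Phi> (Y j))" by (rule linear_germ_operatorD(2)[OF \<Phi> b f(2)])
      have "germ_eq b (\<Phi> (f j 1)) (\<Phi> (\<lambda>z. M $ 1 $ j * Y 1 z + M $ 2 $ j * Y 2 z))"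
        using linear_germ_operatorD(2)[OF \<Phi> b f(3)] by (simp add: sum_2)
      also have "germ_eq b \<dots> (\<lambda>z. M $ 1 $ j * \<Phi> (Y 1) z + M $ 2 $ j * \<Phi> (Y 2) z)"
        by (rule linear_germ_operatorD(3)[OF \<Phi> b Y Y])
      finally show "germ_eq b (\<Phi> (f j 1)) (\<lambda>z. \<Sum>i\<in>UNIV. M $ i $ j * \<Phi> (Y i) z)"
        by (simp add: sum_2)
    qed
  qed (rule g)
next
  fix M :: "complex^2^2" assume "M \<in> monodromy_group \<Omega> b (\<lambda>i. \<Phi> (Y i))"
  then obtain g f where g: "path_from \<Omega> b g" "pathfinish g = b"
    and f: "\<And>j. analytic_continuation_along g (f j)" "\<And>j. germ_eq b (f j 0) (\<Phi> (Y j))"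
     "\<And>j. germ_eq b (f j 1) (\<lambda>z. \<Sum>i\<in>UNIV. M $ i $ j * \<Phi> (Y i) z)"
    by (rule monodromy_groupE) blast
  have g01: "g 0 = b" "g 1 = b" "path g" "path_image g \<subseteq> \<Omega>"
    using g by (auto simp: path_from_def pathstart_def pathfinish_def)
  have "g 0 \<notin> A" "g 1 \<notin> A" using b g01 by auto
  then obtain g' f' where g': "path g'" "path_image g' \<subseteq> \<Omega> - A" "g' 0 = g 0" "g' 1 = g 1"
    and f': "\<And>j. analytic_continuation_along g' (f' j)"
      "\<And>j. germ_eq (g 0) (f' j 0) (f j 0)" "\<And>j. germ_eq (g 1) (f' j 1) (f j 1)"
    by (rule continuation_avoiding[where f = f, OF \<Omega> A g01(3,4) _ _ f(1)]) blast
  show "M \<in> monodromy_group (\<Omega> - A) b Y"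
    unfolding monodromy_group_def mem_Collect_eq
  proof (intro exI[of _ g'] conjI allI)
    show "path_from (\<Omega> - A) b g'" "pathfinish g' = b"
      using g' g01 by (auto simp: path_from_def pathstart_def pathfinish_def)
    fix j
    show "\<exists>f. analytic_continuation_along g' f \<and> germ_eq b (f 0) (Y j) \<and>
               germ_eq b (f 1) (\<lambda>z. \<Sum>i\<in>UNIV. M $ i $ j * Y i z)"
    proof (intro exI[of _ "\<lambda>t. \<Psi> (f' j t)"] conjI)
      show "analytic_continuation_along g' (\<lambda>t. \<Psi> (f' j t))"
        using g' f'(1) by (intro linear_germ_operator_continuation[OF \<Psi>])
      have "germ_eq b (f' j 0) (\<Phi> (Y j))" using f'(2)[of j] f(2)[of j] unfolding g01
          by (rule germ_eq_trans)
      then have "germ_eq b (\<Psi> (f' j 0)) (\<Psi> (\<Phi> (Y j)))" by (rule linear_germ_operatorD(2)[OF \<Psi> b])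
      then show "germ_eq b (\<Psi> (f' j 0)) (Y j)" using \<Psi>\<Phi> by (rule germ_eq_trans)
      have an: "\<Phi> (Y i) analytic_on {b}" for i using linear_germ_operatorD(1)[OF \<Phi> b Y] .
      have "germ_eq b (f' j 1) (\<lambda>z. M $ 1 $ j * \<Phi> (Y 1) z + M $ 2 $ j * \<Phi> (Y 2) z)"
        using germ_eq_trans[OF f'(3)[of j, unfolded g01] f(3)[of j]] by (simp add: sum_2)
      then have "germ_eq b (\<Psi> (f' j 1)) (\<Psi> (\<lambda>z. M $ 1 $ j * \<Phi> (Y 1) z + M $ 2 $ j * \<Phi> (Y 2) z))"
        by (rule linear_germ_operatorD(2)[OF \<Psi> b])
      also have "germ_eq b \<dots> (\<lambda>z. M $ 1 $ j * \<Psi> (\<Phi> (Y 1)) z + M $ 2 $ j * \<Psi> (\<Phi> (Y 2)) z)"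
        by (rule linear_germ_operatorD(3)[OF \<Psi> b an an])
      also have "germ_eq b \<dots> (\<lambda>z. M $ 1 $ j * Y 1 z + M $ 2 $ j * Y 2 z)"
        using \<Psi>\<Phi>[of 1] \<Psi>\<Phi>[of 2] unfolding germ_eq_def by eventually_elim simp
      finally show "germ_eq b (\<Psi> (f' j 1)) (\<lambda>z. \<Sum>i\<in>UNIV. M $ i $ j * Y i z)"
        by (simp add: sum_2)
    qed
  qed
qed

section \<open>Apparent singularities\<close>

lemma eventually_at_openE:
  fixes a :: complex
  assumes "\<forall>\<^sub>F z in at a. Q z"
  obtains T where "open T" "a \<in> T" "\<And>z. z \<in> T - {a} \<Longrightarrow> Q z"
  using assms unfolding eventually_at_topological by blast

lemma eventually_at_deriv_cong:
  fixes f g :: "complex \<Rightarrow> complex"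
  assumes "\<forall>\<^sub>F z in at a. f z = g z"
  shows "\<forall>\<^sub>F z in at a. deriv f z = deriv g z"
proof -
  obtain T where T: "open T" "a \<in> T" "\<And>z. z \<in> T - {a} \<Longrightarrow> f z = g z"
    using assms by (rule eventually_at_openE) blast
  have "deriv f z = deriv g z" if "z \<in> T - {a}" for z
    using T that by (intro deriv_cong_ev eventually_mono[OF eventually_nhds_in_open[of "T
        - {a}" z]]) auto
  then show ?thesis unfolding eventually_at_topological using T by blast
qed

text \<open>The identity theorem, in the form that carries the Riccati equation from the base point
  to the singularity.\<close>

lemma meromorphic_eventually_zero:
  assumes f: "f meromorphic_on A" "open A" "connected A" and b: "b \<in> A" "\<forall>\<^sub>F z in at b. f z
      = 0" and a: "a \<in> A"
  shows "\<forall>\<^sub>F z in at a. f z = 0"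
proof -
  consider "\<forall>\<^sub>F z in cosparse A. f z = 0" | "\<forall>\<^sub>F z in cosparse A. f z \<noteq> 0"
    using meromorphic_imp_constant_or_avoid[OF f, of 0] by blast
  then show ?thesis
  proof cases
    case 1
    then show ?thesis using f a by (simp add: eventually_cosparse_open_eq)
  next
    case 2
    then have "\<forall>\<^sub>F z in at b. f z \<noteq> 0" using f b by (simp add: eventually_cosparse_open_eq)
    with b(2) have "\<forall>\<^sub>F z in at b. False" by eventually_elim simp
    then show ?thesis by simp
  qed
qed

lemma analytic_eventually_nonzero:
  assumes "f analytic_on {a}"
  shows "(\<forall>\<^sub>F z in nhds a. f z = 0) \<or> (\<forall>\<^sub>F z in at a. f z \<noteq> 0)"
proof -
  obtain e where e: "e > 0" "f holomorphic_on ball a e" using assms by (auto simp: analytic_at_ball)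
  then have "f meromorphic_on ball a e"
    by (intro analytic_on_imp_meromorphic_on) (simp add: analytic_on_open)
  then consider "\<forall>\<^sub>F z in cosparse (ball a e). f z = 0" | "\<forall>\<^sub>F z in cosparse (ball a e). f z \<noteq> 0"
    using meromorphic_imp_constant_or_avoid[of f "ball a e" 0] by auto
  then show ?thesis
  proof cases
    case 1
    then have ev: "\<forall>\<^sub>F z in at a. f z = 0" using e by (simp add: eventually_cosparse_open_eq)
    have "f \<midarrow>a\<rightarrow> f a" using assms analytic_at_imp_isCont isContD by blast
    moreover have "f \<midarrow>a\<rightarrow> 0" using ev by (rule tendsto_eventually)
    ultimately have "f a = 0" by (rule LIM_unique)
    with ev show ?thesis unfolding eventually_at_filter by (auto elim!: eventually_mono)
  next
    case 2
    then show ?thesis using e by (simp add: eventually_cosparse_open_eq)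
  qed
qed

lemma analytic_divide_linear:
  assumes "f analytic_on {a}"
  obtains v where "v analytic_on {a}" "\<forall>\<^sub>F z in nhds a. f z = f a + (z - a) * v z"
proof -
  obtain e where e: "e > 0" "f holomorphic_on ball a e" using assms by (auto simp: analytic_at_ball)
  define v where "v z = (if z = a then deriv f a else (f z - f a) / (z - a))" for z
  have "v holomorphic_on ball a e" unfolding v_def by (rule pole_lemma_open[OF e(2) open_ball])
  then have v: "v analytic_on {a}" using e by (auto simp: analytic_at_ball)
  have "f z = f a + (z - a) * v z" for z
    by (simp add: v_def)
  then have "\<forall>\<^sub>F z in nhds a. f z = f a + (z - a) * v z"
    by (intro always_eventually allI)
  with v show ?thesis by (rule that)
qed

lemma analytic_taylor:
  assumes "f analytic_on {a}"
  shows "\<exists>T u. u analytic_on {a} \<and> (\<forall>\<^sub>F z in nhds a. f z = poly T z + (z - a) ^ n * u z)"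
proof (induction n)
  case 0
  show ?case using assms by (intro exI[of _ 0] exI[of _ f]) simp
next
  case (Suc n)
  then obtain T u where Tu: "u analytic_on {a}" "\<forall>\<^sub>F z in nhds a. f z = poly T z + (z
      - a) ^ n * u z" by blast
  obtain v where v: "v analytic_on {a}" "\<forall>\<^sub>F z in nhds a. u z = u a + (z - a) * v z"
    using Tu(1) by (rule analytic_divide_linear)
  have "\<forall>\<^sub>F z in nhds a. f z = poly (T + smult (u a) ([:-a, 1:] ^ n)) z + (z - a) ^ Suc n * v z"
    using Tu(2) v(2) by eventually_elim (simp add: algebra_simps poly_power)
  with v(1) show ?case by blast
qed

lemma analytic_factor:
  assumes "f analytic_on {a}" "\<forall>\<^sub>F z in at a. f z \<noteq> 0"
  obtains n u where "u analytic_on {a}" "u a \<noteq> 0" "\<forall>\<^sub>F z in nhds a. f z = (z - a) ^ n * u z"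
proof (cases "f a = 0")
  case False
  show ?thesis by (rule that[of f 0]) (use assms False in auto)
next
  case True
  obtain e where e: "e > 0" "f holomorphic_on ball a e" using assms by (auto simp: analytic_at_ball)
  have "\<not> f constant_on ball a e"
  proof
    assume "f constant_on ball a e"
    then have "\<And>z. z \<in> ball a e \<Longrightarrow> f z = 0" using True e unfolding constant_on_def
        by (metis centre_in_ball)
    then have "\<forall>\<^sub>F z in at a. f z = 0"
      using e by (auto simp: eventually_at intro!: exI[of _ e] simp: dist_commute)
    with assms(2) have "\<forall>\<^sub>F z in at a. False" by eventually_elim simp
    then show False by simp
  qed
  note nonconst = this
  have "a \<in> ball a e" using e(1) by simp
  obtain g r n where g: "0 < n" "0 < r" "ball a r \<subseteq> ball a e" "g holomorphic_on ball a r"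
            "\<And>w. w \<in> ball a r \<Longrightarrow> f w = (w - a)^n * g w" "\<And>w. w \<in> ball a r \<Longrightarrow> g w \<noteq> 0"
    by (rule holomorphic_factor_zero_nonconstant[OF e(2) open_ball connected_ball \<open>a \<in> ball a e\<close>
        True nonconst]) blast
  show ?thesis
  proof (rule that[of g n])
    show "g analytic_on {a}" using g by (auto simp: analytic_at_ball)
    show "g a \<noteq> 0" using g by simp
    show "\<forall>\<^sub>F z in nhds a. f z = (z - a) ^ n * g z"
      using eventually_nhds_in_open[OF open_ball, of a a r] g by (auto elim!: eventually_mono)
  qed
qed

text \<open>Turns a local order of vanishing into divisibility. Continuity of \<open>u\<close>
  excludes a pole that would cancel the power of z - a.\<close>

lemma poly_dvd_if_analytic_factor:
  fixes R :: "complex poly"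
  assumes "isCont u a" "\<forall>\<^sub>F z in at a. poly R z = (z - a) ^ n * u z"
  shows "[:-a, 1:] ^ n dvd R"
  using assms(2)
proof (induction n arbitrary: R)
  case (Suc n)
  have "(\<lambda>z. (z - a) ^ Suc n * u z) \<midarrow>a\<rightarrow> (a - a) ^ Suc n * u a"
    using assms(1) by (intro tendsto_intros isContD)
  then have "poly R \<midarrow>a\<rightarrow> (a - a) ^ Suc n * u a"
    by (rule Lim_transform_eventually) (use Suc.prems in \<open>auto elim!: eventually_mono\<close>)
  moreover have "poly R \<midarrow>a\<rightarrow> poly R a" using poly_isCont isContD by blast
  ultimately have "poly R a = 0" using LIM_unique by fastforce
  then obtain S where S: "R = [:-a, 1:] * S" by (auto simp: poly_eq_0_iff_dvd elim: dvdE)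
  have "\<forall>\<^sub>F z in at a. z \<noteq> a" by (simp add: eventually_at_filter)
  with Suc.prems have "\<forall>\<^sub>F z in at a. poly S z = (z - a) ^ n * u z"
  proof eventually_elim
    case (elim z)
    then have "(z - a) * poly S z = (z - a) * ((z - a) ^ n * u z)" by (simp add: S algebra_simps)
    with elim(2) show ?case by simp
  qed
  from Suc.IH[OF this] show ?case unfolding S power_Suc by (rule mult_dvd_mono[OF dvd_refl])
qed simp

lemma poly_analytic [simp, intro]: "poly g analytic_on S" for g :: "complex poly"
proof -
  have "poly g holomorphic_on UNIV"
    by (rule holomorphic_onI) (auto simp: field_differentiable_def intro: DERIV_subset[OF
        poly_DERIV])
  then show ?thesis by (simp add: analytic_on_open analytic_on_subset[of _ UNIV])
qed

text \<open>Newton's scheme: W vanishes at the old nodes to the required orders, so adding W t does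
  no harm there, and t is a Taylor polynomial of (G c - g) / W at the new node c.\<close>

lemma hermite_interpolation:
  fixes G :: "complex \<Rightarrow> complex \<Rightarrow> complex"
  assumes "finite A" "\<And>a. a \<in> A \<Longrightarrow> G a analytic_on {a}"
  shows "\<exists>g. \<forall>a\<in>A. \<exists>u. u analytic_on {a} \<and> (\<forall>\<^sub>F z in nhds a. poly g z - G a z = (z
      - a) ^ n a * u z)"
  using assms
proof (induction A rule: finite_induct)
  case (insert c A)
  then obtain g where g: "\<And>a. a \<in> A \<Longrightarrow> \<exists>u. u analytic_on {a} \<and>
      (\<forall>\<^sub>F z in nhds a. poly g z - G a z = (z - a) ^ n a * u z)"
    by blast
  define W where "W = (\<Prod>a\<in>A. [:-a, 1:] ^ n a)"
  have Wc: "poly W c \<noteq> 0" using insert.hyps by (auto simp: W_def poly_prod poly_power)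
  have "(\<lambda>z. (G c z - poly g z) / poly W z) analytic_on {c}"
    using insert.prems Wc by (intro analytic_intros) auto
  then obtain t u where tu: "u analytic_on {c}"
    "\<forall>\<^sub>F z in nhds c. (G c z - poly g z) / poly W z = poly t z + (z - c) ^ n c * u z"
    using analytic_taylor by blast
  show ?case
  proof (intro exI[of _ "g + W * t"] ballI)
    fix a assume a: "a \<in> insert c A"
    show "\<exists>u. u analytic_on {a} \<and> (\<forall>\<^sub>F z in nhds a. poly (g + W * t) z - G a z = (z
        - a) ^ n a * u z)"
    proof (cases "a = c")
      case True
      have "\<forall>\<^sub>F z in nhds c. poly W z \<noteq> 0"
        using tendsto_imp_eventually_ne[OF isContD[OF poly_isCont] Wc]
        by (simp add: eventually_nhds_conv_at Wc)
      with tu(2) have "\<forall>\<^sub>F z in nhds c. poly (g + W * t) z - G c z = (z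
          - c) ^ n c * (- poly W z * u z)"
        by eventually_elim (simp add: field_simps)
      moreover have "(\<lambda>z. - poly W z * u z) analytic_on {c}" using tu(1)
          by (intro analytic_intros) auto
      ultimately show ?thesis using True by blast
    next
      case False
      with a have a: "a \<in> A" by simp
      from g[OF a] obtain v where v: "v analytic_on {a}" "\<forall>\<^sub>F z in nhds a. poly g z - G a z = (z
          - a) ^ n a * v z"
        by blast
      obtain W' where W': "W = [:-a, 1:] ^ n a * W'"
        unfolding W_def using prod.remove[OF insert.hyps(1) a, of "\<lambda>a. [:-a, 1:] ^ n a"] by blast
      have "\<forall>\<^sub>F z in nhds a. poly (g + W * t) z - G a z = (z - a) ^ n a * (v z + poly (W' * t) z)"
        using v(2) by eventually_elim (simp add: W' algebra_simps poly_power)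
      moreover have "(\<lambda>z. v z + poly (W' * t) z) analytic_on {a}" using v(1)
          by (intro analytic_on_add poly_analytic)
      ultimately show ?thesis by blast
    qed
  qed
qed simp


text \<open>For \<open>H = y\<^sub>1 / y\<^sub>2\<close> the function \<open>\<sigma>\<close> is \<open>y\<^sub>2' / y\<^sub>2\<close>, because \<open>H'\<close> is the Wronskian divided by
  \<open>y\<^sub>2\<^sup>2\<close>. By the Riccati equation its residue \<open>e\<close> is \<open>0\<close> or \<open>m + 1\<close>; since \<open>H\<close> has no pole,
  \<open>e \<le> m / 2\<close>.\<close>

lemma apparent_residue_zero:
  assumes p0: "p0 analytic_on {a}" and q0: "q0 analytic_on {a}" and H: "H analytic_on {a}"
    and H0: "\<forall>\<^sub>F z in at a. deriv H z \<noteq> 0"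
    and p: "\<forall>\<^sub>F z in at a. p z = - of_nat m / (z - a) + p0 z"
    and q: "\<forall>\<^sub>F z in at a. q z = q0 z / (z - a)"
    and \<sigma>: "\<forall>\<^sub>F z in at a. \<sigma> z = - (p z + deriv (deriv H) z / deriv H z) / 2"
    and ric: "\<forall>\<^sub>F z in at a. deriv \<sigma> z + (\<sigma> z)\<^sup>2 + p z * \<sigma> z + q z = 0"
  obtains s where "s analytic_on {a}" "\<forall>\<^sub>F z in at a. \<sigma> z = s z"
proof -
  obtain n u where u: "u analytic_on {a}" "u a \<noteq> 0" "\<forall>\<^sub>F z in nhds a. deriv H z = (z - a) ^ n * u z"
    using analytic_factor[OF analytic_deriv[OF H] H0] by blast
  \<comment> \<open>At \<open>a\<close> the residue of \<open>p\<close> is - m, and that of H'' / H'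
    is the order n of the zero of H'; hence the residue of \<sigma> is (m - n) / 2.\<close>
  define e where "e = (of_nat m - of_nat n) / (2 :: complex)"
  define s where "s z = - (p0 z + deriv u z / u z) / 2" for z
  have s: "s analytic_on {a}" unfolding s_def using p0 u
    by (intro analytic_on_divide analytic_on_neg analytic_on_add analytic_deriv
        analytic_on_const) auto
  have unz: "\<forall>\<^sub>F z in at a. u z \<noteq> 0"
    using tendsto_imp_eventually_ne[OF isContD[OF analytic_at_imp_isCont[OF u(1)]] u(2)] .
  obtain T where T: "open T" "a \<in> T" "u holomorphic_on T" using u(1) by (auto simp: analytic_at)
  have inT: "\<forall>\<^sub>F z in at a. z \<in> T - {a}" using eventually_at_in_open[OF T(1,2)] .
  have "\<forall>\<^sub>F z in at a. deriv (deriv H) z = deriv (\<lambda>z. (z - a) ^ n * u z) z"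
    using u(3) by (intro eventually_at_deriv_cong) (simp add: eventually_at_filter eventually_mono)
  moreover have "\<forall>\<^sub>F z in at a. deriv H z = (z - a) ^ n * u z"
    using u(3) by (simp add: eventually_at_filter eventually_mono)
  ultimately have \<sigma>s: "\<forall>\<^sub>F z in at a. \<sigma> z = e / (z - a) + s z"
    using p \<sigma> unz inT
  proof eventually_elim
    case (elim z)
    have za: "z - a \<noteq> 0" using elim by auto
    have "(u has_field_derivative deriv u z) (at z)" using T elim
        by (auto intro: holomorphic_derivI)
    then have "((\<lambda>z. (z - a) ^ n * u z) has_field_derivative
        (of_nat n * (z - a) ^ (n - 1)) * u z + (z - a) ^ n * deriv u z) (at z)"
      by (auto intro!: derivative_eq_intros)
    then have "deriv (deriv H) z = (of_nat n * (z - a) ^ (n - 1)) * u z + (z - a) ^ n * deriv u z"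
      using elim(1) by (simp add: DERIV_imp_deriv)
    also have "(of_nat n :: complex) * (z - a) ^ (n - 1) = of_nat n / (z - a) * (z - a) ^ n"
      using za by (cases n) auto
    finally have "deriv (deriv H) z = (z - a) ^ n * u z * (of_nat n / (z - a) + deriv u z / u z)"
      using elim(5) by (simp add: field_simps)
    then have "deriv (deriv H) z / deriv H z = of_nat n / (z - a) + deriv u z / u z"
      unfolding elim(2) using za elim(5) by simp
    then show ?case unfolding elim(3) elim(4)
      by (simp add: e_def s_def diff_divide_distrib add_divide_distrib mult.commute)
  qed
  obtain U where U: "open U" "a \<in> U" "s holomorphic_on U" using s by (auto simp: analytic_at)
  have inU: "\<forall>\<^sub>F z in at a. z \<in> U - {a}" using eventually_at_in_open[OF U(1,2)] .
  \<comment> \<open>The Riccati expression times (z - a)^2, continuous at \<open>a\<close>. Its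
    value there is e (e - 1 - m), the indicial polynomial.\<close>
  define G where "G z = - e + (z - a)\<^sup>2 * deriv s z + (e + (z - a) * s z)\<^sup>2
      + (- of_nat m + (z - a) * p0 z) * (e + (z - a) * s z) + (z - a) * q0 z" for z
  have "\<forall>\<^sub>F z in at a. G z = 0"
    using eventually_at_deriv_cong[OF \<sigma>s] \<sigma>s p q ric inU
  proof eventually_elim
    case (elim z)
    have za: "z - a \<noteq> 0" using elim by auto
    have "(s has_field_derivative deriv s z) (at z)" using U elim
        by (auto intro: holomorphic_derivI)
    then have "((\<lambda>z. e / (z - a) + s z) has_field_derivative - e / (z - a)\<^sup>2 + deriv s z) (at z)"
      using za by (auto intro!: derivative_eq_intros simp: power2_eq_square)
    then have ds: "deriv \<sigma> z = - e / (z - a)\<^sup>2 + deriv s z" using elim(1)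
        by (simp add: DERIV_imp_deriv)
    have "G z = (z - a)\<^sup>2 * (deriv \<sigma> z + (\<sigma> z)\<^sup>2 + p z * \<sigma> z + q z)"
    proof -
      define w where "w = z - a"
      have "w \<noteq> 0" using za by (simp add: w_def)
      then have "w\<^sup>2 * (- e / w\<^sup>2 + deriv s z) = - e + w\<^sup>2 * deriv s z"
        "w\<^sup>2 * (e / w + s z)\<^sup>2 = (e + w * s z)\<^sup>2"
        "w\<^sup>2 * ((- of_nat m / w + p0 z) * (e / w + s z)) = (- of_nat m + w * p0 z) * (e + w * s z)"
        "w\<^sup>2 * (q0 z / w) = w * q0 z"
        by (simp_all add: field_simps power2_eq_square)
      then show ?thesis unfolding G_def ds elim(2,3,4) w_def[symmetric] distrib_left by simp
    qed
    then show ?case using elim(5) by simp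
  qed
  moreover have "isCont G a"
  proof -
    have "isCont s a" "isCont (deriv s) a" "isCont p0 a" "isCont q0 a"
      using s p0 q0 analytic_deriv[OF s] by (auto intro: analytic_at_imp_isCont)
    then show ?thesis unfolding G_def by (intro continuous_intros)
  qed
  ultimately have "G a = 0"
    using LIM_unique[OF isContD tendsto_eventually] by blast
  then have "e * (e - 1 - of_nat m) = 0" by (simp add: G_def power2_eq_square algebra_simps)
  then have "e = 0 \<or> e - 1 - of_nat m = 0" by (simp only: mult_eq_0_iff)
  then have "e = 0 \<or> e = 1 + of_nat m" by (auto simp: diff_diff_eq)
  moreover have "e \<noteq> 1 + of_nat m"
  proof
    assume "e = 1 + of_nat m"
    then have *: "of_nat m - of_nat n = (2 :: complex) * (1 + of_nat m)" by (simp add: e_def)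
    have "(of_nat (2 + m + n) :: complex) = 2 * (1 + of_nat m) - (of_nat m - of_nat n)" by simp
    then have "(of_nat (2 + m + n) :: complex) = 0" unfolding * by simp
    then show False unfolding of_nat_eq_0_iff by simp
  qed
  ultimately have "e = 0" by blast
  with \<sigma>s s show ?thesis using that by simp
qed

text \<open>Near \<open>b\<close> the logarithmic derivative of \<open>y2\<close> is - (p + h'' /
  h') / 2. This expression is meromorphic on the whole ball, so its Riccati equation passes from
  \<open>b\<close> to \<open>a\<close> without any continuation of \<open>y1\<close> and
  \<open>y2\<close>.\<close>

lemma apparent_core:
  assumes p0: "p0 analytic_on {a}" and q0: "q0 analytic_on {a}"
    and p: "\<forall>\<^sub>F z in at a. p z = - of_nat m / (z - a) + p0 z"
    and q: "\<forall>\<^sub>F z in at a. q z = q0 z / (z - a)"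
    and pm: "p meromorphic_on ball a r" and qm: "q meromorphic_on ball a r"
    and b: "b \<in> ball a r" and pb: "p analytic_on {b}" and qb: "q analytic_on {b}"
    and y: "local_solution p q b y1" "local_solution p q b y2"
    and W0: "y1 b * deriv y2 b - y2 b * deriv y1 b \<noteq> 0"
    and h: "h meromorphic_on ball a r" "\<not> is_pole h a" "\<forall>\<^sub>F z in at b. h z = y1 z / y2 z"
  obtains s where "s analytic_on {a}" "\<forall>\<^sub>F z in at a. deriv s z + (s z)\<^sup>2 + p z * s z + q z = 0"
proof -
  have a: "a \<in> ball a r" using b by (metis centre_in_ball ball_eq_empty empty_iff not_le)
  obtain S1 where S1: "open S1" "b \<in> S1" "y1 holomorphic_on S1"
    "\<And>z. z \<in> S1 \<Longrightarrow> deriv (deriv y1) z + p z * deriv y1 z + q z * y1 z = 0"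
    using y(1) by (rule local_solution_openE) blast
  obtain S2 where S2: "open S2" "b \<in> S2" "y2 holomorphic_on S2"
    "\<And>z. z \<in> S2 \<Longrightarrow> deriv (deriv y2) z + p z * deriv y2 z + q z * y2 z = 0"
    using y(2) by (rule local_solution_openE) blast
  define W where "W z = deriv y1 z * y2 z - y1 z * deriv y2 z" for z
  have "W analytic_on {b}" unfolding W_def
    using y by (intro analytic_intros local_solution_analytic) (auto intro:
        local_solution_analytic analytic_deriv)
  moreover have "W b \<noteq> 0" using W0 by (simp add: W_def algebra_simps)
  ultimately have Wnz: "\<forall>\<^sub>F z in at b. W z \<noteq> 0"
    using tendsto_imp_eventually_ne[OF isContD[OF analytic_at_imp_isCont]] by blast
  have y2nz: "\<forall>\<^sub>F z in at b. y2 z \<noteq> 0"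
  proof -
    have "\<not> (\<forall>\<^sub>F z in nhds b. y2 z = 0)"
    proof
      assume "\<forall>\<^sub>F z in nhds b. y2 z = 0"
      then have *: "germ_eq b y2 (\<lambda>_. 0)" by (simp add: germ_eq_def)
      from germ_eq_at[OF this] germ_eq_at[OF germ_eq_deriv[OF this]] W0 show False by simp
    qed
    then show ?thesis
      using analytic_eventually_nonzero[OF local_solution_analytic[OF y(2)]] by blast
  qed
  have "\<forall>\<^sub>F z in at b. h z = y1 z / y2 z \<and> y2 z \<noteq> 0 \<and> W z \<noteq> 0"
    using h(3) y2nz Wnz by eventually_elim simp
  then obtain T where T: "open T" "b \<in> T" "\<And>z. z \<in> T - {b} \<Longrightarrow> h z = y1 z / y2 z \<and> y2 z \<noteq> 0 \<and> W z \<noteq> 0"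
    by (rule eventually_at_openE) blast
  define N where "N = S1 \<inter> S2 \<inter> T - {b}"
  have N: "open N" using S1 S2 T by (auto simp: N_def)
  have evN: "\<forall>\<^sub>F z in at b. z \<in> N"
    unfolding N_def using S1 S2 T by (intro eventually_at_in_open) auto
  have congN: "deriv f z = deriv g z" if "z \<in> N" "\<And>w. w \<in> N \<Longrightarrow> f w = g w" for f g z
    using N that by (intro deriv_cong_ev eventually_mono[OF eventually_nhds_in_open[of N z]]) auto
  define \<sigma> where "\<sigma> z = - (p z + deriv (deriv h) z / deriv h z) / 2" for z
  have der: "(y1 has_field_derivative deriv y1 z) (at z)" "(y2 has_field_derivative deriv y2 z)
      (at z)"
     "(deriv y1 has_field_derivative - (p z * deriv y1 z + q z * y1 z)) (at z)"
     "(deriv y2 has_field_derivative - (p z * deriv y2 z + q z * y2 z)) (at z)" if "z \<in> N" for z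
  proof -
    have z: "z \<in> S1" "z \<in> S2" using that by (auto simp: N_def)
    show "(y1 has_field_derivative deriv y1 z) (at z)" "(y2 has_field_derivative deriv y2 z) (at z)"
      using z S1 S2 by (auto intro: holomorphic_derivI)
    have "deriv (deriv y1) z = - (p z * deriv y1 z + q z * y1 z)"
      using S1(4)[OF z(1)] by (simp add: algebra_simps add_eq_0_iff)
    then show "(deriv y1 has_field_derivative - (p z * deriv y1 z + q z * y1 z)) (at z)"
      using holomorphic_derivI[OF holomorphic_deriv[OF S1(3,1)] S1(1) z(1)] by simp
    have "deriv (deriv y2) z = - (p z * deriv y2 z + q z * y2 z)"
      using S2(4)[OF z(2)] by (simp add: algebra_simps add_eq_0_iff)
    then show "(deriv y2 has_field_derivative - (p z * deriv y2 z + q z * y2 z)) (at z)"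
      using holomorphic_derivI[OF holomorphic_deriv[OF S2(3,1)] S2(1) z(2)] by simp
  qed
  have nz: "y2 z \<noteq> 0" "W z \<noteq> 0" if "z \<in> N" for z using T(3)[of z] that by (auto simp: N_def)
  have dh: "deriv h z = W z / (y2 z)\<^sup>2" if z: "z \<in> N" for z
  proof -
    have "deriv h z = deriv (\<lambda>z. y1 z / y2 z) z" using T by (intro congN[OF z]) (auto simp: N_def)
    also have "\<dots> = W z / (y2 z)\<^sup>2"
      using der(1,2)[OF z] nz(1)[OF z]
      by (intro DERIV_imp_deriv) (auto intro!: derivative_eq_intros simp: W_def power2_eq_square)
    finally show ?thesis .
  qed
  have ddh: "deriv (deriv h) z = W z / (y2 z)\<^sup>2 * (- p z - 2 * deriv y2 z / y2 z)" if z: "z \<in> N"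
      for z
  proof -
    have dW: "(W has_field_derivative - p z * W z) (at z)"
      unfolding W_def using der[OF z] by (auto intro!: derivative_eq_intros simp: algebra_simps)
    have "deriv (deriv h) z = deriv (\<lambda>z. W z / (y2 z)\<^sup>2) z" by (intro congN[OF z]) (auto simp: dh)
    also have "\<dots> = ((- p z * W z) * (y2 z)\<^sup>2 - W z * (2 * deriv y2 z * y2 z)) / ((y2 z)\<^sup>2 * (y2
        z)\<^sup>2)"
      using dW der(2)[OF z] nz(1)[OF z]
      by (intro DERIV_imp_deriv) (auto intro!: derivative_eq_intros simp: mult_ac)
    also have "\<dots> = W z / (y2 z)\<^sup>2 * (- p z - 2 * deriv y2 z / y2 z)"
      using nz(1)[OF z] by (simp add: field_simps power2_eq_square)
    finally show ?thesis .
  qed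
  have \<sigma>N: "\<sigma> z = deriv y2 z / y2 z" if z: "z \<in> N" for z
    unfolding \<sigma>_def dh[OF z] ddh[OF z] using nz[OF z] by (simp add: field_simps)
  have ricN: "deriv \<sigma> z + (\<sigma> z)\<^sup>2 + p z * \<sigma> z + q z = 0" if z: "z \<in> N" for z
  proof -
    have "deriv \<sigma> z = deriv (\<lambda>z. deriv y2 z / y2 z) z" by (intro congN[OF z]) (auto simp: \<sigma>N)
    also have "\<dots> = (- (p z * deriv y2 z + q z * y2 z) * y2 z
        - deriv y2 z * deriv y2 z) / (y2 z * y2 z)"
      using der(2,4)[OF z] nz(1)[OF z] by (intro DERIV_imp_deriv) (auto intro!:
          derivative_eq_intros)
    finally show ?thesis
      unfolding \<sigma>N[OF z] using nz(1)[OF z] by (simp add: field_simps power2_eq_square)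
  qed
  have \<sigma>m: "\<sigma> meromorphic_on ball a r" unfolding \<sigma>_def using pm h(1) by (intro meromorphic_intros)
  have "(\<lambda>z. deriv \<sigma> z + (\<sigma> z)\<^sup>2 + p z * \<sigma> z + q z) meromorphic_on ball a r"
    using \<sigma>m pm qm by (intro meromorphic_intros)
  then have ric: "\<forall>\<^sub>F z in at a. deriv \<sigma> z + (\<sigma> z)\<^sup>2 + p z * \<sigma> z + q z = 0"
    using evN ricN by (intro meromorphic_eventually_zero[OF _ open_ball connected_ball b _ a])
        (auto elim: eventually_mono)
  have hnz: "\<forall>\<^sub>F z in at a. deriv h z \<noteq> 0"
  proof -
    have dhm: "deriv h meromorphic_on ball a r" using h(1) by (intro meromorphic_intros)
    consider "\<forall>\<^sub>F z in cosparse (ball a r). deriv h z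
        = 0" | "\<forall>\<^sub>F z in cosparse (ball a r). deriv h z \<noteq> 0"
      using meromorphic_imp_constant_or_avoid[OF dhm open_ball connected_ball, of 0] by blast
    then show ?thesis
    proof cases
      case 1
      then have "\<forall>\<^sub>F z in at b. deriv h z = 0" using b by (simp add: eventually_cosparse_open_eq)
      with evN have "\<forall>\<^sub>F z in at b. False" by eventually_elim (use dh nz in auto)
      then show ?thesis by simp
    next
      case 2
      then show ?thesis using a by (simp add: eventually_cosparse_open_eq)
    qed
  qed
  have hma: "h meromorphic_on {a}" using h(1) a by (auto intro: meromorphic_on_subset)
  then have iso: "isolated_singularity_at h a" and "not_essential h a"
      by (auto simp: meromorphic_at_iff)
  then obtain c where c: "h \<midarrow>a\<rightarrow> c" using h(2) by (auto simp: not_essential_def)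
  define H where "H = remove_sings h"
  have H: "H analytic_on {a}" unfolding H_def by (rule remove_sings_analytic_at[OF iso c])
  have Hh: "\<forall>\<^sub>F z in at a. H z = h z" unfolding H_def
      by (rule eventually_remove_sings_eq_at[OF iso])
  note Hh1 = eventually_at_deriv_cong[OF Hh]
  note Hh2 = eventually_at_deriv_cong[OF Hh1]
  have "\<forall>\<^sub>F z in at a. deriv H z \<noteq> 0" using Hh1 hnz by eventually_elim simp
  moreover have "\<forall>\<^sub>F z in at a. \<sigma> z = - (p z + deriv (deriv H) z / deriv H z) / 2"
    using Hh1 Hh2 by eventually_elim (simp add: \<sigma>_def)
  ultimately obtain s where s: "s analytic_on {a}" "\<forall>\<^sub>F z in at a. \<sigma> z = s z"
    using apparent_residue_zero[OF p0 q0 H _ p q _ ric] by blast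
  have "\<forall>\<^sub>F z in at a. deriv s z + (s z)\<^sup>2 + p z * s z + q z = 0"
    using ric s(2) eventually_at_deriv_cong[OF s(2)] by eventually_elim simp
  with s(1) show ?thesis using that by blast
qed

text \<open>If the ratio h has a pole at \<open>a\<close>, the two solutions are exchanged and h
  becomes 1 / h. What is extracted from apparentness is the logarithmic derivative, holomorphic at
  \<open>a\<close>, of one solution.\<close>

lemma apparent_riccati:
  assumes app: "apparent_singularity \<Omega> p q a"
    and p0: "p0 analytic_on {a}" and q0: "q0 analytic_on {a}"
    and p: "\<forall>\<^sub>F z in at a. p z = - of_nat m / (z - a) + p0 z"
    and q: "\<forall>\<^sub>F z in at a. q z = q0 z / (z - a)"
    and pm: "p meromorphic_on UNIV" and qm: "q meromorphic_on UNIV"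
    and \<Omega>: "open \<Omega>" "p holomorphic_on \<Omega>" "q holomorphic_on \<Omega>"
  obtains s where "s analytic_on {a}" "\<forall>\<^sub>F z in at a. deriv s z + (s z)\<^sup>2 + p z * s z + q z = 0"
proof -
  obtain r where r: "r > 0" "ball a r - {a} \<subseteq> \<Omega>"
    and ratio: "\<And>b Y. b \<in> ball a r - {a} \<Longrightarrow> (\<And>i. local_solution p q b (Y i)) \<Longrightarrow>
        germs_independent b Y \<Longrightarrow>
           \<exists>h. h meromorphic_on ball a r \<and> (\<forall>\<^sub>F z in at b. h z = Y 1 z / Y 2 z)"
    using app unfolding apparent_singularity_def by blast
  define b where "b = a + of_real (r / 2)"
  have b: "b \<in> ball a r - {a}" using r by (auto simp: b_def dist_norm)
  then have "b \<in> \<Omega>" using r by blast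
  then have pb: "p analytic_on {b}" and qb: "q analytic_on {b}"
    using \<Omega> by (auto intro: holomorphic_on_imp_analytic_at)
  obtain Y where Y: "solution_basis p q b Y" using exists_solution_basis[OF pb qb] by blast
  then have Y: "\<And>i. local_solution p q b (Y i)" "germs_independent b Y"
    by (auto simp: solution_basis_def)
  have det: "Y 1 b * deriv (Y 2) b - Y 2 b * deriv (Y 1) b \<noteq> 0"
    by (rule germs_independent_imp_det[OF pb qb Y])
  then have det': "Y 2 b * deriv (Y 1) b - Y 1 b * deriv (Y 2) b \<noteq> 0" by (simp add: algebra_simps)
  obtain h where h: "h meromorphic_on ball a r" "\<forall>\<^sub>F z in at b. h z = Y 1 z / Y 2 z"
    using ratio[OF b Y] by blast
  have m: "p meromorphic_on ball a r" "q meromorphic_on ball a r"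
    using pm qm by (auto intro: meromorphic_on_subset)
  note core = apparent_core[OF p0 q0 p q m _ pb qb]
  show ?thesis
  proof (cases "is_pole h a")
    case False
    show ?thesis by (rule core[OF _ Y(1) Y(1) det h(1) False h(2)]) (use b that in auto)
  next
    case True
    then have "(\<lambda>z. inverse (h z)) \<midarrow>a\<rightarrow> 0" unfolding is_pole_def
      by (rule filterlim_compose[OF tendsto_inverse_0])
    then have np: "\<not> is_pole (\<lambda>z. inverse (h z)) a" unfolding is_pole_def
      by (metis at_neq_bot not_tendsto_and_filterlim_at_infinity)
    have "(\<lambda>z. inverse (h z)) meromorphic_on ball a r" using h(1) by (intro meromorphic_intros)
    moreover have "\<forall>\<^sub>F z in at b. inverse (h z) = Y 2 z / Y 1 z" using h(2) by eventually_elim simp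
    ultimately show ?thesis using core[OF _ Y(1) Y(1) det' _ np] b that by auto
  qed
qed

section \<open>Differential operators with polynomial coefficients\<close>

text \<open>Gaussian elimination on the coefficient of degree n with pivot \<open>i0\<close>.
  Dependence is stated for an indexed family because its members may coincide.\<close>

lemma poly_family_dependent:
  fixes p :: "'i \<Rightarrow> 'a::field poly"
  assumes "finite S" "card S > n" "\<And>i l. i \<in> S \<Longrightarrow> l \<ge> n \<Longrightarrow> coeff (p i) l = 0"
  shows "\<exists>c. (\<exists>i\<in>S. c i \<noteq> 0) \<and> (\<Sum>i\<in>S. smult (c i) (p i)) = 0"
  using assms
proof (induction n arbitrary: S p)
  case 0
  then obtain i0 where i0: "i0 \<in> S" by fastforce
  have "p i = 0" if "i \<in> S" for i using 0 that by (simp add: poly_eq_iff)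
  then show ?case using i0 by (intro exI[of _ "\<lambda>_. 1"]) auto
next
  case (Suc n)
  show ?case
  proof (cases "\<forall>i\<in>S. coeff (p i) n = 0")
    case True
    have "\<exists>c. (\<exists>i\<in>S. c i \<noteq> 0) \<and> (\<Sum>i\<in>S. smult (c i) (p i)) = 0"
    proof (rule Suc.IH)
      show "coeff (p i) l = 0" if "i \<in> S" "l \<ge> n" for i l
        using that True Suc.prems(3)[of i l] by (cases "l = n") auto
    qed (use Suc.prems in auto)
    then show ?thesis .
  next
    case False
    then obtain i0 where i0: "i0 \<in> S" "coeff (p i0) n \<noteq> 0" by auto
    define r where "r i = coeff (p i) n / coeff (p i0) n" for i
    have "\<exists>c. (\<exists>i\<in>S - {i0}. c i \<noteq> 0) \<and>
              (\<Sum>i\<in>S - {i0}. smult (c i) (p i - smult (r i) (p i0))) = 0"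
    proof (rule Suc.IH)
      show "n < card (S - {i0})" using Suc.prems i0 by simp
      show "coeff (p i - smult (r i) (p i0)) l = 0" if "i \<in> S - {i0}" "l \<ge> n" for i l
        using that Suc.prems(3)[of i l] Suc.prems(3)[of i0 l] i0
        by (cases "l = n") (auto simp: r_def)
    qed (use Suc.prems in auto)
    then obtain c where c: "\<exists>i\<in>S - {i0}. c i \<noteq> 0"
      "(\<Sum>i\<in>S - {i0}. smult (c i) (p i - smult (r i) (p i0))) = 0" by blast
    \<comment> \<open>The coefficient of the pivot undoes the subtracted multiples of p i0.\<close>
    define c' where "c' i = (if i = i0 then - (\<Sum>j\<in>S - {i0}. c j * r j) else c i)" for i
    have "(\<Sum>i\<in>S. smult (c' i) (p i)) =
          smult (c' i0) (p i0) + (\<Sum>i\<in>S - {i0}. smult (c' i) (p i))"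
      using Suc.prems(1) i0(1) by (rule sum.remove)
    also have "(\<Sum>i\<in>S - {i0}. smult (c' i) (p i)) = (\<Sum>i\<in>S - {i0}. smult (c i) (p i))"
      by (rule sum.cong) (auto simp: c'_def)
    also have "\<dots> = (\<Sum>i\<in>S - {i0}. smult (c i) (p i - smult (r i) (p i0))
                       + smult (c i * r i) (p i0))"
      by (rule sum.cong) (auto simp: smult_diff_right)
    also have "\<dots> = (\<Sum>i\<in>S - {i0}. smult (c i * r i) (p i0))"
      unfolding sum.distrib c(2) by simp
    also have "\<dots> = smult (\<Sum>i\<in>S - {i0}. c i * r i) (p i0)" by (simp add: smult_sum)
    finally have "(\<Sum>i\<in>S. smult (c' i) (p i)) = 0" by (simp add: c'_def)
    moreover have "\<exists>i\<in>S. c' i \<noteq> 0" using c(1) by (auto simp: c'_def)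
    ultimately show ?thesis by blast
  qed
qed

lemma coeff_mult_top:
  assumes "degree p \<le> a" "degree q \<le> b"
  shows "coeff (p * q) (a + b) = coeff p a * coeff q b"
proof -
  have "coeff (p * q) (a + b) = (\<Sum>i\<le>a + b. coeff p i * coeff q (a + b - i))"
    by (rule coeff_mult)
  also have "\<dots> = (\<Sum>i\<in>{a}. coeff p i * coeff q (a + b - i))"
  proof (rule sum.mono_neutral_right)
    show "\<forall>i\<in>{..a + b} - {a}. coeff p i * coeff q (a + b - i) = 0"
    proof
      fix i assume "i \<in> {..a + b} - {a}"
      then show "coeff p i * coeff q (a + b - i) = 0"
        using assms by (cases "i < a") (auto simp: coeff_eq_0)
    qed
  qed auto
  finally show ?thesis by simp
qed

section \<open>Pairs of polynomials standing for first order operators\<close>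

abbreviation zvar :: "complex poly" where "zvar \<equiv> [:0, 1:]"
abbreviation zvar1 :: "complex poly" where "zvar1 \<equiv> [:-1, 1:]"

definition pair_scale :: "'a::comm_ring_1 \<Rightarrow> 'a poly \<times> 'a poly \<Rightarrow> 'a poly \<times> 'a poly" where
  "pair_scale c w = (smult c (fst w), smult c (snd w))"

lemma pair_scale_simps [simp]:
  "fst (pair_scale c w) = smult c (fst w)" "snd (pair_scale c w) = smult c (snd w)"
  "pair_scale 0 w = 0" "pair_scale 1 w = w" "pair_scale c 0 = 0"
  by (simp_all add: pair_scale_def prod_eq_iff)

lemma pair_scale_add: "pair_scale c (v + w) = pair_scale c v + pair_scale c w"
  by (simp add: prod_eq_iff smult_add_right)

lemma pair_scale_add_left: "pair_scale (c + e) w = pair_scale c w + pair_scale e w"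
  by (simp add: prod_eq_iff smult_add_left)

lemma pair_scale_sum: "pair_scale c (sum f S) = (\<Sum>i\<in>S. pair_scale c (f i))"
  by (induction S rule: infinite_finite_induct) (auto simp: pair_scale_add)

text \<open>The computation behind \<open>adm_step\<close>, over an arbitrary commutative ring. The
  letters x, y, w, p stand for z, z - 1, \<omega>, \<pi>, and b, a for \<beta> + 1, \<alpha> + 1; a
  prime is the derivative and R the quotient in the Riccati divisibility. The right hand side
  exhibits the factor \<pi>.\<close>

lemma riccati_ring_identity:
  fixes x :: "'a::comm_ring_1"
  assumes R: "x * y * (w * g' + P - g * M) + w * (g^2 - (b * x + a * y) * g) = w * p * R"
    and p: "p' * w = M * p" and U: "U = p * T - g * V"
    and U': "U' = p' * T + p * T' - g' * V - g * V'" and N: "w * N = U * M + V * P"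
  shows "y * x * (w * U' - w * N) + w * g * (U + b * x * V + y * (x * V' + a * V)) =
         w * p * (y * x * T' + g * T - V * R)"
proof -
  have "w * U' = (p' * w) * T + w * p * T' - w * g' * V - w * g * V'"
    unfolding U' by (simp add: algebra_simps)
  then have 1: "w * U' - w * N = w * p * T' - w * g' * V - w * g * V' + g * V * M - V * P"
    unfolding N p U by (simp add: algebra_simps)
  have "y * x * (w * U' - w * N) + w * g * (U + b * x * V + y * (x * V' + a * V)) =
        w * p * (y * x * T' + g * T)
        - V * (x * y * (w * g' + P - g * M) + w * (g^2 - (b * x + a * y) * g))"
    unfolding 1 U by (simp add: algebra_simps power2_eq_square)
  also have "\<dots> = w * p * (y * x * T' + g * T - V * R)"
    unfolding R by (simp add: algebra_simps)
  finally show ?thesis .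
qed

text \<open>With \<open>D = z d/dz\<close>, the pair \<open>w = (U, V)\<close> stands for the operator
  \<open>(U + (z - 1) V D) / \<pi>\<close> on the solutions \<open>y\<close> of \<open>(E)\<close>; here \<open>\<pi>\<close> is the product of the
  \<open>(z - a\<^sub>j)^m\<^sub>j\<close>, \<open>\<omega>\<close> its radical and \<open>M / \<omega>\<close> its logarithmic derivative. The polynomial
  \<open>g\<close> interpolates \<open>z (z - 1) y' / y\<close> at the \<open>a\<^sub>j\<close>, with \<open>y\<close> holomorphic and nonzero there, so that
  \<open>U + g V\<close> is divisible by \<open>\<pi>\<close> iff \<open>w y\<close> is holomorphic at the \<open>a\<^sub>j\<close>.\<close>

locale euler_pairs =
  fixes d k :: nat and \<alpha> \<beta> \<gamma> \<delta> :: complex and \<pi> \<omega> M P g :: "complex poly"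
  assumes d_pos: "d \<ge> 1" and k_pos: "k \<ge> 1"
    and deg_pi: "degree \<pi> = d" "coeff \<pi> d = 1"
    and deg_omega: "degree \<omega> = k" "coeff \<omega> k = 1"
    and omega_dvd_pi: "\<omega> dvd \<pi>"
    and pderiv_pi: "pderiv \<pi> * \<omega> = M * \<pi>"
    and pi_0: "poly \<pi> 0 \<noteq> 0" and pi_1: "poly \<pi> 1 \<noteq> 0"
    and deg_P: "degree P \<le> k" "coeff P k = \<gamma> * \<delta>"
    and riccati: "\<omega> * \<pi> dvd zvar * zvar1 * (\<omega> * pderiv g + P - g * M)
       + \<omega> * (g^2 - ([:\<beta> + 1:] * zvar + [:1 + \<alpha>:] * zvar1) * g)"
    and fuchs: "\<gamma> + \<delta> = \<alpha> + \<beta> + 1 + of_nat d"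
    and nonres: "\<And>n. n < d \<Longrightarrow> of_nat n \<notin> {\<gamma>, \<delta>, \<gamma> - \<alpha> - 1, \<delta> - \<alpha> - 1}"
begin

lemma omega_0: "poly \<omega> 0 \<noteq> 0"
  using omega_dvd_pi pi_0 by (auto elim!: dvdE)
lemma omega_1: "poly \<omega> 1 \<noteq> 0"
  using omega_dvd_pi pi_1 by (auto elim!: dvdE)
lemma pi_nz [simp]: "\<pi> \<noteq> 0" and omega_nz [simp]: "\<omega> \<noteq> 0"
  using pi_0 omega_0 by auto

lemma dvd_linear_cancel:
  fixes p :: "complex poly"
  assumes "poly p c \<noteq> 0" "p dvd [:- c, 1:] * A"
  shows "p dvd A"
proof -
  obtain q where q: "[:- c, 1:] * A = p * q" using assms(2) by (auto elim: dvdE)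
  have "poly p c * poly q c = poly ([:- c, 1:] * A) c" unfolding q by simp
  then have "poly q c = 0" using assms(1) by simp
  then obtain q' where "q = [:- c, 1:] * q'" by (auto simp: poly_eq_0_iff_dvd elim: dvdE)
  with q have "[:- c, 1:] * A = [:- c, 1:] * (p * q')" by (simp only: mult_ac)
  then have "A = p * q'" by (simp only: mult_cancel_left) simp
  then show ?thesis by simp
qed

lemma dvd_zvar_cancel: "poly p 0 \<noteq> 0 \<Longrightarrow> p dvd zvar * A \<Longrightarrow> p dvd A"
  using dvd_linear_cancel[of p 0 A] by simp

text \<open>Modulo \<open>(E)\<close>, \<open>D w\<close> is \<open>(Aop w + Bop w D) / \<pi>\<close>. It is again represented by a pair,
  namely \<open>Dop w\<close>, iff \<open>Bop w\<close> vanishes at \<open>1\<close>.\<close>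

definition Nop :: "complex poly \<times> complex poly \<Rightarrow> complex poly" where
  "Nop w = (fst w * M + snd w * P) div \<omega>"
definition Aop :: "complex poly \<times> complex poly \<Rightarrow> complex poly" where
  "Aop w = zvar * (pderiv (fst w) - Nop w)"
definition Bop :: "complex poly \<times> complex poly \<Rightarrow> complex poly" where
  "Bop w = fst w + [:\<beta> + 1:] * zvar * snd w
            + zvar1 * (zvar * pderiv (snd w) + [:1 + \<alpha>:] * snd w)"
definition Dop :: "complex poly \<times> complex poly \<Rightarrow> complex poly \<times> complex poly" where
  "Dop w = (Aop w, Bop w div zvar1)"
text \<open>With these degrees U / \<pi> and (z - 1) V / \<pi> stay finite at infinity, so that
  functions growing like z^\<gamma> or z^\<delta> are mapped to functions growing no faster.\<close>

definition adm :: "(complex poly \<times> complex poly) set" where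
  "adm = {w. degree (fst w) \<le> d \<and> degree (snd w) \<le> d - 1 \<and> \<pi> dvd fst w + g * snd w}"

text \<open>The value is U(1) + (\<beta> + 1) V(1). Divided by \<pi>(1), it is the factor by which
  the operator multiplies the leading coefficient of a branch (z - 1)^(\<beta> + 1) (1 +
  ...).\<close>

abbreviation obst :: "complex poly \<times> complex poly \<Rightarrow> complex" where
  "obst w \<equiv> poly (Bop w) 1"

lemma Nop_add: "Nop (v + w) = Nop v + Nop w"
  by (simp add: Nop_def poly_div_add_left[symmetric] algebra_simps)
lemma Nop_scale: "Nop (pair_scale c w) = smult c (Nop w)"
  by (simp add: Nop_def smult_add_right[symmetric] div_smult_left del: smult_add_right)
lemma Aop_add: "Aop (v + w) = Aop v + Aop w"
  by (simp add: Aop_def Nop_add pderiv_add algebra_simps)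
lemma Aop_scale: "Aop (pair_scale c w) = smult c (Aop w)"
  by (simp add: Aop_def Nop_scale pderiv_smult smult_diff_right)
lemma Bop_add: "Bop (v + w) = Bop v + Bop w"
  unfolding Bop_def by (simp only: fst_add snd_add pderiv_add) algebra
lemma smult_eq_mult: "smult c p = [:c:] * p" by simp
lemma Bop_scale: "Bop (pair_scale c w) = smult c (Bop w)"
  unfolding Bop_def
  by (simp only: pair_scale_simps pderiv_smult) (simp only: smult_eq_mult, algebra)
lemma Dop_add: "Dop (v + w) = Dop v + Dop w"
  by (simp add: Dop_def Aop_add Bop_add poly_div_add_left)
lemma Dop_scale: "Dop (pair_scale c w) = pair_scale c (Dop w)"
  by (simp add: Dop_def Aop_scale Bop_scale div_smult_left prod_eq_iff)
lemma Dop_zero [simp]: "Dop 0 = 0"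
  using Dop_scale[of 0 0] by simp
lemma Dop_sum: "Dop (sum f S) = (\<Sum>i\<in>S. Dop (f i))"
  by (induction S rule: infinite_finite_induct) (auto simp: Dop_add)
lemma Dpow_add: "(Dop ^^ n) (v + w) = (Dop ^^ n) v + (Dop ^^ n) w"
  by (induction n) (auto simp: Dop_add)
lemma Dpow_scale: "(Dop ^^ n) (pair_scale c w) = pair_scale c ((Dop ^^ n) w)"
  by (induction n) (auto simp: Dop_scale)
lemma Dpow_zero [simp]: "(Dop ^^ n) 0 = 0"
  by (induction n) auto
lemma Dpow_sum: "(Dop ^^ n) (sum f S) = (\<Sum>i\<in>S. (Dop ^^ n) (f i))"
  by (induction S rule: infinite_finite_induct) (auto simp: Dpow_add)
lemma Bop_zero [simp]: "Bop 0 = 0"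
  using Bop_scale[of 0 0] by simp
lemma Bop_sum: "Bop (sum f S) = (\<Sum>i\<in>S. Bop (f i))"
  by (induction S rule: infinite_finite_induct) (auto simp: Bop_add)

lemma adm_add: "v \<in> adm \<Longrightarrow> w \<in> adm \<Longrightarrow> v + w \<in> adm"
  unfolding adm_def
proof clarify
  assume *: "\<pi> dvd fst v + g * snd v" "\<pi> dvd fst w + g * snd w"
    "degree (fst v) \<le> d" "degree (fst w) \<le> d" "degree (snd v) \<le> d - 1" "degree (snd w) \<le> d - 1"
  have "fst (v + w) + g * snd (v + w) = (fst v + g * snd v) + (fst w + g * snd w)"
    by (simp add: algebra_simps)
  with * show "degree (fst (v + w)) \<le> d \<and> degree (snd (v + w)) \<le> d - 1 \<and>
      \<pi> dvd fst (v + w) + g * snd (v + w)"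
    by (metis degree_add_le dvd_add fst_add snd_add)
qed
lemma adm_scale: "w \<in> adm \<Longrightarrow> pair_scale c w \<in> adm"
  unfolding adm_def
  by (auto intro: order.trans[OF degree_smult_le] dvd_smult
           simp: smult_add_right[symmetric] simp del: smult_add_right)
lemma adm_zero [simp]: "0 \<in> adm" by (simp add: adm_def)
lemma adm_sum: "(\<And>i. i \<in> S \<Longrightarrow> f i \<in> adm) \<Longrightarrow> sum f S \<in> adm"
  by (induction S rule: infinite_finite_induct) (auto simp: adm_add)

text \<open>Modulo \<omega> only z (z - 1) (P - g M) remains of the Riccati expression, and \<omega>
  is prime to z (z - 1).\<close>

lemma omega_dvd_riccati: "\<omega> dvd P - g * M"
proof -
  have "\<omega> dvd zvar * zvar1 * (\<omega> * pderiv g + P - g * M)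
       + \<omega> * (g^2 - ([:\<beta> + 1:] * zvar + [:1 + \<alpha>:] * zvar1) * g)"
    using riccati dvd_mult_left by blast
  then have "\<omega> dvd zvar * zvar1 * (\<omega> * pderiv g + P - g * M)"
    by (subst (asm) dvd_add_left_iff) auto
  then have "\<omega> dvd zvar1 * (\<omega> * pderiv g + P - g * M)"
    using dvd_zvar_cancel[OF omega_0] by (simp only: mult.assoc)
  then have "\<omega> dvd \<omega> * pderiv g + (P - g * M)"
    using dvd_linear_cancel[of \<omega> 1, OF omega_1] by (simp only: add_diff_eq)
  then show ?thesis by (subst (asm) dvd_add_right_iff) auto
qed

text \<open>On \<open>adm\<close> the division in \<open>Nop\<close> is exact, because U M + V P =
  (U + g V) M + V (P - g M) and \<omega> divides both terms.\<close>

lemma Nop_eq: "w \<in> adm \<Longrightarrow> \<omega> * Nop w = fst w * M + snd w * P"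
proof -
  assume w: "w \<in> adm"
  have "fst w * M + snd w * P = (fst w + g * snd w) * M + snd w * (P - g * M)"
    by (simp add: algebra_simps)
  moreover have "\<omega> dvd \<dots>"
    using w omega_dvd_pi omega_dvd_riccati dvd_trans unfolding adm_def
    by (intro dvd_add) (auto intro: dvd_trans dvd_mult2)
  ultimately show ?thesis by (simp add: Nop_def)
qed

text \<open>D preserves holomorphy at the a_j. The factor z - 1 in front of \<open>Aop\<close>
  appears because \<open>Bop w\<close> has not yet been divided by z - 1.\<close>

lemma adm_step:
  assumes w: "w \<in> adm"
  shows "\<pi> dvd zvar1 * Aop w + g * Bop w"
proof -
  obtain U V where UV: "w = (U, V)" by force
  define N where "N = Nop w"
  have N: "\<omega> * N = U * M + V * P" using Nop_eq[OF w] by (simp add: UV N_def)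
  obtain T where T: "U + g * V = \<pi> * T" using w unfolding adm_def UV by (auto elim: dvdE)
  obtain R where R: "zvar * zvar1 * (\<omega> * pderiv g + P - g * M)
       + \<omega> * (g^2 - ([:\<beta> + 1:] * zvar + [:1 + \<alpha>:] * zvar1) * g) = \<omega> * \<pi> * R"
    using riccati by (auto elim: dvdE)
  have U: "U = \<pi> * T - g * V" using T by (simp add: algebra_simps)
  have U': "pderiv U = pderiv \<pi> * T + \<pi> * pderiv T - pderiv g * V - g * pderiv V"
    unfolding U by (simp add: pderiv_mult pderiv_diff algebra_simps)
  have "\<omega> * (zvar1 * Aop w + g * Bop w) =
      zvar1 * zvar * (\<omega> * pderiv U - \<omega> * N) + \<omega> * g * (U + [:\<beta> + 1:] * zvar * V
            + zvar1 * (zvar * pderiv V + [:1 + \<alpha>:] * V))"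
    unfolding Aop_def Bop_def N_def UV fst_conv snd_conv by algebra
  also have "\<dots> = \<omega> * \<pi> * (zvar1 * zvar * pderiv T + g * T - V * R)"
    using riccati_ring_identity[OF R pderiv_pi U U' N] .
  finally have "\<omega> * (zvar1 * Aop w + g * Bop w) =
      \<omega> * (\<pi> * (zvar1 * zvar * pderiv T + g * T - V * R))" by (simp only: mult.assoc)
  then have "zvar1 * Aop w + g * Bop w = \<pi> * (zvar1 * zvar * pderiv T + g * T - V * R)"
    by (subst (asm) mult_cancel_left) simp
  then show ?thesis by simp
qed

section \<open>Leading coefficients at infinity and lowest coefficients at 0\<close>

lemma M_top: "degree M \<le> k - 1" "coeff M (k - 1) = of_nat d"
proof -
  have "degree (pderiv \<pi>) = d - 1" using deg_pi by (simp add: degree_pderiv)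
  then have "degree (M * \<pi>) \<le> (d - 1) + k"
    using degree_mult_le[of "pderiv \<pi>" \<omega>] deg_omega pderiv_pi by simp
  moreover have "degree (M * \<pi>) = degree M + d" if "M \<noteq> 0"
    using that deg_pi by (simp add: degree_mult_eq)
  ultimately show dM: "degree M \<le> k - 1"
    using d_pos k_pos by (cases "M = 0") auto
  have "coeff (M * \<pi>) ((k - 1) + d) = coeff M (k - 1) * 1"
    using coeff_mult_top[OF dM, of \<pi> d] deg_pi by simp
  moreover have "coeff (pderiv \<pi> * \<omega>) ((d - 1) + k) = of_nat d"
    using coeff_mult_top[of "pderiv \<pi>" "d - 1" \<omega> k] deg_omega deg_pi \<open>degree (pderiv \<pi>) = d - 1\<close>
      d_pos by (simp add: coeff_pderiv)
  moreover have "(k - 1) + d = (d - 1) + k" using d_pos k_pos by simp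
  ultimately show "coeff M (k - 1) = of_nat d" using pderiv_pi by simp
qed

text \<open>The degree \<open>e\<close> is left free: e = d - 1 gives the bounds that define
  \<open>adm\<close>, smaller values describe the leading terms of an eigenvector.\<close>

lemma Nop_top:
  assumes "w \<in> adm" "degree (fst w) \<le> Suc e" "degree (snd w) \<le> e"
  shows "degree (Nop w) \<le> e"
    and "coeff (Nop w) e = of_nat d * coeff (fst w) (Suc e) + \<gamma> * \<delta> * coeff (snd w) e"
proof -
  have 1: "degree (fst w * M) \<le> e + k"
    using degree_mult_le[of "fst w" M] assms M_top k_pos by simp
  have 2: "degree (snd w * P) \<le> e + k"
    using degree_mult_le[of "snd w" P] assms deg_P by simp
  have "degree (\<omega> * Nop w) \<le> e + k"
    unfolding Nop_eq[OF assms(1)] using 1 2 by (rule degree_add_le)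
  then show *: "degree (Nop w) \<le> e"
    using deg_omega by (cases "Nop w = 0") (auto simp: degree_mult_eq)
  have "coeff (\<omega> * Nop w) (k + e) = coeff (Nop w) e"
    using coeff_mult_top[OF _ *, of \<omega> k] deg_omega by simp
  moreover have "coeff (fst w * M) (Suc e + (k - 1)) = coeff (fst w) (Suc e) * of_nat d"
    using coeff_mult_top[OF assms(2), of M "k - 1"] M_top by simp
  moreover have "coeff (snd w * P) (e + k) = coeff (snd w) e * (\<gamma> * \<delta>)"
    using coeff_mult_top[OF assms(3), of P k] deg_P by simp
  moreover have "Suc e + (k - 1) = k + e" using k_pos by simp
  ultimately show "coeff (Nop w) e = of_nat d * coeff (fst w) (Suc e) + \<gamma> * \<delta> * coeff (snd w) e"
    using Nop_eq[OF assms(1)] by (simp add: add.commute mult.commute)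
qed

lemma Aop_top:
  assumes "w \<in> adm" "degree (fst w) \<le> Suc e" "degree (snd w) \<le> e"
  shows "degree (Aop w) \<le> Suc e"
    and "coeff (Aop w) (Suc e) = (of_nat (Suc e) - of_nat d) * coeff (fst w) (Suc e)
           - \<gamma> * \<delta> * coeff (snd w) e"
proof -
  have "degree (pderiv (fst w) - Nop w) \<le> e"
    using Nop_top(1)[OF assms] assms(2) by (intro degree_diff_le) (auto simp: degree_pderiv)
  then show "degree (Aop w) \<le> Suc e"
    unfolding Aop_def by (simp add: degree_pCons_eq_if)
  show "coeff (Aop w) (Suc e) = (of_nat (Suc e) - of_nat d) * coeff (fst w) (Suc e)
           - \<gamma> * \<delta> * coeff (snd w) e"
    using Nop_top(2)[OF assms] by (simp add: Aop_def coeff_pderiv algebra_simps)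
qed

lemma Bop_top:
  assumes "degree (fst w) \<le> Suc e" "degree (snd w) \<le> e"
  shows "degree (Bop w) \<le> Suc e"
    and "coeff (Bop w) (Suc e) = coeff (fst w) (Suc e)
           + (of_nat e + \<alpha> + \<beta> + 2) * coeff (snd w) e"
proof -
  have "degree (zvar * pderiv (snd w)) \<le> e"
    using assms(2) degree_mult_le[of zvar "pderiv (snd w)"]
    by (cases "degree (snd w) = 0") (auto simp: degree_pderiv pderiv_eq_0_iff degree_pCons_eq_if)
  then have *: "degree (zvar * pderiv (snd w) + [:1 + \<alpha>:] * snd w) \<le> e"
    using assms(2) by (intro degree_add_le) (auto intro: order.trans[OF degree_smult_le])
  show "degree (Bop w) \<le> Suc e"
    unfolding Bop_def using assms
    by (intro degree_add_le order.trans[OF degree_mult_le[of zvar1]] order.trans[OF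
        degree_mult_le[of "_ * zvar"]])
       (use * in \<open>auto simp: degree_pCons_eq_if\<close>)
  have V0: "coeff (snd w) (Suc e) = 0" using assms(2) by (simp add: coeff_eq_0)
  show "coeff (Bop w) (Suc e) = coeff (fst w) (Suc e) + (of_nat e + \<alpha> + \<beta> + 2) * coeff (snd w) e"
    unfolding Bop_def using V0
    by (cases e) (auto simp: coeff_pderiv coeff_pCons algebra_simps)
qed

lemma Dop_snd: "obst w = 0 \<Longrightarrow> zvar1 * snd (Dop w) = Bop w"
  by (simp add: Dop_def poly_eq_0_iff_dvd del: mult_pCons_left)

lemma adm_degrees: "w \<in> adm \<Longrightarrow> degree (fst w) \<le> Suc (d - 1) \<and> degree (snd w) \<le> d - 1"
  using d_pos by (simp add: adm_def)

lemma degree_zvar1_mult: "degree (zvar1 * p) \<le> Suc n \<Longrightarrow> degree p \<le> n"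
  by (cases "p = 0") (auto simp: degree_mult_eq simp del: mult_pCons_left)

lemma Dop_adm:
  assumes w: "w \<in> adm" "obst w = 0"
  shows "Dop w \<in> adm"
proof -
  have deg: "degree (fst w) \<le> Suc (d - 1)" "degree (snd w) \<le> d - 1"
    using adm_degrees[OF w(1)] by auto
  have "degree (fst (Dop w)) \<le> d"
    using Aop_top(1)[OF w(1) deg] d_pos by (simp add: Dop_def)
  moreover have "degree (snd (Dop w)) \<le> d - 1"
    using Bop_top(1)[OF deg] unfolding Dop_snd[OF w(2), symmetric] by (rule degree_zvar1_mult)
  moreover have "zvar1 * (fst (Dop w) + g * snd (Dop w)) = zvar1 * Aop w + g * Bop w"
    unfolding Dop_snd[OF w(2), symmetric] by (simp add: Dop_def algebra_simps)
  then have "\<pi> dvd zvar1 * (fst (Dop w) + g * snd (Dop w))"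
    using adm_step[OF w(1)] by simp
  then have "\<pi> dvd fst (Dop w) + g * snd (Dop w)"
    by (rule dvd_linear_cancel[of _ 1, OF pi_1])
  ultimately show ?thesis by (simp add: adm_def)
qed

lemma coeff_zvar_pderiv: "coeff (zvar * pderiv p) n = of_nat n * coeff p n"
  by (cases n) (auto simp: coeff_pderiv)

lemma coeff_zvar1_mult: "coeff (zvar1 * p) n = (if n = 0 then 0 else coeff p (n - 1)) - coeff p n"
  by (cases n) auto

text \<open>Division by \<omega> does not lower the order of vanishing at 0, as \<omega>(0) is not
  0.\<close>

lemma Nop_low:
  assumes "w \<in> adm" "\<And>i. i < j \<Longrightarrow> coeff (fst w) i = 0" "\<And>i. i < j \<Longrightarrow> coeff (snd w) i = 0"
  shows "i < j \<Longrightarrow> coeff (Nop w) i = 0"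
proof (induction i rule: less_induct)
  case (less i)
  have "coeff (\<omega> * Nop w) i = (\<Sum>l\<le>i. coeff \<omega> l * coeff (Nop w) (i - l))" by (rule coeff_mult)
  also have "\<dots> = (\<Sum>l\<in>{0}. coeff \<omega> l * coeff (Nop w) (i - l))"
    using less by (intro sum.mono_neutral_right) auto
  also have "\<dots> = poly \<omega> 0 * coeff (Nop w) i" by (simp add: poly_0_coeff_0)
  finally have *: "coeff (\<omega> * Nop w) i = poly \<omega> 0 * coeff (Nop w) i" .
  have "coeff (fst w * M + snd w * P) i = 0"
    using assms(2,3) less.prems by (simp add: coeff_mult)
  with * show ?case unfolding Nop_eq[OF assms(1)] using omega_0 by simp
qed

text \<open>In the top degree, the coefficients of U and V form an eigenvector of a 2 by 2 matrix
  whose eigenvalues are \<gamma> and \<delta> up to the shift e + 1 - d. In the lowest degree j one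
  gets \<mu> = j or \<mu> = j + \<alpha> + 1. Together, \<gamma> or \<delta> equals n or n +
  \<alpha> + 1 with n = d - 1 - (e - j), and n < d as 0 \<le> j \<le> e \<le> d - 1.\<close>

lemma no_eigenvector:
  assumes w: "w \<in> adm" "obst w = 0" "Dop w = pair_scale \<mu> w"
  shows "w = 0"
proof (rule ccontr)
  assume nz: "w \<noteq> 0"
  define U V where "U = fst w" and "V = snd w"
  have eq1: "zvar * (pderiv U - Nop w) = smult \<mu> U"
    using arg_cong[OF w(3), of fst] by (simp add: Dop_def Aop_def U_def)
  have eq2: "Bop w = zvar1 * smult \<mu> V"
    using Dop_snd[OF w(2)] unfolding w(3) by (simp add: V_def)
  have V: "V \<noteq> 0"
  proof
    assume "V = 0"
    then have "U = 0" using eq2 by (simp add: Bop_def U_def V_def)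
    with \<open>V = 0\<close> nz show False by (simp add: U_def V_def prod_eq_iff)
  qed
  \<comment> \<open>The order of the pair at infinity. U may have one degree more than V, because V
    comes with the factor z - 1 in the operator.\<close>
  define e where "e = max (degree U - 1) (degree V)"
  have degU: "degree U \<le> Suc e" and degV: "degree V \<le> e" by (auto simp: e_def)
  have e_le: "e \<le> d - 1" using w(1) by (auto simp: e_def U_def V_def adm_def)
  have top1: "(of_nat (Suc e) - of_nat d) * coeff U (Suc e) - \<gamma> * \<delta> * coeff V e
                = \<mu> * coeff U (Suc e)"
    using Aop_top(2)[OF w(1), of e] degU degV arg_cong[OF eq1, of "\<lambda>p. coeff p (Suc e)"]
    by (simp add: Aop_def U_def V_def)
  have top2: "coeff U (Suc e) + (of_nat e + \<alpha> + \<beta> + 2) * coeff V e = \<mu> * coeff V e"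
    using Bop_top(2)[of w e] degU degV arg_cong[OF eq2, of "\<lambda>p. coeff p (Suc e)"]
      coeff_eq_0[of V "Suc e"]
    by (simp add: U_def V_def)
  have Ve: "coeff V e \<noteq> 0"
  proof
    assume "coeff V e = 0"
    with V have "degree V \<noteq> e" by auto
    then have "degree U = Suc e" unfolding e_def
        by (cases "degree U") (auto simp: max_def split: if_splits)
    then have "coeff U (Suc e) \<noteq> 0" by (metis leading_coeff_0_iff degree_0 Zero_not_Suc)
    with top2 \<open>coeff V e = 0\<close> show False by simp
  qed
  \<comment> \<open>After this shift the matrix on the top coefficients has trace \<gamma> +
    \<delta>, by the Fuchs relation, and determinant \<gamma> \<delta>.\<close>
  define s where "s = \<mu> - (of_nat (Suc e) - of_nat d)"
  have 1: "s * coeff U (Suc e) = - \<gamma> * \<delta> * coeff V e"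
    using top1 by (simp add: s_def algebra_simps)
  have 2: "coeff U (Suc e) = (s - (\<gamma> + \<delta>)) * coeff V e"
    using top2 unfolding fuchs by (simp add: s_def algebra_simps)
  have "((s - \<gamma>) * (s - \<delta>)) * coeff V e = 0"
    using 1 unfolding 2 by (simp add: algebra_simps)
  then have s: "s = \<gamma> \<or> s = \<delta>" using Ve by simp

  define j where "j = (LEAST j. coeff U j \<noteq> 0 \<or> coeff V j \<noteq> 0)"
  have j: "coeff U j \<noteq> 0 \<or> coeff V j \<noteq> 0"
    unfolding j_def by (rule LeastI[of _ e]) (use Ve in simp)
  have j_le: "j \<le> e" unfolding j_def by (rule Least_le) (use Ve in simp)
  have low: "coeff U i = 0" "coeff V i = 0" if "i < j" for i
    using not_less_Least[OF that[unfolded j_def]] by auto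
  have "coeff (zvar * Nop w) j = 0"
    using Nop_low[OF w(1), of j "j - 1"] low by (cases j) (auto simp: U_def V_def)
  moreover have "coeff (zvar * pderiv U) j - coeff (zvar * Nop w) j = \<mu> * coeff U j"
    using arg_cong[OF eq1, of "\<lambda>p. coeff p j"]
    by (simp only: right_diff_distrib coeff_diff coeff_smult)
  ultimately have low1: "of_nat j * coeff U j = \<mu> * coeff U j"
    unfolding coeff_zvar_pderiv by simp
  have "coeff (Bop w) j = coeff U j - (of_nat j + 1 + \<alpha>) * coeff V j"
    unfolding Bop_def U_def[symmetric] V_def[symmetric] coeff_add coeff_zvar1_mult coeff_zvar_pderiv
    using low by (cases j) (auto simp: coeff_zvar_pderiv coeff_pderiv algebra_simps)
  moreover have "coeff (zvar1 * smult \<mu> V) j = - \<mu> * coeff V j"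
    unfolding coeff_zvar1_mult using low by (cases j) auto
  ultimately have low2: "coeff U j = (of_nat j + 1 + \<alpha> - \<mu>) * coeff V j"
    using arg_cong[OF eq2, of "\<lambda>p. coeff p j"] by (simp add: algebra_simps)
  have lam: "\<mu> = of_nat j \<or> \<mu> = of_nat j + 1 + \<alpha>"
    using low1 low2 j by (cases "coeff U j = 0") auto
  define n where "n = d - 1 - (e - j)"
  have n: "n < d" "(of_nat n :: complex) = of_nat d - 1 - of_nat e + of_nat j"
    using e_le j_le d_pos by (auto simp: n_def of_nat_diff)
  have "s = of_nat n \<or> s = of_nat n + 1 + \<alpha>"
    using lam unfolding s_def n(2) by (auto simp: algebra_simps)
  with s have "of_nat n \<in> {\<gamma>, \<delta>, \<gamma> - \<alpha> - 1, \<delta> - \<alpha> - 1}" by (auto simp: algebra_simps)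
  with nonres[OF n(1)] show False by blast
qed

definition poly_Dop :: "complex poly \<Rightarrow> complex poly \<times> complex poly \<Rightarrow> complex poly \<times> complex poly"
    where
  "poly_Dop p w = (\<Sum>i\<le>degree p. pair_scale (coeff p i) ((Dop ^^ i) w))"

lemma poly_Dop_bound: "degree p \<le> n \<Longrightarrow> poly_Dop p w = (\<Sum>i\<le>n. pair_scale (coeff p i) ((Dop ^^ i) w))"
  unfolding poly_Dop_def by (rule sum.mono_neutral_left) (auto simp: coeff_eq_0)

lemma poly_Dop_linear_mult:
  "poly_Dop ([:- \<mu>, 1:] * p) w = Dop (poly_Dop p w) - pair_scale \<mu> (poly_Dop p w)"
proof -
  define n where "n = degree p"
  have "degree ([:- \<mu>, 1:] * p) \<le> Suc n"
    using degree_mult_le[of "[:- \<mu>, 1:]" p] by (simp add: n_def)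
  then have "poly_Dop ([:- \<mu>, 1:] * p) w =
      (\<Sum>i\<le>Suc n. pair_scale (coeff (pCons 0 p) i + - \<mu> * coeff p i) ((Dop ^^ i) w))"
    by (subst poly_Dop_bound) (auto simp: algebra_simps)
  also have "\<dots> = (\<Sum>i\<le>Suc n. pair_scale (coeff (pCons 0 p) i) ((Dop ^^ i) w))
                  + (\<Sum>i\<le>Suc n. pair_scale (- \<mu> * coeff p i) ((Dop ^^ i) w))"
    by (simp only: pair_scale_add_left sum.distrib)
  also have "(\<Sum>i\<le>Suc n. pair_scale (coeff (pCons 0 p) i) ((Dop ^^ i) w)) = Dop (poly_Dop p w)"
    unfolding sum.atMost_Suc_shift poly_Dop_def n_def[symmetric] Dop_sum by (simp add: Dop_scale)
  also have "(\<Sum>i\<le>Suc n. pair_scale (- \<mu> * coeff p i) ((Dop ^^ i) w)) =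
      - pair_scale \<mu> (poly_Dop p w)"
  proof -
    have "poly_Dop p w = (\<Sum>i\<le>Suc n. pair_scale (coeff p i) ((Dop ^^ i) w))"
      by (rule poly_Dop_bound) (simp add: n_def)
    then have "- pair_scale \<mu> (poly_Dop p w)
        = pair_scale (- \<mu>) (\<Sum>i\<le>Suc n. pair_scale (coeff p i) ((Dop ^^ i) w))"
      by (simp add: prod_eq_iff del: sum.atMost_Suc)
    also have "\<dots> = (\<Sum>i\<le>Suc n. pair_scale (- \<mu> * coeff p i) ((Dop ^^ i) w))"
      unfolding pair_scale_sum by (simp add: pair_scale_def del: sum.atMost_Suc)
    finally show ?thesis by simp
  qed
  finally show ?thesis by simp
qed

text \<open>Over the complex numbers p splits off a factor X - \<mu>, and p(D) w = 0 makes p'(D) w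
  an eigenvector for the cofactor p'. It is unobstructed, since p' involves only powers of D below
  \<open>n\<close>.\<close>

lemma no_relation:
  assumes X: "\<And>i. i \<le> n \<Longrightarrow> (Dop ^^ i) w \<in> adm" and obst: "\<And>i. i < n \<Longrightarrow> obst ((Dop ^^ i) w) = 0"
    and w: "w \<noteq> 0"
  shows "p \<noteq> 0 \<Longrightarrow> degree p \<le> n \<Longrightarrow> poly_Dop p w \<noteq> 0"
proof (induction "degree p" arbitrary: p)
  case 0
  then obtain c where "p = [:c:]" "c \<noteq> 0" by (metis degree_eq_zeroE pCons_0_0)
  then show ?case using w by (auto simp: poly_Dop_def prod_eq_iff)
next
  case (Suc m)
  from Suc.hyps(2) obtain \<mu> where "poly p \<mu> = 0"
    using alg_closed_imp_poly_has_root[of p] by auto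
  then obtain p' where p': "p = [:- \<mu>, 1:] * p'" by (auto simp: poly_eq_0_iff_dvd elim: dvdE)
  with Suc.prems have p'nz: "p' \<noteq> 0" by auto
  then have dp': "degree p = Suc (degree p')" unfolding p' by (subst degree_mult_eq) auto
  have nz: "poly_Dop p' w \<noteq> 0" using Suc.hyps p'nz dp' Suc.prems by auto
  have inX: "poly_Dop p' w \<in> adm"
    unfolding poly_Dop_def using dp' Suc.prems by (intro adm_sum adm_scale X) auto
  have ob: "obst (poly_Dop p' w) = 0"
    unfolding poly_Dop_def Bop_sum poly_sum Bop_scale using dp' Suc.prems
        by (intro sum.neutral) (auto simp: obst)
  show ?case
  proof
    assume "poly_Dop p w = 0"
    then have "Dop (poly_Dop p' w) = pair_scale \<mu> (poly_Dop p' w)"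
        unfolding p' poly_Dop_linear_mult by simp
    from no_eigenvector[OF inX ob this] nz show False by simp
  qed
qed

text \<open>The dimension of \<open>adm\<close> is at most d + 1: the linear map
  \<open>\<iota>\<close>, sending (U, V) to V + U_d z^d, is injective, for V = 0 and U_d = 0 leave a
  multiple U of \<pi> of degree below d.\<close>

lemma adm_dependent:
  assumes "finite S" "card S > Suc d" "\<And>i. i \<in> S \<Longrightarrow> w i \<in> adm"
  shows "\<exists>c. (\<exists>i\<in>S. c i \<noteq> 0) \<and> (\<Sum>i\<in>S. pair_scale (c i) (w i)) = 0"
proof -
  define \<iota> where "\<iota> v = snd v + monom (coeff (fst v) d) d" for v :: "complex poly \<times> complex poly"
  have "\<exists>c. (\<exists>i\<in>S. c i \<noteq> 0) \<and> (\<Sum>i\<in>S. smult (c i) (\<iota> (w i))) = 0"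
  proof (rule poly_family_dependent[OF assms(1,2)])
    fix i l assume il: "i \<in> S" "Suc d \<le> l"
    then have "degree (snd (w i)) < l" using assms(3)[OF il(1)] by (auto simp: adm_def)
    then show "coeff (\<iota> (w i)) l = 0" using il by (simp add: \<iota>_def coeff_eq_0)
  qed
  then obtain c where c: "\<exists>i\<in>S. c i \<noteq> 0" "(\<Sum>i\<in>S. smult (c i) (\<iota> (w i))) = 0" by blast
  define v where "v = (\<Sum>i\<in>S. pair_scale (c i) (w i))"
  have v: "v \<in> adm" unfolding v_def using assms by (intro adm_sum adm_scale)
  have "\<iota> v = (\<Sum>i\<in>S. smult (c i) (\<iota> (w i)))"
    unfolding \<iota>_def v_def
    by (simp add: snd_sum fst_sum coeff_sum smult_add_right sum.distrib smult_monom monom_sum)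
  then have \<iota>: "snd v + monom (coeff (fst v) d) d = 0" using c(2) by (simp add: \<iota>_def)
  have "coeff (snd v) d = 0" using v d_pos by (intro coeff_eq_0) (auto simp: adm_def)
  with arg_cong[OF \<iota>, of "\<lambda>p. coeff p d"] have top: "coeff (fst v) d = 0" by simp
  with \<iota> have snd: "snd v = 0" by simp
  have "fst v = 0"
  proof (rule ccontr)
    assume nz: "fst v \<noteq> 0"
    then have "degree \<pi> \<le> degree (fst v)" using v snd
        by (intro dvd_imp_degree_le) (auto simp: adm_def)
    then have "degree (fst v) = d" using v deg_pi by (auto simp: adm_def)
    with top nz show False by (metis leading_coeff_0_iff)
  qed
  with snd have "v = 0" by (simp add: prod_eq_iff)
  with c(1) show ?thesis unfolding v_def by blast
qed

text \<open>The target of \<open>Hop\<close>: the part D (D - \<alpha> - 1) of the hypergeometric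
  operator kills the constant terms of the pair, and the remaining part carries a factor z.\<close>

definition adm0 :: "(complex poly \<times> complex poly) set" where
  "adm0 = {w \<in> adm. coeff (fst w) 0 = 0 \<and> coeff (snd w) 0 = 0}"

text \<open>V / z has only d - 1 free coefficients and determines the pair: for V = 0, U is a
  constant multiple of \<pi>, and U(0) = 0 while \<pi>(0) is not 0.\<close>

lemma adm0_dependent:
  assumes "finite S" "card S > d - 1" "\<And>i. i \<in> S \<Longrightarrow> w i \<in> adm0"
  shows "\<exists>c. (\<exists>i\<in>S. c i \<noteq> 0) \<and> (\<Sum>i\<in>S. pair_scale (c i) (w i)) = 0"
proof -
  have "\<exists>p. snd (w i) = pCons 0 p" if "i \<in> S" for i
    using assms(3)[OF that] by (cases "snd (w i)") (auto simp: adm0_def)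
  then obtain p where p: "\<And>i. i \<in> S \<Longrightarrow> snd (w i) = pCons 0 (p i)" by metis
  have "\<exists>c. (\<exists>i\<in>S. c i \<noteq> 0) \<and> (\<Sum>i\<in>S. smult (c i) (p i)) = 0"
  proof (rule poly_family_dependent[OF assms(1,2)])
    fix i l assume il: "i \<in> S" "d - 1 \<le> l"
    have "coeff (snd (w i)) (Suc l) = 0"
      using assms(3)[OF il(1)] il(2) by (intro coeff_eq_0) (auto simp: adm0_def adm_def)
    then show "coeff (p i) l = 0" using p[OF il(1)] by simp
  qed
  then obtain c where c: "\<exists>i\<in>S. c i \<noteq> 0" "(\<Sum>i\<in>S. smult (c i) (p i)) = 0" by blast
  define v where "v = (\<Sum>i\<in>S. pair_scale (c i) (w i))"
  have v: "v \<in> adm" unfolding v_def using assms by (intro adm_sum adm_scale) (auto simp: adm0_def)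
  have v0: "poly (fst v) 0 = 0"
    unfolding v_def using assms(3) by (simp add: fst_sum adm0_def poly_0_coeff_0 coeff_sum)
  have "snd v = (\<Sum>i\<in>S. zvar * smult (c i) (p i))"
    unfolding v_def by (auto simp: snd_sum p intro!: sum.cong)
  also have "\<dots> = 0" unfolding sum_distrib_left[symmetric] c(2) by simp
  finally have snd: "snd v = 0" .
  have "fst v = 0"
  proof (rule ccontr)
    assume nz: "fst v \<noteq> 0"
    obtain t where t: "fst v = \<pi> * t" using v snd by (auto simp: adm_def elim: dvdE)
    with nz have "degree (fst v) = d + degree t" using deg_pi
        by (subst t, subst degree_mult_eq) auto
    then have "degree t = 0" using v by (auto simp: adm_def)
    then obtain a where "t = [:a:]" by (metis degree_eq_zeroE)
    with t v0 pi_0 nz show False by simp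
  qed
  with snd have "v = 0" by (simp add: prod_eq_iff)
  with c(1) show ?thesis unfolding v_def by blast
qed

lemma Dpow_adm:
  assumes "w \<in> adm" "\<And>i. i < n \<Longrightarrow> obst ((Dop ^^ i) w) = 0"
  shows "i \<le> n \<Longrightarrow> (Dop ^^ i) w \<in> adm"
  by (induction i) (auto simp: assms intro: Dop_adm)

lemma exists_unobstructed:
  "\<exists>w\<in> adm. w \<noteq> 0 \<and> (\<forall>i<d. obst ((Dop ^^ i) w) = 0)"
proof -
  \<comment> \<open>d + 1 independent pairs: V = z^n with U forced modulo \<pi> by the divisibility
    condition, and (\<pi>, 0), the identity operator.\<close>
  define \<Psi> :: "nat \<Rightarrow> complex poly \<times> complex poly"
    where "\<Psi> n = (if n < d then (- ((g * monom 1 n) mod \<pi>), monom 1 n) else (\<pi>, 0))" for n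
  have \<Psi>: "\<Psi> n \<in> adm" for n
  proof (cases "n < d")
    case True
    have "degree ((g * monom 1 n) mod \<pi>) \<le> d"
      using degree_mod_less[of \<pi> "g * monom 1 n"] deg_pi by auto
    moreover have "\<pi> dvd g * monom 1 n - (g * monom 1 n) mod \<pi>" by (rule dvd_minus_mod)
    ultimately show ?thesis using True by (simp add: \<Psi>_def adm_def degree_monom_eq)
  next
    case False
    then show ?thesis using deg_pi by (simp add: \<Psi>_def adm_def)
  qed
  \<comment> \<open>The d obstructions of \<open>\<Psi> n\<close> are packed into a polynomial, so
    that dependence of polynomials solves the linear system. The powers of \<open>Dop\<close> on a
    single \<open>\<Psi> n\<close> may leave \<open>adm\<close>; the conditions are linear all the
    same, since \<open>Dop\<close> is linear on all pairs, even where its divisions leave a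
    remainder.\<close>
  define p where "p n = (\<Sum>i<d. monom (obst ((Dop ^^ i) (\<Psi> n))) i)" for n
  have "\<exists>c. (\<exists>n\<in>{..d}. c n \<noteq> 0) \<and> (\<Sum>n\<in>{..d}. smult (c n) (p n)) = 0"
    by (rule poly_family_dependent[where n = d]) (auto simp: p_def coeff_sum intro!: sum.neutral)
  then obtain c where c: "\<exists>n\<in>{..d}. c n \<noteq> 0" "(\<Sum>n\<in>{..d}. smult (c n) (p n)) = 0" by blast
  define w where "w = (\<Sum>n\<le>d. pair_scale (c n) (\<Psi> n))"
  have "obst ((Dop ^^ i) w) = 0" if "i < d" for i
  proof -
    have "obst ((Dop ^^ i) w) = (\<Sum>n\<le>d. c n * obst ((Dop ^^ i) (\<Psi> n)))"
      by (simp add: w_def Dpow_sum Dpow_scale Bop_sum Bop_scale poly_sum)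
    also have "\<dots> = coeff (\<Sum>n\<in>{..d}. smult (c n) (p n)) i"
      using that by (simp add: coeff_sum p_def if_distrib[of "\<lambda>x. _ * x"] cong: if_cong)
    finally show ?thesis using c(2) by simp
  qed
  moreover have "w \<in> adm" unfolding w_def using \<Psi> by (intro adm_sum adm_scale)
  moreover have "w \<noteq> 0"
  proof
    assume w0: "w = 0"
    have "coeff (snd w) n = c n" if "n < d" for n
    proof -
      have "coeff (snd w) n = (\<Sum>i\<le>d. if i = n then c n else 0)"
        unfolding w_def snd_sum coeff_sum using that by (intro sum.cong) (auto simp: \<Psi>_def)
      with that show ?thesis by simp
    qed
    then have cn: "c n = 0" if "n < d" for n using that w0 by simp
    have "fst w = smult (c d) \<pi>"
      unfolding w_def fst_sum using cn
      by (subst sum.remove[of _ d]) (auto simp: \<Psi>_def intro!: sum.neutral)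
    with w0 have "c d = 0" by simp
    with cn c(1) show False by (metis atMost_iff le_neq_implies_less)
  qed
  ultimately show ?thesis by blast
qed

text \<open>The d + 2 pairs w, ..., D^d w and (\<pi>, 0) are dependent, and
  \<open>no_relation\<close> makes the coefficient of (\<pi>, 0) nonzero. A degree below d is
  impossible: lower powers of D give unobstructed pairs, whereas (\<pi>, 0) has obstruction
  \<pi>(1).\<close>

lemma exists_poly_Dop:
  assumes X: "w \<in> adm" and obst: "\<And>i. i < d \<Longrightarrow> obst ((Dop ^^ i) w) = 0" and w: "w \<noteq> 0"
  shows "\<exists>Q. degree Q = d \<and> poly_Dop Q w = (\<pi>, 0)"
proof -
  note DX = Dpow_adm[OF X obst]
  define v where "v i = (if i = Suc d then (\<pi>, 0) else (Dop ^^ i) w)" for i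
  have "(\<pi>, 0) \<in> adm" using deg_pi by (simp add: adm_def)
  then have "\<exists>c. (\<exists>i\<in>{..Suc d}. c i \<noteq> 0) \<and> (\<Sum>i\<in>{..Suc d}. pair_scale (c i) (v i)) = 0"
    using DX by (intro adm_dependent) (auto simp: v_def)
  then obtain c where c: "\<exists>i\<in>{..Suc d}. c i \<noteq> 0" "(\<Sum>i\<in>{..Suc d}. pair_scale (c i) (v i))
      = 0" by blast
  \<comment> \<open>The scalar \<open>s\<close> is 1 in the contradiction that shows c (Suc d) to be
    nonzero, and - 1 / c (Suc d) in the normalised relation.\<close>
  define q where "q s = (\<Sum>i\<le>d. monom (s * c i) i)" for s
  have cq: "coeff (q s) i = (if i \<le> d then s * c i else 0)" for s i
    by (simp add: q_def coeff_sum)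
  then have dq: "degree (q s) \<le> d" for s by (intro degree_le) simp
  have "(\<Sum>i\<in>{..Suc d}. pair_scale (c i) (v i))
      = (\<Sum>i\<le>d. pair_scale (c i) ((Dop ^^ i) w)) + pair_scale (c (Suc d)) (\<pi>, 0)"
    by (auto simp: v_def intro!: sum.cong)
  with c(2) have rel: "(\<Sum>i\<le>d. pair_scale (c i) ((Dop ^^ i) w)) = - pair_scale (c (Suc d)) (\<pi>, 0)"
    by (simp add: eq_neg_iff_add_eq_0)
  have pq: "poly_Dop (q s) w = pair_scale (- s * c (Suc d)) (\<pi>, 0)" for s
  proof -
    have "poly_Dop (q s) w = pair_scale s (\<Sum>i\<le>d. pair_scale (c i) ((Dop ^^ i) w))"
      unfolding poly_Dop_bound[OF dq] cq pair_scale_sum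
          by (auto simp: pair_scale_def intro!: sum.cong)
    then show ?thesis unfolding rel by (simp add: pair_scale_def)
  qed
  have cnz: "c (Suc d) \<noteq> 0"
  proof
    assume 0: "c (Suc d) = 0"
    have "\<exists>i\<le>d. c i \<noteq> 0" using c(1) 0 by (metis atMost_iff le_Suc_eq)
    then have "q 1 \<noteq> 0" using cq[of 1] by (metis coeff_0 mult_1)
    from no_relation[OF DX obst w this dq] pq[of 1] 0 show False by simp
  qed
  define Q where "Q = q (- 1 / c (Suc d))"
  have Q: "poly_Dop Q w = (\<pi>, 0)" unfolding Q_def pq using cnz by (simp add: pair_scale_def)
  moreover have "degree Q = d"
  proof (rule ccontr)
    assume "degree Q \<noteq> d"
    with dq have lt: "degree Q < d" unfolding Q_def using le_neq_implies_less by blast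
    have "obst (poly_Dop Q w) = 0"
      unfolding poly_Dop_def Bop_sum poly_sum Bop_scale using lt
          by (intro sum.neutral) (auto simp: obst)
    then show False unfolding Q using pi_1 by (simp add: Bop_def)
  qed
  ultimately show ?thesis by blast
qed

section \<open>The hypergeometric operator on pairs\<close>

definition zmul :: "complex poly \<times> complex poly \<Rightarrow> complex poly \<times> complex poly" where
  "zmul w = (zvar * fst w, zvar * snd w)"

lemma Bop_zmul: "Bop (zmul w) = zvar * Bop w + zvar1 * zvar * snd w"
proof -
  have "pderiv (zvar * snd w) = zvar * pderiv (snd w) + snd w"
    unfolding pderiv_mult by (simp add: pderiv_pCons)
  then show ?thesis unfolding Bop_def zmul_def fst_conv snd_conv by algebra
qed

text \<open>The Leibniz rule D z = z + z D, checked on \<open>Aop\<close> and \<open>Bop\<close>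
  directly because \<open>zmul w\<close> may have too large a degree for \<open>adm\<close>.\<close>

lemma Dop_zmul:
  assumes w: "w \<in> adm" "obst w = 0"
  shows "Dop (zmul w) = zmul w + zmul (Dop w)"
proof -
  have "\<omega> * (zvar * Nop w) = fst (zmul w) * M + snd (zmul w) * P"
    using Nop_eq[OF w(1)] unfolding zmul_def fst_conv snd_conv by algebra
  then have N: "Nop (zmul w) = zvar * Nop w"
    unfolding Nop_def[of "zmul w"] by (metis nonzero_mult_div_cancel_left omega_nz)
  have "pderiv (zvar * fst w) = zvar * pderiv (fst w) + fst w"
    unfolding pderiv_mult by (simp add: pderiv_pCons)
  then have A: "Aop (zmul w) = zvar * fst w + zvar * Aop w"
    unfolding Aop_def N unfolding zmul_def fst_conv by algebra
  have "Bop (zmul w) = zvar1 * (zvar * snd w + zvar * snd (Dop w))"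
    unfolding Bop_zmul Dop_snd[OF w(2), symmetric] by algebra
  then have "Bop (zmul w) div zvar1 = zvar * snd w + zvar * snd (Dop w)"
    by (metis nonzero_mult_div_cancel_left pCons_eq_0_iff one_neq_zero)
  with A show ?thesis by (simp add: Dop_def zmul_def)
qed

text \<open>Collects the terms D^l w and z D^l w of lower order in \<open>Hop_zero\<close>. Only the
  bound on l and the obstruction matter, so no coefficients are recorded.\<close>

inductive_set low :: "complex poly \<times> complex poly \<Rightarrow> nat \<Rightarrow> (complex poly \<times> complex poly) set"
    for w n where
  "l \<le> n \<Longrightarrow> pair_scale c ((Dop ^^ l) w) \<in> low w n"
| "l \<le> n \<Longrightarrow> zmul (pair_scale c ((Dop ^^ l) w)) \<in> low w n"
| "u \<in> low w n \<Longrightarrow> v \<in> low w n \<Longrightarrow> u + v \<in> low w n"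

lemma obst_low:
  assumes "u \<in> low w n" "\<And>l. l \<le> n \<Longrightarrow> obst ((Dop ^^ l) w) = 0"
  shows "obst u = 0"
  using assms(1)
  by induction (auto simp: assms(2) Bop_scale Bop_zmul Bop_add simp del: mult_pCons_left)

lemma Dop_low:
  assumes "u \<in> low w n" "\<And>l. l \<le> n \<Longrightarrow> (Dop ^^ l) w \<in> adm" "\<And>l. l \<le> n \<Longrightarrow> obst ((Dop ^^ l) w) = 0"
  shows "Dop u \<in> low w (Suc n)"
  using assms(1)
proof induction
  case (1 l c)
  then show ?case using low.intros(1)[of "Suc l" "Suc n" c w] by (simp add: Dop_scale)
next
  case (2 l c)
  have "Dop (zmul (pair_scale c ((Dop ^^ l) w)))
      = zmul (pair_scale c ((Dop ^^ l) w)) + zmul (pair_scale c ((Dop ^^ Suc l) w))"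
    using assms(2,3)[OF 2] by (subst Dop_zmul) (auto simp: adm_scale Bop_scale Dop_scale)
  also have "\<dots> \<in> low w (Suc n)"
    using 2 by (intro low.intros) auto
  finally show ?case .
next
  case (3 u v)
  then show ?case by (simp add: Dop_add low.intros(3))
qed

text \<open>The operator (1 - z) D^2 + ((\<gamma> + \<delta>) z - (\<alpha> + 1)) D - \<gamma>
  \<delta> z applied to w, which is (H) times z^2 (1 - z). The factor 1 - z cancels the division by
  z - 1 in the second D, so the result is a pair even if D w is obstructed, as may happen for d =
  1.\<close>

definition Hop :: "complex poly \<times> complex poly \<Rightarrow> complex poly \<times> complex poly" where
  "Hop w = (- (zvar1 * Aop (Dop w)) + [:-(\<alpha> + 1), \<gamma> + \<delta>:] * fst (Dop w) - [:0, \<gamma> * \<delta>:] * fst w,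
            - Bop (Dop w) + [:-(\<alpha> + 1), \<gamma> + \<delta>:] * snd (Dop w) - [:0, \<gamma> * \<delta>:] * snd w)"

lemma Dop_adm0: "w \<in> adm0 \<Longrightarrow> obst w = 0 \<Longrightarrow> Dop w \<in> adm0"
proof -
  assume w: "w \<in> adm0" "obst w = 0"
  have "coeff (zvar1 * snd (Dop w)) 0 = coeff (Bop w) 0" using w Dop_snd by simp
  then have "coeff (snd (Dop w)) 0 = 0" using w by (simp add: Bop_def adm0_def)
  then show ?thesis using Dop_adm[of w] w by (simp add: adm0_def Dop_def Aop_def)
qed

lemma degree_le_if_top_zero: "degree p \<le> Suc n \<Longrightarrow> coeff p (Suc n) = 0 \<Longrightarrow> degree p \<le> n"
  by (metis le_SucE leading_coeff_0_iff degree_0 le0)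

text \<open>On the top coefficients (U_d, V_(d-1)) D acts by a matrix with characteristic polynomial
  (s - \<gamma>) (s - \<delta>), so by Cayley-Hamilton the terms of excessive degree cancel. On the
  constant terms the characteristic polynomial is s (s - \<alpha> - 1), with the same
  effect.\<close>

lemma Hop_adm0:
  assumes w: "w \<in> adm" "obst w = 0"
  shows "Hop w \<in> adm0"
proof -
  define v where "v = Dop w"
  have v: "v \<in> adm" unfolding v_def by (rule Dop_adm[OF w])
  note dw = adm_degrees[OF w(1)] and dv = adm_degrees[OF v]
  have Sd: "Suc (d - 1) = d" using d_pos by simp
  have of_d: "(of_nat (d - 1) :: complex) = of_nat d - 1" using d_pos by (simp add: of_nat_diff)
  have v1: "coeff (fst v) d = - \<gamma> * \<delta> * coeff (snd w) (d - 1)"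
    using Aop_top(2)[OF w(1), of "d - 1"] dw Sd by (simp add: v_def Dop_def)
  have Bw: "coeff (Bop w) d = coeff (fst w) d + (\<gamma> + \<delta>) * coeff (snd w) (d - 1)"
    using Bop_top(2)[of w "d - 1"] dw Sd unfolding fuchs by (simp add: of_d algebra_simps)
  have "degree (snd v) < d" using dv d_pos by auto
  then have v2: "coeff (snd v) (d - 1) = coeff (Bop w) d"
    using arg_cong[OF Dop_snd[OF w(2)], of "\<lambda>p. coeff p d"] d_pos
    unfolding coeff_zvar1_mult v_def[symmetric] by (simp add: coeff_eq_0)
  have Av: "coeff (Aop v) d = - \<gamma> * \<delta> * coeff (snd v) (d - 1)" "degree (Aop v) \<le> d"
    using Aop_top[OF v, of "d - 1"] dv Sd by auto
  have Bv: "coeff (Bop v) d = coeff (fst v) d + (\<gamma> + \<delta>) * coeff (snd v) (d - 1)" "degree (Bop v)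
      \<le> d"
    using Bop_top[of v "d - 1"] dv Sd unfolding fuchs by (auto simp: of_d algebra_simps)
  define \<mu> \<nu> where "\<mu> = [:-(\<alpha> + 1), \<gamma> + \<delta>:]" and "\<nu> = [:0, \<gamma> * \<delta>:]"
  have lin: "degree (q * p) \<le> Suc n" "coeff (q * p) (Suc n) = coeff q 1 * coeff p n"
    if "degree q \<le> 1" "degree p \<le> n" for p q :: "complex poly" and n
    using degree_mult_le[of q p] coeff_mult_top[OF that] that by auto
  have small: "degree zvar1 \<le> 1" "degree \<mu> \<le> 1" "degree \<nu> \<le> 1" by (auto simp: \<mu>_def \<nu>_def)
  have F: "fst (Hop w) = - (zvar1 * Aop v) + \<mu> * fst v - \<nu> * fst w"
    and S: "snd (Hop w) = - Bop v + \<mu> * snd v - \<nu> * snd w"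
    by (simp_all add: Hop_def v_def \<mu>_def \<nu>_def)
  have "degree (fst (Hop w)) \<le> Suc d"
    unfolding F using small Av dv dw Sd
    by (intro degree_diff_le degree_add_le) (auto intro!: lin simp del: mult_pCons_left)
  moreover have "coeff (fst (Hop w)) (Suc d) = 0"
  proof -
    have e1: "coeff (zvar1 * Aop v) (Suc d) = coeff (Aop v) d"
      using lin(2)[of zvar1 "Aop v" d] small Av by (simp del: mult_pCons_left)
    have e2: "coeff (\<mu> * fst v) (Suc d) = (\<gamma> + \<delta>) * coeff (fst v) d"
      using lin(2)[of \<mu> "fst v" d] small dv Sd by (simp add: \<mu>_def del: mult_pCons_left)
    have e3: "coeff (\<nu> * fst w) (Suc d) = \<gamma> * \<delta> * coeff (fst w) d"
      using lin(2)[of \<nu> "fst w" d] small dw Sd by (simp add: \<nu>_def del: mult_pCons_left)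
    show ?thesis
      unfolding F coeff_diff coeff_add coeff_minus e1 e2 e3 Av(1) v1 v2 Bw
      by (simp add: algebra_simps)
  qed
  ultimately have 1: "degree (fst (Hop w)) \<le> d" by (rule degree_le_if_top_zero)
  have "degree (snd (Hop w)) \<le> Suc (d - 1)"
    unfolding S using small Bv(2) dv dw Sd lin(1)[of \<mu> "snd v" "d - 1"] lin(1)[of \<nu> "snd w" "d - 1"]
    by (intro degree_diff_le degree_add_le) auto
  moreover have "coeff (snd (Hop w)) (Suc (d - 1)) = 0"
    unfolding S coeff_diff coeff_add coeff_minus
    using small Bv dv dw lin(2)[of \<mu> "snd v" "d - 1"] lin(2)[of \<nu> "snd w" "d - 1"] Sd
    by (simp add: v1 \<mu>_def \<nu>_def algebra_simps)
  ultimately have 2: "degree (snd (Hop w)) \<le> d - 1" by (rule degree_le_if_top_zero)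
  have "fst (Hop w) + g * snd (Hop w) = - (zvar1 * Aop v + g * Bop v)
      + \<mu> * (fst v + g * snd v) - \<nu> * (fst w + g * snd w)"
    unfolding F S by (simp add: algebra_simps)
  moreover have "\<pi> dvd \<dots>"
  proof (intro dvd_diff dvd_add)
    show "\<pi> dvd - (zvar1 * Aop v + g * Bop v)" using adm_step[OF v] by (simp only: dvd_minus_iff)
  qed (use v w(1) in \<open>auto simp: adm_def intro!: dvd_mult\<close>)
  ultimately have 3: "\<pi> dvd fst (Hop w) + g * snd (Hop w)" by simp
  have v0: "coeff (fst v) 0 = 0" by (simp add: v_def Dop_def Aop_def)
  then have 4: "coeff (fst (Hop w)) 0 = 0" unfolding F by (simp add: Aop_def coeff_mult_0 \<nu>_def)
  have "coeff (Bop v) 0 = - (1 + \<alpha>) * coeff (snd v) 0"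
    unfolding Bop_def using v0 by (simp add: coeff_mult_0 algebra_simps)
  then have 5: "coeff (snd (Hop w)) 0 = 0"
    unfolding S by (simp add: coeff_mult_0 \<mu>_def \<nu>_def)
  show ?thesis using 1 2 3 4 5 by (simp add: adm_def adm0_def)
qed

lemma zmul_scale: "zmul (pair_scale c v) = pair_scale c (zmul v)"
  by (simp add: zmul_def prod_eq_iff)

text \<open>\<open>Hop w, D (Hop w), \<dots>, D^(d - 1) (Hop w)\<close> all lie in the \<open>(d - 1)\<close>-dimensional space \<open>adm0\<close>
  and hence are linearly dependent, which \<open>no_relation\<close> allows only if \<open>Hop w = 0\<close>.\<close>

lemma Hop_zero:
  assumes X: "w \<in> adm" and obst: "\<And>i. i < d \<Longrightarrow> obst ((Dop ^^ i) w) = 0"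
  shows "Hop w = 0"
proof (rule ccontr)
  assume nz: "Hop w \<noteq> 0"
  note DX = Dpow_adm[OF X obst]
  have HY: "Hop w \<in> adm0" using Hop_adm0[OF X] obst[of 0] d_pos by simp
  \<comment> \<open>The leading part (1 - z) D^(i + 2) w of D^i (Hop w). Its factor 1 - z makes the
    obstruction vanish also for i + 2 = d, beyond the range of the assumption on w.\<close>
  define T where "T i = (Dop ^^ Suc (Suc i)) w + pair_scale (-1) (zmul ((Dop ^^ Suc (Suc i)) w))"
      for i
  have form: "\<exists>z\<in>low w (Suc i). (Dop ^^ i) (Hop w) = T i + z" if "i + 2 \<le> d" for i
    using that
  proof (induction i)
    case 0
    have "obst ((Dop ^^ 1) w) = 0" using 0 by (intro obst) simp
    then have B: "Bop (Dop w) = zvar1 * snd (Dop (Dop w))"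
        by (simp add: Dop_snd del: mult_pCons_left)
    define z where "z = pair_scale (-(\<alpha> + 1)) ((Dop ^^ 1) w) +
        (zmul (pair_scale (\<gamma> + \<delta>) ((Dop ^^ 1) w)) + zmul (pair_scale (- (\<gamma> * \<delta>)) ((Dop ^^ 0) w)))"
    have "z \<in> low w (Suc 0)" unfolding z_def by (intro low.intros) auto
    moreover have "Hop w = T 0 + z"
    proof -
      have A: "Aop (Dop w) = fst (Dop (Dop w))" by (simp add: Dop_def)
      show ?thesis
        by (simp add: Hop_def T_def z_def prod_eq_iff A B zmul_def algebra_simps smult_add_left)
    qed
    ultimately show ?case by auto
  next
    case (Suc i)
    then have "\<exists>z\<in>low w (Suc i). (Dop ^^ i) (Hop w) = T i + z" by simp
    then obtain z where z: "z \<in> low w (Suc i)" "(Dop ^^ i) (Hop w) = T i + z" by blast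
    have DT: "Dop (T i) = T (Suc i) + zmul (pair_scale (-1) ((Dop ^^ Suc (Suc i)) w))"
      unfolding T_def using Suc.prems Dop_zmul[OF DX[of "Suc (Suc i)"] obst[of "Suc (Suc i)"]]
      by (simp add: Dop_add Dop_scale zmul_scale pair_scale_add)
    have "Dop z \<in> low w (Suc (Suc i))"
      using Suc.prems by (intro Dop_low[OF z(1)] DX obst) auto
    then have "zmul (pair_scale (-1) ((Dop ^^ Suc (Suc i)) w)) + Dop z \<in> low w (Suc (Suc i))"
      by (intro low.intros) auto
    moreover have "(Dop ^^ Suc i) (Hop w) = T (Suc i)
        + (zmul (pair_scale (-1) ((Dop ^^ Suc (Suc i)) w)) + Dop z)"
      using z(2) by (simp add: Dop_add DT)
    ultimately show ?case by blast
  qed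
  have ob: "obst ((Dop ^^ i) (Hop w)) = 0" if "i < d - 1" for i
  proof -
    have "\<exists>z\<in>low w (Suc i). (Dop ^^ i) (Hop w) = T i + z"
      by (rule form) (use that in simp)
    then obtain z where z: "z \<in> low w (Suc i)" "(Dop ^^ i) (Hop w) = T i + z" by blast
    have "obst z = 0" using z(1) by (rule obst_low) (use that in \<open>auto intro: obst\<close>)
    moreover have "obst (T i) = 0" unfolding T_def by (simp add: Bop_add Bop_scale Bop_zmul)
    ultimately show ?thesis using z(2) by (simp add: Bop_add)
  qed
  have DY: "(Dop ^^ i) (Hop w) \<in> adm0" if "i \<le> d - 1" for i
    using that by (induction i) (use HY ob in \<open>auto intro: Dop_adm0\<close>)
  have "\<exists>c. (\<exists>i\<in>{..d - 1}. c i \<noteq> 0) \<and>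
      (\<Sum>i\<in>{..d - 1}. pair_scale (c i) ((Dop ^^ i) (Hop w))) = 0"
    by (intro adm0_dependent) (auto simp: DY)
  then obtain c where c: "\<exists>i\<in>{..d - 1}. c i \<noteq> 0"
    "(\<Sum>i\<in>{..d - 1}. pair_scale (c i) ((Dop ^^ i) (Hop w))) = 0" by blast
  define q where "q = (\<Sum>i\<le>d - 1. monom (c i) i)"
  have cq: "coeff q i = (if i \<le> d - 1 then c i else 0)" for i by (simp add: q_def coeff_sum)
  have dq: "degree q \<le> d - 1" by (intro degree_le) (simp add: cq)
  have "poly_Dop q (Hop w) = 0" unfolding poly_Dop_bound[OF dq] cq using c(2) by simp
  moreover have "q \<noteq> 0" using c(1) cq by (metis atMost_iff coeff_0)
  ultimately show False
    using no_relation[of "d - 1" "Hop w" q] DY ob nz dq by (auto simp: adm0_def)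
qed

theorem euler_intertwiner:
  "\<exists>w Q. (\<forall>i\<le>d. (Dop ^^ i) w \<in> adm) \<and> (\<forall>i<d. obst ((Dop ^^ i) w) = 0) \<and>
         degree Q = d \<and> poly_Dop Q w = (\<pi>, 0) \<and> Hop w = 0"
proof -
  obtain w where w: "w \<in> adm" "w \<noteq> 0" "\<forall>i<d. obst ((Dop ^^ i) w) = 0"
    using exists_unobstructed by blast
  then show ?thesis using exists_poly_Dop[of w] Hop_zero[of w] Dpow_adm[of w d] by blast
qed

end

section \<open>The intertwining operator\<close>

lemma linear_germ_operator_compose:
  assumes "linear_germ_operator S \<Phi>" "linear_germ_operator S \<Psi>"
  shows "linear_germ_operator S (\<lambda>f. \<Phi> (\<Psi> f))"
  unfolding linear_germ_operator_def
proof (intro ballI conjI allI impI)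
  fix z f h s t assume z: "z \<in> S"
  note \<Phi> = linear_germ_operatorD[OF assms(1) z] and \<Psi> = linear_germ_operatorD[OF assms(2) z]
  show "\<Phi> (\<Psi> f) analytic_on {z}" if "f analytic_on {z}" using that by (intro \<Phi> \<Psi>)
  show "germ_eq z (\<Phi> (\<Psi> f)) (\<Phi> (\<Psi> h))" if "germ_eq z f h" using that by (intro \<Phi> \<Psi>)
  assume f: "f analytic_on {z}" "h analytic_on {z}"
  have "germ_eq z (\<Phi> (\<Psi> (\<lambda>w. s * f w + t * h w))) (\<Phi> (\<lambda>w. s * \<Psi> f w + t * \<Psi> h w))"
    by (intro \<Phi>(2) \<Psi>(3) f)
  also have "germ_eq z \<dots> (\<lambda>w. s * \<Phi> (\<Psi> f) w + t * \<Phi> (\<Psi> h) w)"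
    by (intro \<Phi>(3) \<Psi>(1) f)
  finally show "germ_eq z (\<Phi> (\<Psi> (\<lambda>w. s * f w + t * h w))) (\<lambda>w. s * \<Phi> (\<Psi> f) w + t * \<Phi> (\<Psi> h) w)" .
qed

lemma linear_germ_operator_deriv: "linear_germ_operator S deriv"
  unfolding linear_germ_operator_def
proof (intro ballI conjI allI impI)
  fix z f h s t
  show "deriv f analytic_on {z}" if "f analytic_on {z}" using that by (rule analytic_deriv)
  show "germ_eq z (deriv f) (deriv h)" if "germ_eq z f h" using that by (rule germ_eq_deriv)
  assume f: "f analytic_on {z}" "h analytic_on {z}"
  obtain T1 where T1: "open T1" "z \<in> T1" "f holomorphic_on T1" using f(1)
      by (auto simp: analytic_at)
  obtain T2 where T2: "open T2" "z \<in> T2" "h holomorphic_on T2" using f(2)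
      by (auto simp: analytic_at)
  show "germ_eq z (deriv (\<lambda>w. s * f w + t * h w)) (\<lambda>w. s * deriv f w + t * deriv h w)"
    using T1 T2
    by (intro germ_eq_open[of "T1 \<inter> T2"] deriv_combination[of _ "T1 \<inter> T2"]) (auto intro:
        holomorphic_on_subset)
qed

lemma linear_germ_operator_id: "linear_germ_operator S (\<lambda>f. f)"
  by (simp add: linear_germ_operator_def)

lemma linear_germ_operator_mult_add:
  assumes "linear_germ_operator S \<Phi>" "linear_germ_operator S \<Psi>" "u analytic_on S" "v analytic_on S"
  shows "linear_germ_operator S (\<lambda>f z. u z * \<Phi> f z + v z * \<Psi> f z)"
  unfolding linear_germ_operator_def
proof (intro ballI conjI allI impI)
  fix z f h s t assume z: "z \<in> S"
  note \<Phi> = linear_germ_operatorD[OF assms(1) z] and \<Psi> = linear_germ_operatorD[OF assms(2) z]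
  have uv: "u analytic_on {z}" "v analytic_on {z}" using assms(3,4) z
      by (auto intro: analytic_on_subset)
  show "(\<lambda>z. u z * \<Phi> f z + v z * \<Psi> f z) analytic_on {z}" if "f analytic_on {z}"
    using that by (intro analytic_intros uv \<Phi> \<Psi>)
  show "germ_eq z (\<lambda>z. u z * \<Phi> f z + v z * \<Psi> f z) (\<lambda>z. u z * \<Phi> h z + v z * \<Psi> h z)"
      if "germ_eq z f h"
    using \<Phi>(2)[OF that] \<Psi>(2)[OF that] unfolding germ_eq_def by eventually_elim simp
  assume f: "f analytic_on {z}" "h analytic_on {z}"
  show "germ_eq z (\<lambda>z. u z * \<Phi> (\<lambda>w. s * f w + t * h w) z + v z * \<Psi> (\<lambda>w. s * f w + t * h w) z)
      (\<lambda>w. s * (u w * \<Phi> f w + v w * \<Psi> f w) + t * (u w * \<Phi> h w + v w * \<Psi> h w))"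
    using \<Phi>(3)[OF f, of s t] \<Psi>(3)[OF f, of s t] unfolding germ_eq_def
    by eventually_elim (simp add: algebra_simps)
qed

lemma linear_germ_operator_euler: "linear_germ_operator S euler_op"
proof -
  have "linear_germ_operator S (\<lambda>f z. z * deriv f z + 0 * f z)"
    by (intro linear_germ_operator_mult_add linear_germ_operator_deriv linear_germ_operator_id
        analytic_intros)
  moreover have "(\<lambda>f z. z * deriv f z + 0 * f z) = euler_op" by (simp add: euler_op_def fun_eq_iff)
  ultimately show ?thesis by simp
qed

lemma linear_germ_operator_euler_pow: "linear_germ_operator S (euler_op ^^ n)"
proof (induction n)
  case 0
  then show ?case using linear_germ_operator_id by (simp add: id_def)
next
  case (Suc n)
  then show ?case using linear_germ_operator_compose[OF linear_germ_operator_euler Suc]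
      by (simp add: o_def)
qed

lemma linear_germ_operator_poly_euler: "linear_germ_operator S (poly_euler_op Q)"
proof -
  have "linear_germ_operator S (\<lambda>f z. \<Sum>i\<le>n. coeff Q i * (euler_op ^^ i) f z)" for n
  proof (induction n)
    case 0
    have "linear_germ_operator S (\<lambda>f z. coeff Q 0 * f z + 0 * f z)"
      by (intro linear_germ_operator_mult_add linear_germ_operator_id analytic_intros)
    then show ?case by simp
  next
    case (Suc n)
    have "linear_germ_operator S (\<lambda>f z. 1 * (\<Sum>i\<le>n. coeff Q i * (euler_op ^^ i) f z)
        + coeff Q (Suc n) * (euler_op ^^ Suc n) f z)"
      by (intro linear_germ_operator_mult_add Suc linear_germ_operator_euler_pow analytic_intros)
    then show ?case by simp
  qed
  then show ?thesis by (simp add: poly_euler_op_def[abs_def])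
qed

section \<open>Products of powers of linear factors\<close>

lemma prod_linear_powers_dvd:
  fixes R :: "complex poly"
  assumes "finite J" "inj_on a J" "\<And>j. j \<in> J \<Longrightarrow> [:- a j, 1:] ^ n j dvd R"
  shows "(\<Prod>j\<in>J. [:- a j, 1:] ^ n j) dvd R"
  using assms
proof (induction J rule: finite_induct)
  case (insert c J)
  define T where "T = (\<Prod>j\<in>J. [:- a j, 1:] ^ n j)"
  have Tc: "poly T (a c) \<noteq> 0"
    using insert.hyps insert.prems(1) by (auto simp: T_def poly_prod poly_power inj_on_def)
  obtain S where S: "R = T * S" using insert unfolding T_def by (auto elim!: dvdE simp: inj_on_def)
  have "[:- a c, 1:] ^ n c dvd S"
  proof (cases "R = 0")
    case True
    then have "S = 0" using S Tc by auto
    then show ?thesis by simp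
  next
    case False
    then have "n c \<le> order (a c) R" using insert.prems(2)[of c] by (simp add: order_divides)
    also have "order (a c) R = order (a c) T + order (a c) S"
      unfolding S using False S by (intro order_mult) simp
    also have "order (a c) T = 0" using Tc by (rule order_0I)
    finally show ?thesis by (simp add: order_divides)
  qed
  then have "[:- a c, 1:] ^ n c * T dvd S * T" by (rule mult_dvd_mono) simp
  then show ?case using insert.hyps S by (simp add: T_def mult.commute)
qed simp

lemma prod_linear_monic:
  fixes a :: "'i \<Rightarrow> complex"
  assumes "finite J"
  shows "degree (\<Prod>j\<in>J. [:- a j, 1:] ^ n j) = sum n J"
    and "coeff (\<Prod>j\<in>J. [:- a j, 1:] ^ n j) (sum n J) = 1"
proof -
  have "(\<Prod>j\<in>J. [:- a j, 1:] ^ n j) \<noteq> 0" using assms by simp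
  show d: "degree (\<Prod>j\<in>J. [:- a j, 1:] ^ n j) = sum n J"
    by (subst degree_prod_eq_sum_degree) (auto simp: degree_linear_power)
  have "lead_coeff (\<Prod>j\<in>J. [:- a j, 1:] ^ n j) = 1"
    by (simp add: lead_coeff_prod lead_coeff_power)
  then show "coeff (\<Prod>j\<in>J. [:- a j, 1:] ^ n j) (sum n J) = 1" by (simp only: d)
qed

lemma pderiv_prod_linear:
  fixes a :: "'i \<Rightarrow> complex"
  assumes "finite J"
  shows "pderiv (\<Prod>j\<in>J. [:- a j, 1:] ^ m j) * (\<Prod>j\<in>J. [:- a j, 1:]) =
         (\<Sum>i\<in>J. smult (of_nat (m i)) (\<Prod>l\<in>J - {i}. [:- a l, 1:])) * (\<Prod>j\<in>J. [:- a j, 1:] ^ m j)"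
  unfolding pderiv_prod sum_distrib_right
proof (rule sum.cong)
  fix i assume i: "i \<in> J"
  show "(\<Prod>j\<in>J - {i}. [:- a j, 1:] ^ m j) * pderiv ([:- a i, 1:] ^ m i) * (\<Prod>j\<in>J. [:- a j, 1:])
      = smult (of_nat (m i)) (\<Prod>l\<in>J - {i}. [:- a l, 1:]) * (\<Prod>j\<in>J. [:- a j, 1:] ^ m j)"
  proof (cases "m i")
    case 0
    then show ?thesis by simp
  next
    case (Suc n)
    have "pderiv ([:- a i, 1:] ^ m i) = smult (of_nat (m i)) ([:- a i, 1:] ^ n)"
      unfolding Suc pderiv_power_Suc by (simp add: pderiv_pCons)
    then show ?thesis
      unfolding prod.remove[OF assms i, of "\<lambda>j. [:- a j, 1:]"] prod.remove[OF assms i, of "\<lambda>j.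
          [:- a j, 1:] ^ m j"]
      by (simp only: Suc power_Suc mult_smult_left mult_smult_right mult_ac)
  qed
qed simp


text \<open>The substitution G = z (z - 1) s clears the denominators of the Riccati equation for s =
  y' / y; x, y, w are the values of z, z - 1 and \<omega>.\<close>

lemma riccati_transform:
  fixes x s s' :: complex
  assumes "x \<noteq> 0" "y \<noteq> 0" "w \<noteq> 0"
    and s': "s' + s\<^sup>2 + p * s + q = 0" and p: "p = - (\<alpha> / x + \<beta> / y + M / w)" and q: "q
        = P / (x * y * w)"
    and G: "G = x * y * s" and G': "G' = (x + y) * s + x * y * s'"
  shows "x * y * (w * G' + P - G * M) + w * (G\<^sup>2 - ((\<beta> + 1) * x + (1 + \<alpha>) * y) * G) = 0"
proof -
  have 1: "x * y * w * p = - (\<alpha> * y * w + \<beta> * x * w + x * y * M)"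
    using assms(1-3) unfolding p by (simp add: field_simps)
  have 2: "x * y * w * q = P" using assms(1-3) unfolding q by simp
  have s'': "s' = - (s\<^sup>2 + p * s + q)"
    unfolding eq_neg_iff_add_eq_0 using s' by (simp only: add.assoc)
  have "x * y * w * G' = w * (x + y) * G - w * G\<^sup>2 - (x * y * w * p) * G - x * y * (x * y * w * q)"
    unfolding G' G s'' by (simp add: algebra_simps power2_eq_square)
  then have "x * y * w * G' = w * (x + y) * G - w * G\<^sup>2 + (\<alpha> * y * w + \<beta> * x * w + x * y * M) * G
      - x * y * P"
    unfolding 1 2 by algebra
  then show ?thesis by algebra
qed

text \<open>With t = z - a_j, an error of order m + 1 in G changes the expression only in order m +
  1: the derivative loses one power of t, but it is multiplied by w, which vanishes at t =
  0.\<close>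

lemma riccati_perturbation:
  fixes x y w :: complex
  assumes ric: "x * y * (w * G' + P - G * M) + w * (G\<^sup>2 - c * G) = 0"
    and w: "w = t * w1" and g: "g = G + t ^ Suc m * u"
    and g': "g' = G' + (of_nat (Suc m) * t ^ m * u + t ^ Suc m * u')"
  shows "x * y * (w * g' + P - g * M) + w * (g\<^sup>2 - c * g) =
     t ^ Suc m * (x * y * (w1 * (of_nat (Suc m) * u + t * u') - u * M) + w * (2 * G * u
         + t ^ Suc m * u\<^sup>2 - c * u))"
proof -
  have expand: "x * y * (w * (G' + E') + P - (G + E) * M) + w * ((G + E)\<^sup>2 - c * (G + E)) =
      (x * y * (w * G' + P - G * M) + w * (G\<^sup>2 - c * G))
      + x * y * (w * E' - E * M) + w * (2 * G * E + E\<^sup>2 - c * E)" for E E'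
    by algebra
  have "x * y * (w * g' + P - g * M) + w * (g\<^sup>2 - c * g) =
      (x * y * (w * G' + P - G * M) + w * (G\<^sup>2 - c * G))
      + x * y * (w * (of_nat (Suc m) * t ^ m * u + t ^ Suc m * u') - t ^ Suc m * u * M)
      + w * (2 * G * (t ^ Suc m * u) + (t ^ Suc m * u)\<^sup>2 - c * (t ^ Suc m * u))"
    unfolding g g' by (rule expand)
  also have "x * y * (w * (of_nat (Suc m) * t ^ m * u + t ^ Suc m * u') - t ^ Suc m * u * M)
     = t ^ Suc m * (x * y * (w1 * (of_nat (Suc m) * u + t * u') - u * M))"
    unfolding w by (simp add: algebra_simps del: of_nat_Suc)
  also have "w * (2 * G * (t ^ Suc m * u) + (t ^ Suc m * u)\<^sup>2 - c * (t ^ Suc m * u))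
     = t ^ Suc m * (w * (2 * G * u + t ^ Suc m * u\<^sup>2 - c * u))"
    by (simp add: algebra_simps power2_eq_square del: power_Suc)
  finally show ?thesis unfolding ric by (simp only: distrib_left add_0)
qed

lemma meromorphic_poly [meromorphic_intros]: "poly g meromorphic_on S" for g :: "complex poly"
  by (rule analytic_on_imp_meromorphic_on) simp

text \<open>\<open>rad_poly\<close>, \<open>mult_poly\<close> and \<open>log_poly\<close> are the
  \<omega>, \<pi> and M of \<open>euler_pairs\<close>.\<close>

definition rad_poly :: "nat \<Rightarrow> (nat \<Rightarrow> complex) \<Rightarrow> complex poly" where
  "rad_poly k a = (\<Prod>j\<in>{1..k}. [:- a j, 1:])"
definition mult_poly :: "nat \<Rightarrow> (nat \<Rightarrow> complex) \<Rightarrow> (nat \<Rightarrow> nat) \<Rightarrow> complex poly" where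
  "mult_poly k a m = (\<Prod>j\<in>{1..k}. [:- a j, 1:] ^ m j)"
definition log_poly :: "nat \<Rightarrow> (nat \<Rightarrow> complex) \<Rightarrow> (nat \<Rightarrow> nat) \<Rightarrow> complex poly" where
  "log_poly k a m = (\<Sum>i\<in>{1..k}. smult (of_nat (m i)) (\<Prod>l\<in>{1..k} - {i}. [:- a l, 1:]))"

lemma poly_rad_poly: "poly (rad_poly k a) z = (\<Prod>j\<in>{1..k}. z - a j)"
  by (simp add: rad_poly_def poly_prod)

lemma rad_poly_nonzero_iff: "poly (rad_poly k a) z \<noteq> 0 \<longleftrightarrow> z \<notin> a ` {1..k}"
  by (auto simp: poly_rad_poly)

lemma E_dom_eq_diff: "E_dom k a = H_dom - a ` {1..k}"
  by (auto simp: E_dom_def H_dom_def)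

lemma E_dom_iff: "z \<in> E_dom k a \<longleftrightarrow> z \<noteq> 0 \<and> z \<noteq> 1 \<and> poly (rad_poly k a) z \<noteq> 0"
  unfolding rad_poly_nonzero_iff by (auto simp: E_dom_def)

lemma open_E_dom: "open (E_dom k a)" and open_H_dom: "open H_dom"
  by (auto simp: E_dom_def H_dom_def intro!: open_Compl finite_imp_closed)

lemma E_p_eq: "z \<in> E_dom k a \<Longrightarrow> E_p \<alpha> \<beta> k a m z = - (\<alpha> / z + \<beta> / (z - 1)
    + poly (log_poly k a m) z / poly (rad_poly k a) z)"
proof -
  assume z: "z \<in> E_dom k a"
  have "(\<Sum>i=1..k. of_nat (m i) / (z - a i)) = poly (log_poly k a m) z / poly (rad_poly k a) z"
    unfolding log_poly_def poly_sum sum_divide_distrib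
  proof (rule sum.cong)
    fix i assume i: "i \<in> {1..k}"
    have "poly (rad_poly k a) z = (z - a i) * (\<Prod>l\<in>{1..k} - {i}. z - a l)"
      unfolding poly_rad_poly by (rule prod.remove[OF _ i]) simp
    moreover have "poly (rad_poly k a) z \<noteq> 0" using z E_dom_iff by blast
    ultimately show "of_nat (m i) / (z - a i) =
        poly (smult (of_nat (m i)) (\<Prod>l\<in>{1..k} - {i}. [:- a l, 1:])) z / poly (rad_poly k a) z"
      by (simp add: poly_prod del: prod_zero_iff)
  qed simp
  then show ?thesis by (simp add: E_p_def)
qed

lemma E_q_eq: "E_q k a P z = poly P z / (z * (z - 1) * poly (rad_poly k a) z)"
  by (simp add: E_q_def poly_rad_poly)

lemma E_holomorphic: "E_p \<alpha> \<beta> k a m holomorphic_on E_dom k a" "E_q k a P holomorphic_on E_dom k a"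
  unfolding E_p_def[abs_def] E_q_def[abs_def]
  by (auto intro!: holomorphic_intros analytic_imp_holomorphic[OF poly_analytic] simp: E_dom_def)

lemma E_meromorphic: "E_p \<alpha> \<beta> k a m meromorphic_on UNIV" "E_q k a P meromorphic_on UNIV"
  unfolding E_p_def[abs_def] E_q_def[abs_def] by (intro meromorphic_intros)+

lemma pderiv_mult_poly: "pderiv (mult_poly k a m) * (rad_poly k a)
    = (log_poly k a m) * (mult_poly k a m)"
  unfolding mult_poly_def rad_poly_def log_poly_def by (rule pderiv_prod_linear) simp

context
  fixes k :: nat and a :: "nat \<Rightarrow> complex" and m :: "nat \<Rightarrow> nat" and \<alpha> \<beta> :: complex and P ::
      "complex poly"
  assumes inj: "inj_on a {1..k}" and a01: "\<And>j. j \<in> {1..k} \<Longrightarrow> a j \<notin> {0, 1}"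
    and app: "\<And>j. j \<in> {1..k} \<Longrightarrow>
           apparent_singularity (E_dom k a) (E_p \<alpha> \<beta> k a m) (E_q k a P) (a j)"
begin

lemma local_riccati:
  assumes j: "j \<in> {1..k}"
  shows "\<exists>G. G analytic_on {a j} \<and> (\<forall>\<^sub>F z in at (a j).
     z * (z - 1) * (poly (rad_poly k a) z * deriv G z + poly P z - G z * poly (log_poly k a m) z)
       + poly (rad_poly k a) z * ((G z)\<^sup>2 - ((\<beta> + 1) * z + (1 + \<alpha>) * (z - 1)) * G z) = 0)"
proof -
  define p0 where "p0 z = - (\<alpha> / z + \<beta> / (z - 1) + (\<Sum>i\<in>{1..k} - {j}. of_nat (m i) / (z - a i)))"
      for z
  define q0 where "q0 z = poly P z / (z * (z - 1) * (\<Prod>i\<in>{1..k} - {j}. z - a i))" for z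
  have ne: "a j \<noteq> 0" "a j \<noteq> 1" using a01[OF j] by simp_all
  have ne': "a j - a i \<noteq> 0" if "i \<in> {1..k} - {j}" for i
    using inj_onD[OF inj, of j i] j that by force
  note ne = ne ne'
  have p0: "p0 analytic_on {a j}" unfolding p0_def using ne
    by (intro analytic_intros) auto
  have q0: "q0 analytic_on {a j}" unfolding q0_def
    using ne by (intro analytic_on_divide poly_analytic analytic_intros) auto
  have "E_p \<alpha> \<beta> k a m z = - of_nat (m j) / (z - a j) + p0 z" for z
    unfolding E_p_def p0_def by (subst sum.remove[OF _ j]) auto
  then have p: "\<forall>\<^sub>F z in at (a j). E_p \<alpha> \<beta> k a m z = - of_nat (m j) / (z - a j) + p0 z"
    by (intro always_eventually allI)
  have "E_q k a P z = q0 z / (z - a j)" for z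
    unfolding E_q_def q0_def by (subst prod.remove[OF _ j]) (auto simp: mult_ac)
  then have q: "\<forall>\<^sub>F z in at (a j). E_q k a P z = q0 z / (z - a j)"
    by (intro always_eventually allI)
  obtain s where s: "s analytic_on {a j}"
    "\<forall>\<^sub>F z in at (a j). deriv s z + (s z)\<^sup>2 + E_p \<alpha> \<beta> k a m z * s z + E_q k a P z = 0"
    by (rule apparent_riccati[OF app[OF j] p0 q0 p q E_meromorphic open_E_dom E_holomorphic])
  define G where "G z = z * (z - 1) * s z" for z
  have G: "G analytic_on {a j}" unfolding G_def using s by (intro analytic_intros)
  obtain T where T: "open T" "a j \<in> T" "s holomorphic_on T" using s(1) by (auto simp: analytic_at)
  define U where "U = T - ({0, 1} \<union> a ` ({1..k} - {j}))"
  have "a j \<notin> a ` ({1..k} - {j})" using ne(3) by force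
  then have U: "open U" "a j \<in> U"
    unfolding U_def using T ne(1,2) by (auto intro!: open_Diff finite_imp_closed)
  have "\<forall>\<^sub>F z in at (a j). z \<in> U - {a j}" using eventually_at_in_open[OF U] .
  with s(2) have "\<forall>\<^sub>F z in at (a j).
     z * (z - 1) * (poly (rad_poly k a) z * deriv G z + poly P z - G z * poly (log_poly k a m) z)
       + poly (rad_poly k a) z * ((G z)\<^sup>2 - ((\<beta> + 1) * z + (1 + \<alpha>) * (z - 1)) * G z) = 0"
  proof eventually_elim
    case (elim z)
    have z: "z \<in> E_dom k a" "z \<in> T" using elim(2) by (auto simp: U_def E_dom_def)
    have "(s has_field_derivative deriv s z) (at z)" using T z by (auto intro: holomorphic_derivI)
    then have "deriv G z = (z + (z - 1)) * s z + z * (z - 1) * deriv s z"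
      unfolding G_def[abs_def] by (intro DERIV_imp_deriv) (auto intro!: derivative_eq_intros
          simp: algebra_simps)
    then show ?case
      using z(1) elim(1) unfolding E_dom_iff
      by (intro riccati_transform[OF _ _ _ elim(1) E_p_eq[OF z(1)] E_q_eq]) (auto simp: G_def)
  qed
  with G show ?thesis by blast
qed

text \<open>The local solutions G j are interpolated to order m_j + 1 at a_j, which makes the
  expression divisible by (z - a_j)^(m_j + 1). The product of these powers is \<omega>
  \<pi>.\<close>

lemma exists_riccati_polynomial:
  "\<exists>g. (rad_poly k a) * (mult_poly k a m) dvd zvar * zvar1 * ((rad_poly k a) * pderiv g + P
      - g * (log_poly k a m))
       + (rad_poly k a) * (g^2 - ([:\<beta> + 1:] * zvar + [:1 + \<alpha>:] * zvar1) * g)"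
proof -
  have "\<forall>j\<in>{1..k}. \<exists>G. G analytic_on {a j} \<and> (\<forall>\<^sub>F z in at (a j).
     z * (z - 1) * (poly (rad_poly k a) z * deriv G z + poly P z - G z * poly (log_poly k a m) z)
       + poly (rad_poly k a) z * ((G z)\<^sup>2 - ((\<beta> + 1) * z + (1 + \<alpha>) * (z - 1)) * G z) = 0)"
    using local_riccati by blast
  from bchoice[OF this] obtain G where "\<forall>j\<in>{1..k}. G j analytic_on {a j} \<and> (\<forall>\<^sub>F z in at (a j).
     z * (z - 1) * (poly (rad_poly k a) z * deriv (G j) z + poly P z
         - G j z * poly (log_poly k a m) z)
       + poly (rad_poly k a) z * ((G j z)\<^sup>2 - ((\<beta> + 1) * z + (1 + \<alpha>) * (z - 1)) * G j z) = 0)"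
    by (elim exE)
  then have G: "\<And>j. j \<in> {1..k} \<Longrightarrow> G j analytic_on {a j}"
    "\<And>j. j \<in> {1..k} \<Longrightarrow> \<forall>\<^sub>F z in at (a j).
     z * (z - 1) * (poly (rad_poly k a) z * deriv (G j) z + poly P z
         - G j z * poly (log_poly k a m) z)
       + poly (rad_poly k a) z * ((G j z)\<^sup>2 - ((\<beta> + 1) * z + (1 + \<alpha>) * (z - 1)) * G j z) = 0"
    by (simp_all only: Ball_def)
  \<comment> \<open>\<open>hermite_interpolation\<close> is indexed by the nodes themselves;
    \<open>idx\<close> recovers j from a j.\<close>
  define idx where "idx = inv_into {1..k} a"
  have idx: "idx (a j) = j" if "j \<in> {1..k}" for j using inj that by (simp add: idx_def)
  have "\<exists>g. \<forall>c\<in>a ` {1..k}. \<exists>u. u analytic_on {c} \<and>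
      (\<forall>\<^sub>F z in nhds c. poly g z - G (idx c) z = (z - c) ^ Suc (m (idx c)) * u z)"
    using G(1) by (intro hermite_interpolation) (auto simp: idx)
  then obtain g where g': "\<forall>c\<in>a ` {1..k}. \<exists>u. u analytic_on {c} \<and>
      (\<forall>\<^sub>F z in nhds c. poly g z - G (idx c) z = (z - c) ^ Suc (m (idx c)) * u z)" by (elim exE)
  have g: "\<exists>u. u analytic_on {a j} \<and>
      (\<forall>\<^sub>F z in nhds (a j). poly g z - G j z = (z - a j) ^ Suc (m j) * u z)" if j: "j \<in> {1..k}"
          for j
    using bspec[OF g' imageI[OF j]] unfolding idx[OF j] .
  define R where "R = zvar * zvar1 * ((rad_poly k a) * pderiv g + P - g * (log_poly k a m))
       + (rad_poly k a) * (g^2 - ([:\<beta> + 1:] * zvar + [:1 + \<alpha>:] * zvar1) * g)"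
  have polyR: "poly R z = z * (z - 1) * (poly (rad_poly k a) z * poly (pderiv g) z + poly P z
      - poly g z * poly (log_poly k a m) z)
       + poly (rad_poly k a) z * ((poly g z)\<^sup>2 - ((\<beta> + 1) * z + (1 + \<alpha>) * (z
           - 1)) * poly g z)" for z
    by (simp add: R_def algebra_simps)
  have "[:- a j, 1:] ^ Suc (m j) dvd R" if j: "j \<in> {1..k}" for j
  proof -
    obtain u where u: "u analytic_on {a j}" "\<forall>\<^sub>F z in nhds (a j). poly g z - G j z = (z
        - a j) ^ Suc (m j) * u z"
      using g[OF j] by blast
    obtain w1 where w1: "(rad_poly k a) = [:- a j, 1:] * w1"
      unfolding rad_poly_def using prod.remove[OF _ j, of "\<lambda>j. [:- a j, 1:]"] by auto
    \<comment> \<open>The cofactor given by \<open>riccati_perturbation\<close>; it is continuous at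
      a j because \<open>u\<close>, its derivative and G j are.\<close>
    define v where "v z = z * (z - 1) * (poly w1 z * (of_nat (Suc (m j)) * u z + (z
        - a j) * deriv u z) - u z * poly (log_poly k a m) z)
       + poly (rad_poly k a) z * (2 * G j z * u z + (z - a j) ^ Suc (m j) * (u z)\<^sup>2 - ((\<beta>
           + 1) * z + (1 + \<alpha>) * (z - 1)) * u z)" for z
    have "isCont u (a j)" "isCont (deriv u) (a j)" "isCont (G j) (a j)"
      using u(1) G(1)[OF j] analytic_deriv[OF u(1)] by (auto intro: analytic_at_imp_isCont)
    then have v: "isCont v (a j)" unfolding v_def by (intro continuous_intros)
    obtain T1 where T1: "open T1" "a j \<in> T1" "u holomorphic_on T1" using u(1)
        by (auto simp: analytic_at)
    obtain T2 where T2: "open T2" "a j \<in> T2" "G j holomorphic_on T2" using G(1)[OF j]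
        by (auto simp: analytic_at)
    have "\<forall>\<^sub>F z in at (a j). z \<in> T1 \<inter> T2 - {a j}"
      using T1 T2 by (intro eventually_at_in_open) auto
    moreover have ev: "\<forall>\<^sub>F z in nhds (a j). poly g z = G j z + (z - a j) ^ Suc (m j) * u z"
      using u(2) by eventually_elim (simp add: algebra_simps)
    then have "\<forall>\<^sub>F z in at (a j). poly g z = G j z + (z - a j) ^ Suc (m j) * u z"
      by (simp add: eventually_at_filter eventually_mono)
    moreover note G(2)[OF j] eventually_at_deriv_cong[OF this]
    ultimately have "\<forall>\<^sub>F z in at (a j). poly R z = (z - a j) ^ Suc (m j) * v z"
    proof eventually_elim
      case (elim z)
      have "(u has_field_derivative deriv u z) (at z)" "(G j has_field_derivative deriv (G j) z)
          (at z)"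
        using elim(1) T1 T2 by (auto intro: holomorphic_derivI)
      then have "((\<lambda>z. G j z + (z - a j) ^ Suc (m j) * u z) has_field_derivative
          deriv (G j) z + (of_nat (Suc (m j)) * (z - a j) ^ m j * u z + (z
              - a j) ^ Suc (m j) * deriv u z)) (at z)"
        by (auto intro!: derivative_eq_intros simp del: of_nat_Suc power_Suc)
      then have "poly (pderiv g) z = deriv (G j) z + (of_nat (Suc (m j)) * (z - a j) ^ m j * u z
          + (z - a j) ^ Suc (m j) * deriv u z)"
        using elim(4) DERIV_imp_deriv[OF poly_DERIV[of g z]] by (simp add: DERIV_imp_deriv)
      moreover have "poly (rad_poly k a) z = (z - a j) * poly w1 z" unfolding w1
          by (simp add: algebra_simps)
      ultimately show ?case
        unfolding polyR v_def by (intro riccati_perturbation[OF elim(3) _ elim(2)])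
    qed
    then show ?thesis by (rule poly_dvd_if_analytic_factor[OF v])
  qed
  then have "(\<Prod>j\<in>{1..k}. [:- a j, 1:] ^ Suc (m j)) dvd R"
    by (intro prod_linear_powers_dvd inj) auto
  moreover have "(\<Prod>j\<in>{1..k}. [:- a j, 1:] ^ Suc (m j)) = (rad_poly k a) * (mult_poly k a m)"
    by (simp only: rad_poly_def mult_poly_def prod.distrib power_Suc)
  ultimately show ?thesis unfolding R_def by auto
qed

end

section \<open>The action of pairs on solutions\<close>

definition act :: "complex poly \<Rightarrow> complex poly \<times> complex poly \<Rightarrow> (complex \<Rightarrow> complex) \<Rightarrow> complex \<Rightarrow>
    complex" where
  "act \<pi> w y = (\<lambda>z. poly (fst w) z / poly \<pi> z * y z + (z
      - 1) * poly (snd w) z * z / poly \<pi> z * deriv y z)"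

lemma act_linear_germ_operator:
  assumes "\<And>z. z \<in> S \<Longrightarrow> poly \<pi> z \<noteq> 0"
  shows "linear_germ_operator S (act \<pi> w)"
  unfolding act_def[abs_def]
  by (intro linear_germ_operator_mult_add linear_germ_operator_id linear_germ_operator_deriv
        analytic_intros poly_analytic) (use assms in auto)

text \<open>The letters are values at z: r of \<pi>, c of \<omega>, and y0, y1, y2 of y, y', y''. In
  the coefficient of y, differentiating 1 / \<pi> contributes - U M / c and eliminating y''
  contributes - V P / c, together - N; in the coefficient of y' the two terms with M cancel.\<close>

lemma act_ring_identity:
  fixes z :: complex
  assumes nz: "z \<noteq> 0" "z \<noteq> 1" "c \<noteq> 0" "r \<noteq> 0"
    and ode: "y2 + p * y1 + q * y0 = 0"
    and p: "p = - (\<alpha> / z + \<beta> / (z - 1) + M / c)" and q: "q = P / (z * (z - 1) * c)"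
    and r: "r' * c = M * r" and N: "c * N = U * M + V * P"
  shows "z * (((U' * y0 + U * y1 + (z * V + (z - 1) * V + (z - 1) * z * V') * y1 + (z
      - 1) * z * V * y2) * r
            - (U * y0 + (z - 1) * z * V * y1) * r') / (r * r))
       = (z * (U' - N) * y0 + (U + (\<beta> + 1) * z * V + (z - 1) * (z * V' + (1
           + \<alpha>) * V)) * z * y1) / r"
proof -
  have 1: "c * ((z - 1) * z * p) = - (\<alpha> * (z - 1) * c + \<beta> * z * c + z * (z - 1) * M)"
    using nz unfolding p by (simp add: field_simps)
  have 2: "c * ((z - 1) * z * q) = P" using nz unfolding q by simp
  have y2: "y2 = - (p * y1 + q * y0)" unfolding eq_neg_iff_add_eq_0 using ode
      by (simp only: add.assoc)
  have 3: "c * ((z - 1) * z * V * y2) =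
      V * (\<alpha> * (z - 1) * c + \<beta> * z * c + z * (z - 1) * M) * y1 - V * P * y0"
  proof -
    have "c * ((z - 1) * z * V * y2) = - V * ((c * ((z - 1) * z * p)) * y1 + (c * ((z
        - 1) * z * q)) * y0)"
      unfolding y2 by algebra
    then show ?thesis unfolding 1 2 by algebra
  qed
  define L where "L = U' * y0 + U * y1 + (z * V + (z - 1) * V + (z - 1) * z * V') * y1 + (z
      - 1) * z * V * y2"
  define K where "K = U * y0 + (z - 1) * z * V * y1"
  define R where "R = z * (U' - N) * y0 + (U + (\<beta> + 1) * z * V + (z - 1) * (z * V' + (1
      + \<alpha>) * V)) * z * y1"
  have "c * (z * L - R) = z * K * M"
    using 3 N unfolding L_def K_def R_def by algebra
  then have "c * (z * (L * r - K * r')) = c * (R * r)"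
    using r by algebra
  then have "z * (L * r - K * r') = R * r" using nz(3) by simp
  then have "z * ((L * r - K * r') / (r * r)) = R / r"
    using nz(4) by (simp add: field_simps)
  then show ?thesis unfolding L_def K_def R_def .
qed

context euler_pairs
begin

lemma euler_act:
  assumes z: "z \<noteq> 0" "z \<noteq> 1" "poly \<omega> z \<noteq> 0" "poly \<pi> z \<noteq> 0"
    and y: "y holomorphic_on S" "open S" "z \<in> S"
    and ode: "deriv (deriv y) z + p * deriv y z + q * y z = 0"
    and p: "p = - (\<alpha> / z + \<beta> / (z - 1) + poly M z / poly \<omega> z)" and q: "q = poly P z / (z * (z
        - 1) * poly \<omega> z)"
    and w: "w \<in> adm"
  shows "euler_op (act \<pi> w y) z = (poly (Aop w) z * y z
      + poly (Bop w) z * z * deriv y z) / poly \<pi> z"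
proof -
  define U V where "U = fst w" and "V = snd w"
  have dy: "(y has_field_derivative deriv y z) (at z)" using y by (auto intro: holomorphic_derivI)
  have dy1: "(deriv y has_field_derivative deriv (deriv y) z) (at z)"
    using y by (auto intro!: holomorphic_derivI holomorphic_deriv)
  have "act \<pi> w y = (\<lambda>z. (poly U z * y z + (z - 1) * z * poly V z * deriv y z) / poly \<pi> z)"
    unfolding act_def U_def V_def by (simp add: fun_eq_iff add_divide_distrib mult_ac)
  moreover have "((\<lambda>z. (poly U z * y z + (z - 1) * z * poly V z * deriv y z) / poly \<pi> z)
      has_field_derivative
     ((poly (pderiv U) z * y z + poly U z * deriv y z + (z * poly V z + (z - 1) * poly V z + (z
         - 1) * z * poly (pderiv V) z) * deriv y z
        + (z - 1) * z * poly V z * deriv (deriv y) z) * poly \<pi> z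
            - (poly U z * y z + (z - 1) * z * poly V z * deriv y z) * poly (pderiv \<pi>) z) / (poly
                \<pi> z * poly \<pi> z)) (at z)"
    using z(4) by (auto intro!: derivative_eq_intros dy dy1 simp: algebra_simps)
  ultimately have "deriv (act \<pi> w y) z =
     ((poly (pderiv U) z * y z + poly U z * deriv y z + (z * poly V z + (z - 1) * poly V z + (z
         - 1) * z * poly (pderiv V) z) * deriv y z
        + (z - 1) * z * poly V z * deriv (deriv y) z) * poly \<pi> z
            - (poly U z * y z + (z - 1) * z * poly V z * deriv y z) * poly (pderiv \<pi>) z) / (poly
                \<pi> z * poly \<pi> z)"
    by (simp add: DERIV_imp_deriv)
  moreover have "poly (pderiv \<pi>) z * poly \<omega> z = poly M z * poly \<pi> z"
    using arg_cong[OF pderiv_pi, of "\<lambda>p. poly p z"] by simp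
  moreover have "poly \<omega> z * poly (Nop w) z = poly U z * poly M z + poly V z * poly P z"
    using arg_cong[OF Nop_eq[OF w], of "\<lambda>p. poly p z"] by (simp add: U_def V_def)
  moreover have "poly (Aop w) z = z * (poly (pderiv U) z - poly (Nop w) z)"
      by (simp add: Aop_def U_def)
  moreover have "poly (Bop w) z = poly U z + (\<beta> + 1) * z * poly V z + (z
      - 1) * (z * poly (pderiv V) z + (1 + \<alpha>) * poly V z)"
    by (simp add: Bop_def U_def V_def algebra_simps)
  ultimately show ?thesis
    unfolding euler_op_def using act_ring_identity[OF z ode p q] by simp
qed

lemma euler_act_step:
  assumes w: "w \<in> adm" "obst w = 0"
  shows "(poly (Aop w) z * y z + poly (Bop w) z * z * deriv y z) / poly \<pi> z = act \<pi> (Dop w) y z"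
  unfolding act_def Dop_snd[OF w(2), symmetric]
      by (simp add: Dop_def add_divide_distrib diff_divide_distrib algebra_simps)

context
  fixes p q :: "complex \<Rightarrow> complex" and S :: "complex set"
  assumes S: "open S" "\<And>z. z \<in> S \<Longrightarrow> z \<noteq> 0 \<and> z \<noteq> 1 \<and> poly \<omega> z \<noteq> 0 \<and> poly \<pi> z \<noteq> 0"
    and p: "\<And>z. z \<in> S \<Longrightarrow> p z = - (\<alpha> / z + \<beta> / (z - 1) + poly M z / poly \<omega> z)"
    and q: "\<And>z. z \<in> S \<Longrightarrow> q z = poly P z / (z * (z - 1) * poly \<omega> z)"
begin

lemma euler_act_germ:
  assumes b: "b \<in> S" and y: "local_solution p q b y" and w: "w \<in> adm"
  shows "germ_eq b (euler_op (act \<pi> w y)) (\<lambda>z. (poly (Aop w) z * y z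
      + poly (Bop w) z * z * deriv y z) / poly \<pi> z)"
proof -
  obtain T where T: "open T" "b \<in> T" "y holomorphic_on T"
    "\<And>z. z \<in> T \<Longrightarrow> deriv (deriv y) z + p z * deriv y z + q z * y z = 0"
    using y by (rule local_solution_openE) blast
  show ?thesis
  proof (rule germ_eq_open[of "S \<inter> T"])
    fix z assume z: "z \<in> S \<inter> T"
    show "euler_op (act \<pi> w y) z = (poly (Aop w) z * y z
        + poly (Bop w) z * z * deriv y z) / poly \<pi> z"
      by (rule euler_act[OF _ _ _ _ T(3,1) _ T(4) p q w]) (use z S in auto)
  qed (use S T b in auto)
qed

lemma euler_pow_act_germ:
  assumes b: "b \<in> S" and y: "local_solution p q b y"
    and X: "\<And>i. i \<le> n \<Longrightarrow> (Dop ^^ i) w \<in> adm" and obst: "\<And>i. i < n \<Longrightarrow> obst ((Dop ^^ i) w) = 0"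
  shows "i \<le> n \<Longrightarrow> germ_eq b ((euler_op ^^ i) (act \<pi> w y)) (act \<pi> ((Dop ^^ i) w) y)"
proof (induction i)
  case (Suc i)
  then have "germ_eq b ((euler_op ^^ i) (act \<pi> w y)) (act \<pi> ((Dop ^^ i) w) y)" by simp
  then have "germ_eq b (euler_op ((euler_op ^^ i) (act \<pi> w y))) (euler_op (act \<pi> ((Dop ^^ i) w) y))"
    by (rule linear_germ_operatorD(2)[OF linear_germ_operator_euler UNIV_I])
  also have "germ_eq b \<dots> (act \<pi> (Dop ((Dop ^^ i) w)) y)"
    using euler_act_germ[OF b y X[of i]] Suc.prems
    by (simp add: euler_act_step[OF X obst])
  finally show ?case by simp
qed simp

lemma act_sum: "act \<pi> (\<Sum>i\<in>I. pair_scale (c i) (w i)) y z = (\<Sum>i\<in>I. c i * act \<pi> (w i) y z)"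
proof (induction I rule: infinite_finite_induct)
  case (insert i I)
  have "act \<pi> (pair_scale s u + v) y z = s * act \<pi> u y z + act \<pi> v y z" for s u v
    by (simp add: act_def algebra_simps add_divide_distrib diff_divide_distrib)
  with insert show ?case by simp
qed (simp_all add: act_def)

lemma poly_euler_act_germ:
  assumes b: "b \<in> S" and y: "local_solution p q b y"
    and X: "\<And>i. i \<le> n \<Longrightarrow> (Dop ^^ i) w \<in> adm" and obst: "\<And>i. i < n \<Longrightarrow> obst ((Dop ^^ i) w) = 0"
    and Q: "degree Q \<le> n" "poly_Dop Q w = (\<pi>, 0)"
  shows "germ_eq b (poly_euler_op Q (act \<pi> w y)) y"
proof -
  have "\<forall>\<^sub>F z in nhds b. \<forall>i\<in>{..degree Q}. (euler_op ^^ i) (act \<pi> w y) z = act \<pi> ((Dop ^^ i) w) y z"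
    using euler_pow_act_germ[OF b y X obst] Q(1)
    by (intro eventually_ball_finite) (auto simp: germ_eq_def)
  moreover have "\<forall>\<^sub>F z in nhds b. z \<in> S" using S(1) b by (rule eventually_nhds_in_open)
  ultimately have "\<forall>\<^sub>F z in nhds b. poly_euler_op Q (act \<pi> w y) z = y z"
  proof eventually_elim
    case (elim z)
    have "poly_euler_op Q (act \<pi> w y) z = act \<pi> (poly_Dop Q w) y z"
      unfolding poly_euler_op_def poly_Dop_def act_sum using elim(1) by simp
    \<comment> \<open>The pair (\<pi>, 0) acts as the identity.\<close>
    also have "\<dots> = y z" unfolding Q act_def using S(2)[OF elim(2)] by simp
    finally show ?case .
  qed
  then show ?thesis by (simp add: germ_eq_def)
qed

lemma act_hypergeometric:
  assumes b: "b \<in> S" and y: "local_solution p q b y"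
    and w: "w \<in> adm" "obst w = 0" "Hop w = 0"
  shows "local_solution (H_p \<alpha> \<beta> d) (H_q \<gamma> \<delta>) b (act \<pi> w y)"
proof -
  define F where "F = act \<pi> w y"
  have lin: "linear_germ_operator S (act \<pi> w)" using S(2) by (intro act_linear_germ_operator) auto
  have ya: "\<forall>\<^sub>F z in nhds b. local_solution p q z y" by (rule local_solution_nearby[OF y])
  have inS: "\<forall>\<^sub>F z in nhds b. z \<in> S" using S(1) b by (rule eventually_nhds_in_open)
  define v where "v = Dop w"
  have v: "v \<in> adm" unfolding v_def by (rule Dop_adm[OF w(1,2)])
  have "germ_eq b (euler_op F) (act \<pi> v y)"
    using euler_act_germ[OF b y w(1)] by (simp add: euler_act_step[OF w(1,2)] F_def v_def)
  note 1 = germ_eq_nearby[OF this]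
  have eq: "\<forall>\<^sub>F z in nhds b. deriv (deriv F) z + H_p \<alpha> \<beta> d z * deriv F z + H_q \<gamma> \<delta> z * F z = 0"
    using 1 ya inS
  proof eventually_elim
    case (elim z)
    note z = S(2)[OF elim(3)]
    have Fa: "F analytic_on {z}"
      unfolding F_def using linear_germ_operatorD(1)[OF lin elim(3) local_solution_analytic[OF
          elim(2)]] .
    have zF': "z * deriv F z = act \<pi> v y z" using germ_eq_at[OF elim(1)] by (simp add: euler_op_def)
    have "germ_eq z (euler_op (euler_op F)) (euler_op (act \<pi> v y))"
      using elim(1) by (rule linear_germ_operatorD(2)[OF linear_germ_operator_euler UNIV_I])
    also have "germ_eq z \<dots> (\<lambda>z. (poly (Aop v) z * y z + poly (Bop v) z * z * deriv y z) / poly \<pi> z)"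
      by (rule euler_act_germ[OF elim(3,2) v])
    finally have "euler_op (euler_op F) z = (poly (Aop v) z * y z
        + poly (Bop v) z * z * deriv y z) / poly \<pi> z"
      by (rule germ_eq_at)
    moreover have "euler_op (euler_op F) z = z * (deriv F z + z * deriv (deriv F) z)"
    proof -
      have "(deriv F has_field_derivative deriv (deriv F) z) (at z)"
        by (rule analytic_derivI[OF analytic_deriv[OF Fa]])
      then have "deriv (\<lambda>z. z * deriv F z) z = deriv F z + z * deriv (deriv F) z"
        by (intro DERIV_imp_deriv) (auto intro!: derivative_eq_intros)
      then show ?thesis by (simp add: euler_op_def)
    qed
    ultimately have zF'': "z * (deriv F z + z * deriv (deriv F) z) * poly \<pi> z
        = poly (Aop v) z * y z + poly (Bop v) z * z * deriv y z" using z by simp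
    have zF'\<pi>: "z * deriv F z * poly \<pi> z = poly (fst v) z * y z + (z
        - 1) * poly (snd v) z * z * deriv y z"
      unfolding zF' act_def using z by (simp add: field_simps)
    have F\<pi>: "F z * poly \<pi> z = poly (fst w) z * y z + (z - 1) * poly (snd w) z * z * deriv y z"
      unfolding F_def act_def using z by (simp add: field_simps)
    have "fst (Hop w) = 0" "snd (Hop w) = 0" using w(3) by simp_all
    then have "poly (fst (Hop w)) z = 0" "poly (snd (Hop w)) z = 0" by simp_all
    then have h: "- ((z - 1) * poly (Aop v) z) + ((\<gamma> + \<delta>) * z - (\<alpha> + 1)) * poly (fst v) z
        - \<gamma> * \<delta> * z * poly (fst w) z = 0"
      "- poly (Bop v) z + ((\<gamma> + \<delta>) * z - (\<alpha> + 1)) * poly (snd v) z - \<gamma> * \<delta> * z * poly (snd w) z = 0"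
      by (simp_all add: Hop_def v_def algebra_simps)
    \<comment> \<open>The left side is a combination of y and z y' with coefficients fst (Hop w) and
      (z - 1) snd (Hop w).\<close>
    have "(- ((z - 1) * (z * (deriv F z + z * deriv (deriv F) z))) + ((\<gamma> + \<delta>) * z - (\<alpha>
        + 1)) * (z * deriv F z)
        - \<gamma> * \<delta> * z * F z) * poly \<pi> z = 0"
      using zF'' zF'\<pi> F\<pi> h by algebra
    then have *: "- ((z - 1) * (z * (deriv F z + z * deriv (deriv F) z))) + ((\<gamma> + \<delta>) * z - (\<alpha>
        + 1)) * (z * deriv F z)
        - \<gamma> * \<delta> * z * F z = 0" using z by simp
    \<comment> \<open>The prefactor is z^2 (1 - z), and z^2 F'' = D^2 F - D F. The Fuchs relation
      turns 1 + \<alpha> + \<beta> + d into \<gamma> + \<delta>.\<close>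
    have "(- (z - 1) * z * z) * (deriv (deriv F) z + H_p \<alpha> \<beta> d z * deriv F z + H_q \<gamma> \<delta> z * F z)
      = - ((z - 1) * (z * (deriv F z + z * deriv (deriv F) z))) + ((\<gamma> + \<delta>) * z - (\<alpha>
          + 1)) * (z * deriv F z)
        - \<gamma> * \<delta> * z * F z"
    proof -
      have "(z - 1) * z * z * H_p \<alpha> \<beta> d z = - (\<alpha> * (z - 1) * z + (\<beta> + of_nat d) * z * z)"
        unfolding H_p_def using z by (simp add: field_simps)
      moreover have "(z - 1) * z * z * H_q \<gamma> \<delta> z = \<gamma> * \<delta> * z" unfolding H_q_def using z by simp
      ultimately show ?thesis unfolding fuchs by algebra
    qed
    with * z show ?case by simp
  qed
  have "F analytic_on {b}"
    unfolding F_def using linear_germ_operatorD(1)[OF lin b local_solution_analytic[OF y]] .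
  with eq show ?thesis unfolding local_solution_def F_def by blast
qed

end

end


section \<open>Application to (E) and (H)\<close>

lemma H_holomorphic: "H_p \<alpha> \<beta> d holomorphic_on H_dom" "H_q \<gamma> \<delta> holomorphic_on H_dom"
  unfolding H_p_def[abs_def] H_q_def[abs_def] H_dom_def by (auto intro!: holomorphic_intros)

lemma exists_intertwining_operators:
  fixes k d :: nat and a :: "nat \<Rightarrow> complex" and m :: "nat \<Rightarrow> nat"
    and \<alpha> \<beta> \<gamma> \<delta> :: complex and P R :: "complex poly"
  assumes k: "k \<ge> 1"
    and inj: "inj_on a {1..k}"
    and a01: "\<And>j. j \<in> {1..k} \<Longrightarrow> a j \<notin> {0, 1}"
    and m: "\<And>j. j \<in> {1..k} \<Longrightarrow> m j > 0"
    and d: "d = (\<Sum>j=1..k. m j)"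
    and fuchs: "\<gamma> + \<delta> = \<alpha> + \<beta> + 1 + of_nat d"
    and P: "P = monom (\<gamma> * \<delta>) k + R" "degree R \<le> k - 1"
    and app: "\<And>j. j \<in> {1..k} \<Longrightarrow>
           apparent_singularity (E_dom k a) (E_p \<alpha> \<beta> k a m) (E_q k a P) (a j)"
    and nonres: "\<And>n. n \<in> {0..<d} \<Longrightarrow> of_nat n \<notin> {\<gamma>, \<delta>, \<gamma> - \<alpha> - 1, \<delta> - \<alpha> - 1}"
  shows "\<exists>\<Phi> Q. linear_germ_operator (E_dom k a) \<Phi> \<and> degree Q = d \<and>
    (\<forall>b\<in>E_dom k a. \<forall>y. local_solution (E_p \<alpha> \<beta> k a m) (E_q k a P) b y \<longrightarrow>
        local_solution (H_p \<alpha> \<beta> d) (H_q \<gamma> \<delta>) b (\<Phi> y) \<and> germ_eq b (poly_euler_op Q (\<Phi> y)) y)"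
proof -
  obtain g where g: "rad_poly k a * mult_poly k a m dvd zvar * zvar1 * (rad_poly k a * pderiv g
      + P - g * log_poly k a m)
       + rad_poly k a * (g^2 - ([:\<beta> + 1:] * zvar + [:1 + \<alpha>:] * zvar1) * g)"
    using exists_riccati_polynomial[OF inj a01 app] by blast
  have W1: "rad_poly k a = (\<Prod>j\<in>{1..k}. [:- a j, 1:] ^ 1)" by (simp add: rad_poly_def)
  interpret euler_pairs d k \<alpha> \<beta> \<gamma> \<delta> "mult_poly k a m" "rad_poly k a" "log_poly k a m" P g
  proof
    have "m 1 \<le> d" unfolding d using k by (intro member_le_sum) auto
    then show "d \<ge> 1" using m[of 1] k by auto
    show "degree (mult_poly k a m) = d" "coeff (mult_poly k a m) d = 1"
      unfolding mult_poly_def d by (rule prod_linear_monic; simp)+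
    show "degree (rad_poly k a) = k" "coeff (rad_poly k a) k = 1"
      unfolding W1 using prod_linear_monic[of "{1..k}" a "\<lambda>_. 1"] by simp_all
    show "rad_poly k a dvd mult_poly k a m"
      unfolding rad_poly_def mult_poly_def using m by (intro prod_dvd_prod dvd_power) auto
    show "pderiv (mult_poly k a m) * rad_poly k a = log_poly k a m * mult_poly k a m"
        by (rule pderiv_mult_poly)
    show "poly (mult_poly k a m) 0 \<noteq> 0" "poly (mult_poly k a m) 1 \<noteq> 0"
      using a01 by (force simp: mult_poly_def poly_prod poly_power)+
    have "degree (monom (\<gamma> * \<delta>) k) \<le> k" by (rule degree_monom_le)
    then show "degree P \<le> k" unfolding P(1) using P(2) by (intro degree_add_le) auto
    show "coeff P k = \<gamma> * \<delta>" unfolding P(1) using P(2) k by (simp add: coeff_eq_0)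
    show "rad_poly k a * mult_poly k a m dvd zvar * zvar1 * (rad_poly k a * pderiv g + P
        - g * log_poly k a m)
       + rad_poly k a * (g^2 - ([:\<beta> + 1:] * zvar + [:1 + \<alpha>:] * zvar1) * g)" by (rule g)
    show "of_nat n \<notin> {\<gamma>, \<delta>, \<gamma> - \<alpha> - 1, \<delta> - \<alpha> - 1}" if "n < d" for n
      using nonres[of n] that by simp
  qed (use k fuchs in auto)
  obtain w Q where w: "\<And>i. i \<le> d \<Longrightarrow> (Dop ^^ i) w \<in> adm" "\<And>i. i < d \<Longrightarrow> obst ((Dop ^^ i) w) = 0"
    and Q: "degree Q = d" "poly_Dop Q w = (mult_poly k a m, 0)" and H: "Hop w = 0"
    using euler_intertwiner by blast
  have mult_nz: "poly (mult_poly k a m) z \<noteq> 0" if "z \<in> E_dom k a" for z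
    using that by (auto simp: E_dom_def mult_poly_def poly_prod poly_power)
  have S: "z \<noteq> 0 \<and> z \<noteq> 1 \<and> poly (rad_poly k a) z \<noteq> 0 \<and> poly (mult_poly k a m) z \<noteq> 0"
      if "z \<in> E_dom k a" for z
    using that mult_nz[OF that] E_dom_iff by blast
  show ?thesis
  proof (intro exI[of _ "act (mult_poly k a m) w"] exI[of _ Q] conjI ballI allI impI)
    show "linear_germ_operator (E_dom k a) (act (mult_poly k a m) w)"
      using mult_nz by (rule act_linear_germ_operator)
    fix b y assume b: "b \<in> E_dom k a" and y: "local_solution (E_p \<alpha> \<beta> k a m) (E_q k a P) b y"
    show "local_solution (H_p \<alpha> \<beta> d) (H_q \<gamma> \<delta>) b (act (mult_poly k a m) w y)"
      by (rule act_hypergeometric[OF open_E_dom S E_p_eq E_q_eq b y]) (use w(1)[of 0] w(2)[of 0]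
          d_pos H in auto)
    show "germ_eq b (poly_euler_op Q (act (mult_poly k a m) w y)) y"
      by (rule poly_euler_act_germ[OF open_E_dom S E_p_eq E_q_eq b y w _ Q(2)]) (use Q in auto)
  qed (rule Q)
qed

theorem theorem2p1:
  fixes k d :: nat and a :: "nat \<Rightarrow> complex" and m :: "nat \<Rightarrow> nat"
    and \<alpha> \<beta> \<gamma> \<delta> :: complex and P R :: "complex poly"
  assumes "k \<ge> 1"
    and "inj_on a {1..k}"
    and "\<And>j. j \<in> {1..k} \<Longrightarrow> a j \<notin> {0, 1}"
    and "\<And>j. j \<in> {1..k} \<Longrightarrow> m j > 0"
    and "d = (\<Sum>j=1..k. m j)"
    and "\<gamma> + \<delta> = \<alpha> + \<beta> + 1 + of_nat d"
    and "P = monom (\<gamma> * \<delta>) k + R" and "degree R \<le> k - 1"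
    and "\<And>j. j \<in> {1..k} \<Longrightarrow>
           apparent_singularity (E_dom k a) (E_p \<alpha> \<beta> k a m) (E_q k a P) (a j)"
    and "\<And>n. n \<in> {0..<d} \<Longrightarrow> of_nat n \<notin> {\<gamma>, \<delta>, \<gamma> - \<alpha> - 1, \<delta> - \<alpha> - 1}"
  shows
    "(\<exists>Q :: complex poly. degree Q = d \<and>
        (\<forall>b \<in> E_dom k a. \<forall>y.
           multivalued_solution (E_dom k a) (E_p \<alpha> \<beta> k a m) (E_q k a P) b y \<longrightarrow>
           (\<exists>F. multivalued_solution H_dom (H_p \<alpha> \<beta> d) (H_q \<gamma> \<delta>) b F \<and>
              (\<forall>g. path_from (E_dom k a) b g \<longrightarrow>
                 germ_eq (pathfinish g) (y g) (poly_euler_op Q (F g)))))) \<and>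
     (\<forall>b \<in> E_dom k a. \<exists>Y Z.
        solution_basis (E_p \<alpha> \<beta> k a m) (E_q k a P) b Y \<and>
        solution_basis (H_p \<alpha> \<beta> d) (H_q \<gamma> \<delta>) b Z \<and>
        monodromy_group (E_dom k a) b Y = monodromy_group H_dom b Z)"
proof -
  let ?p = "E_p \<alpha> \<beta> k a m" and ?q = "E_q k a P" and ?hp = "H_p \<alpha> \<beta> d" and ?hq = "H_q \<gamma> \<delta>"
  obtain \<Phi> Q where lin: "linear_germ_operator (E_dom k a) \<Phi>" and Q: "degree Q = d"
    and \<Phi>: "\<And>b y. b \<in> E_dom k a \<Longrightarrow> local_solution ?p ?q b y \<Longrightarrow>
        local_solution ?hp ?hq b (\<Phi> y) \<and> germ_eq b (poly_euler_op Q (\<Phi> y)) y"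
    using exists_intertwining_operators[OF assms] by blast
  have linQ: "linear_germ_operator (E_dom k a) (poly_euler_op Q)"
      by (rule linear_germ_operator_poly_euler)
  have sub: "E_dom k a \<subseteq> H_dom" by (auto simp: E_dom_def H_dom_def)
  have "\<exists>F. multivalued_solution H_dom ?hp ?hq b F \<and>
      (\<forall>g. path_from (E_dom k a) b g \<longrightarrow> germ_eq (pathfinish g) (y g) (poly_euler_op Q (F g)))"
    if b: "b \<in> E_dom k a" and y: "multivalued_solution (E_dom k a) ?p ?q b y" for b y
  proof -
    \<comment> \<open>\<open>linepath b b\<close> and \<open>subpath 0 0 g\<close> are both this
      constant function, so \<open>y0\<close> is the initial germ for every path
      \<open>g\<close>.\<close>
    define y0 where "y0 = y (\<lambda>_. b)"
    have "path_from (E_dom k a) b (linepath b b)" using b by (simp add: path_from_def)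
    then have "local_solution ?p ?q (pathfinish (linepath b b)) (y (linepath b b))"
      using y unfolding multivalued_solution_def by blast
    then have "local_solution ?p ?q b y0" by (simp add: y0_def linepath_refl pathfinish_def)
    then have "local_solution ?hp ?hq b (\<Phi> y0)" using \<Phi>[OF b] by blast
    then obtain F where F: "multivalued_solution H_dom ?hp ?hq b F"
      "\<And>g f. path_from H_dom b g \<Longrightarrow> analytic_continuation_along g f \<Longrightarrow> germ_eq b (f 0) (\<Phi> y0) \<Longrightarrow>
        germ_eq (pathfinish g) (F g) (f 1)"
      by (rule multivalued_solution_exists[OF open_H_dom H_holomorphic]) blast
    have "germ_eq (pathfinish g) (y g) (poly_euler_op Q (F g))" if g: "path_from (E_dom k a) b g"
        for g
    proof -
      have g': "path_image g \<subseteq> E_dom k a" "g 0 = b" using g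
          by (auto simp: path_from_def pathstart_def)
      have e: "pathfinish g \<in> E_dom k a" using g' by auto
      have yg: "analytic_continuation_along g (\<lambda>t. y (subpath 0 t g))" "local_solution ?p ?q
          (pathfinish g) (y g)"
        using y g unfolding multivalued_solution_def by blast+
      \<comment> \<open>Both sides arise from the germ \<Phi> y0 by continuation along
        \<open>g\<close>: the left one by the choice of F, the right one because \<Phi> commutes
        with continuation.\<close>
      have "germ_eq (pathfinish g) (F g) (\<Phi> (y (subpath 0 1 g)))"
      proof (rule F(2))
        show "path_from H_dom b g" using g sub by (auto simp: path_from_def)
        show "analytic_continuation_along g (\<lambda>t. \<Phi> (y (subpath 0 t g)))"
          by (rule linear_germ_operator_continuation[OF lin g'(1) yg(1)])
        have "subpath 0 0 g = (\<lambda>_. b)" using g'(2) by (simp add: subpath_def)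
        then show "germ_eq b (\<Phi> (y (subpath 0 0 g))) (\<Phi> y0)" by (simp add: y0_def)
      qed
      then have "germ_eq (pathfinish g) (poly_euler_op Q (F g)) (poly_euler_op Q (\<Phi> (y g)))"
        unfolding subpath_0_1 by (rule linear_germ_operatorD(2)[OF linQ e])
      also have "germ_eq (pathfinish g) \<dots> (y g)" using \<Phi>[OF e yg(2)] by blast
      finally show ?thesis by (rule germ_eq_sym)
    qed
    with F(1) show ?thesis by blast
  qed
  moreover have "\<exists>Y Z. solution_basis ?p ?q b Y \<and> solution_basis ?hp ?hq b Z \<and>
      monodromy_group (E_dom k a) b Y = monodromy_group H_dom b Z" if b: "b \<in> E_dom k a" for b
  proof -
    have pq: "?p analytic_on {b}" "?q analytic_on {b}"
      by (rule holomorphic_on_imp_analytic_at[OF _ open_E_dom b] E_holomorphic)+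
    have hpq: "?hp analytic_on {b}" "?hq analytic_on {b}"
      by (rule holomorphic_on_imp_analytic_at[OF _ open_H_dom subsetD[OF sub b]] H_holomorphic)+
    obtain Y where Y: "solution_basis ?p ?q b Y" using exists_solution_basis[OF pq] by blast
    then have Ysol: "\<And>i. local_solution ?p ?q b (Y i)" and Yind: "germs_independent b Y"
      by (auto simp: solution_basis_def)
    have an: "Y i analytic_on {b}" for i using Ysol by (rule local_solution_analytic)
    have "solution_basis ?hp ?hq b (\<lambda>i. \<Phi> (Y i))"
    proof (rule solution_basis_if_independent[OF hpq])
      show "local_solution ?hp ?hq b (\<Phi> (Y i))" for i using \<Phi>[OF b Ysol] by blast
      \<comment> \<open>Q(D) is a left inverse of \<Phi> on solutions and carries a relation among
        the \<Phi> (Y i) back to the Y i.\<close>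
      show "germs_independent b (\<lambda>i. \<Phi> (Y i))" unfolding germs_independent_def
      proof (intro allI impI)
        fix c and i :: 2
        assume 0: "germ_eq b (\<lambda>z. \<Sum>i\<in>UNIV. c i * \<Phi> (Y i) z) (\<lambda>_. 0)"
        have "germ_eq b (\<lambda>z. c 1 * Y 1 z + c 2 * Y 2 z) (\<lambda>z. c 1 * poly_euler_op Q (\<Phi> (Y 1)) z
            + c 2 * poly_euler_op Q (\<Phi> (Y 2)) z)"
          using conjunct2[OF \<Phi>[OF b Ysol[of 1]]] conjunct2[OF \<Phi>[OF b Ysol[of 2]]]
          unfolding germ_eq_def by eventually_elim simp
        also have "germ_eq b \<dots> (poly_euler_op Q (\<lambda>z. c 1 * \<Phi> (Y 1) z + c 2 * \<Phi> (Y 2) z))"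
          by (rule germ_eq_sym, rule linear_germ_operatorD(3)[OF linQ b])
             (rule linear_germ_operatorD(1)[OF lin b an])+
        also have "germ_eq b \<dots> (poly_euler_op Q (\<lambda>_. 0))"
          using linear_germ_operatorD(2)[OF linQ b 0] by (simp add: sum_2)
        also have "germ_eq b \<dots> (\<lambda>_. 0)"
          using linear_germ_operatorD(3)[OF linQ b, of "\<lambda>_. 0" "\<lambda>_. 0" 0 0] by simp
        finally have "germ_eq b (\<lambda>z. \<Sum>i\<in>UNIV. c i * Y i z) (\<lambda>_. 0)" by (simp add: sum_2)
        then show "c i = 0" using Yind unfolding germs_independent_def by blast
      qed
    qed
    moreover have "monodromy_group (E_dom k a) b Y = monodromy_group H_dom b (\<lambda>i. \<Phi> (Y i))"
    proof -
      note E = E_dom_eq_diff[of k a]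
      have "finite (a ` {1..k})" by simp
      from monodromy_group_eq[where Y = Y and \<Phi> = \<Phi> and \<Psi> = "poly_euler_op Q" and b = b,
          OF open_H_dom this, folded E, OF b lin linQ an conjunct2[OF \<Phi>[OF b Ysol]]]
      show ?thesis .
    qed
    ultimately show ?thesis using Y by blast
  qed
  ultimately show ?thesis using Q by blast
qed

end
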